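(* Let $c_0=0$ and let $(\theta,\rho)$ be a global solution of the flow (F) (with admissible initial datum). Then both the number of zeros in $[0,L)$ of the curvature $\kappa(t,\cdot)=\partial_s\theta(t,\cdot)$ and the number of inflection points of the associated curve at time $t$ are nonincreasing functions of $t\in[0,\infty)$ (with values in $\mathbb{N}_0\cup\{\infty\}$).
   Context: Fixed parameters: $L>0$, $\nu\in\mathbb{R}$, $\mu>0$, $\omega\in\mathbb{Z}$, $c_0\in\mathbb{R}$, and $\beta\in C^\infty(\mathbb{R})$ with $\beta>0$. A function $\theta:[0,L]\to\mathbb{R}$ is the inclination angle of the arc-length parametrized planar curve $\gamma(s)=\gamma(0)+\int_0^s(\cos\theta,\sin\theta)\,\mathrm{d}r$, with curvature $\kappa=\partial_s\theta$; $\rho:[0,L]\to\mathbb{R}$ is a density. The flow (F) is the initial boundary value problem $$\partial_t\theta=\partial_s\big(\beta(\rho)(\partial_s\theta-c_0)\big)+\lambda_{\theta1}\sin\theta-\lambda_{\theta2}\cos\theta,\qquad \partial_t\rho=\mu\,\partial_s^2\rho-\tfrac12\beta'(\rho)(\partial_s\theta-c_0)^2-\lambda_\rho$$ on $(0,T)\times[0,L]$, with boundary conditions $\theta(\cdot,L)-\theta(\cdot,0)=2\pi\omega$, $\rho(\cdot,L)=\rho(\cdot,0)$, $\partial_s\theta(\cdot,L)=\partial_s\theta(\cdot,0)$, $\partial_s\rho(\cdot,L)=\partial_s\rho(\cdot,0)$, and initial condition $(\theta,\rho)(0,\cdot)=(\theta_0,\rho_0)$. The nonlocal multipliers are $$\begin{pmatrix}\lambda_{\theta1}\\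 \lambda_{\theta2}\end{pmatrix}(t)=\Pi^{-1}(\theta)\int_0^L\begin{pmatrix}\cos\theta\\ \sin\theta\end{pmatrix}\partial_s\theta\,\beta(\rho)(\partial_s\theta-c_0)\,\mathrm{d}s,\quad \Pi(\theta)=\begin{pmatrix}\int_0^L\sin^2\theta\,\mathrm{d}s&-\int_0^L\cos\theta\sin\theta\,\mathrm{d}s\\-\int_0^L\cos\theta\sin\theta\,\mathrm{d}s&\int_0^L\cos^2\theta\,\mathrm{d}s\end{pmatrix},$$ $\lambda_\rho(t)=-\frac1{2L}\int_0^L\beta'(\rho)(\partial_s\theta-c_0)^2\,\mathrm{d}s$. An admissible initial datum is $(\theta_0,\rho_0)\in C^\infty([0,L])$ with $\int_0^L\rho_0\,\mathrm{d}s=\nu L$, $\int_0^L\sin\theta_0\,\mathrm{d}s=\int_0^L\cos\theta_0\,\mathrm{d}s=0$, $\theta_0(L)-\theta_0(0)=2\pi\omega$, $\rho_0(L)=\rho_0(0)$, and $\partial_s^j\theta_0(L)=\partial_s^j\theta_0(0)$, $\partial_s^j\rho_0(L)=\partial_s^j\rho_0(0)$ for $j=1,2$. By earlier work, for each admissible initial datum (F) has a unique global solution $(\theta,\rho)\in C^\infty((0,\infty)\times[0,L])\cap C^0([0,\infty);C^2([0,L]))$, and for $t>0$ the functions $\partial_s\theta(t,\cdot)$ and $\rho(t,\cdot)$ extend to smooth $L$-periodic functions on $\mathbb{R}$. "Global solution" means this solution. Inflection points at time $t$ are the sign-changing zeros in $[0,L)$ of the $L$-periodic extension of $\kappa(t,\cdot)$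 to $\mathbb{R}$. Their number is the number of sign changes of $\kappa(t,\cdot)$ over one period: the supremum of all $m\in\mathbb{N}$ for which there are $s_1<\dots<s_m<s_{m+1}=s_1+L$ with $\kappa(t,s_i)\kappa(t,s_{i+1})<0$ for $i=1,\dots,m$ (and $0$ if no such $m$ exists). In particular an interval of zeros across which the sign changes counts once. *)

theory Defs
  imports "HOL-Analysis.Analysis" "HOL-Library.Real_Mod" "HOL-Library.Extended_Nat"
begin

text \<open>Relative to \<^term>\<open>{0..L}\<close> this is the one-sided derivative at the end points.\<close>

definition deriv_within :: "real set \<Rightarrow> (real \<Rightarrow> real) \<Rightarrow> real \<Rightarrow> real" where
  "deriv_within S f x = vector_derivative f (at x within S)"

definition Ck_on :: "nat \<Rightarrow> real set \<Rightarrow> (real \<Rightarrow> real) \<Rightarrow> bool" where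
  "Ck_on k S f \<longleftrightarrow>
     (\<forall>j<k. ((deriv_within S ^^ j) f) differentiable_on S) \<and>
     continuous_on S ((deriv_within S ^^ k) f)"

definition Cinf_on :: "real set \<Rightarrow> (real \<Rightarrow> real) \<Rightarrow> bool" where
  "Cinf_on S f \<longleftrightarrow> (\<forall>k. Ck_on k S f)"

definition C2_norm :: "real \<Rightarrow> (real \<Rightarrow> real) \<Rightarrow> real" where
  "C2_norm L f = (\<Sum>j\<le>2. SUP s\<in>{0..L}. \<bar>(deriv_within {0..L} ^^ j) f s\<bar>)"

text \<open>Functions of time and space are curried, with time as the first argument; only their values
  on \<^term>\<open>{0..} \<times> {0..L}\<close> matter. \<open>C0_C2\<close> is the space
  \<open>C\<^sup>0([0,\<infinity>); C\<^sup>2([0,L]))\<close>.\<close>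

definition C0_C2 :: "real \<Rightarrow> (real \<Rightarrow> real \<Rightarrow> real) \<Rightarrow> bool" where
  "C0_C2 L u \<longleftrightarrow>
     (\<forall>t\<ge>0. Ck_on 2 {0..L} (u t)) \<and>
     (\<forall>t\<ge>0. ((\<lambda>\<tau>. C2_norm L (\<lambda>s. u \<tau> s - u t s)) \<longlongrightarrow> 0) (at t within {0..}))"

text \<open>The space \<open>C\<^sup>\<infinity>((0,\<infinity>) \<times> [0,L])\<close>, smooth up to the lateral boundary: all partial derivatives
  exist and are continuous; \<open>D i j\<close> is the derivative of order \<open>i\<close> in time and \<open>j\<close> in space.\<close>

definition Cinf_strip :: "real \<Rightarrow> (real \<Rightarrow> real \<Rightarrow> real) \<Rightarrow> bool" where
  "Cinf_strip L u \<longleftrightarrow>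
     (\<exists>D :: nat \<Rightarrow> nat \<Rightarrow> real \<Rightarrow> real \<Rightarrow> real.
        (\<forall>t>0. \<forall>s\<in>{0..L}. D 0 0 t s = u t s) \<and>
        (\<forall>i j. continuous_on ({0<..} \<times> {0..L}) (\<lambda>(t, s). D i j t s) \<and>
           (\<forall>t>0. \<forall>s\<in>{0..L}.
              ((\<lambda>\<tau>. D i j \<tau> s) has_real_derivative D (Suc i) j t s) (at t) \<and>
              (D i j t has_real_derivative D i (Suc j) t s) (at s within {0..L}))))"

definition curvature :: "real \<Rightarrow> (real \<Rightarrow> real) \<Rightarrow> real \<Rightarrow> real" where
  "curvature L \<theta> = deriv_within {0..L} \<theta>"

text \<open>The multipliers at a fixed time, as functions of the time slices of \<open>\<theta>\<close> and \<open>\<rho>\<close>.\<close>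

definition Pi_matrix :: "real \<Rightarrow> (real \<Rightarrow> real) \<Rightarrow> real^2^2" where
  "Pi_matrix L \<theta> = vector
     [vector [integral {0..L} (\<lambda>s. (sin (\<theta> s))\<^sup>2),
              - integral {0..L} (\<lambda>s. cos (\<theta> s) * sin (\<theta> s))],
      vector [- integral {0..L} (\<lambda>s. cos (\<theta> s) * sin (\<theta> s)),
              integral {0..L} (\<lambda>s. (cos (\<theta> s))\<^sup>2)]]"

definition lambda_theta ::
  "real \<Rightarrow> real \<Rightarrow> (real \<Rightarrow> real) \<Rightarrow> (real \<Rightarrow> real) \<Rightarrow> (real \<Rightarrow> real) \<Rightarrow> real^2" where
  "lambda_theta L c\<^sub>0 \<beta> \<theta> \<rho> = matrix_inv (Pi_matrix L \<theta>) *v vector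
     [integral {0..L} (\<lambda>s. cos (\<theta> s) * curvature L \<theta> s * \<beta> (\<rho> s) * (curvature L \<theta> s - c\<^sub>0)),
      integral {0..L} (\<lambda>s. sin (\<theta> s) * curvature L \<theta> s * \<beta> (\<rho> s) * (curvature L \<theta> s - c\<^sub>0))]"

definition lambda_rho ::
  "real \<Rightarrow> real \<Rightarrow> (real \<Rightarrow> real) \<Rightarrow> (real \<Rightarrow> real) \<Rightarrow> (real \<Rightarrow> real) \<Rightarrow> real" where
  "lambda_rho L c\<^sub>0 \<beta> \<theta> \<rho> =
     - 1 / (2 * L) * integral {0..L} (\<lambda>s. deriv \<beta> (\<rho> s) * (curvature L \<theta> s - c\<^sub>0)\<^sup>2)"

definition admissible_datum ::
  "real \<Rightarrow> real \<Rightarrow> int \<Rightarrow> (real \<Rightarrow> real) \<Rightarrow> (real \<Rightarrow> real) \<Rightarrow> bool" where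
  "admissible_datum L \<nu> \<omega> \<theta>\<^sub>0 \<rho>\<^sub>0 \<longleftrightarrow>
     Cinf_on {0..L} \<theta>\<^sub>0 \<and> Cinf_on {0..L} \<rho>\<^sub>0 \<and>
     integral {0..L} \<rho>\<^sub>0 = \<nu> * L \<and>
     integral {0..L} (\<lambda>s. sin (\<theta>\<^sub>0 s)) = 0 \<and>
     integral {0..L} (\<lambda>s. cos (\<theta>\<^sub>0 s)) = 0 \<and>
     \<theta>\<^sub>0 L - \<theta>\<^sub>0 0 = 2 * pi * of_int \<omega> \<and>
     \<rho>\<^sub>0 L = \<rho>\<^sub>0 0 \<and>
     (\<forall>j\<in>{1, 2}.
        (deriv_within {0..L} ^^ j) \<theta>\<^sub>0 L = (deriv_within {0..L} ^^ j) \<theta>\<^sub>0 0 \<and>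
        (deriv_within {0..L} ^^ j) \<rho>\<^sub>0 L = (deriv_within {0..L} ^^ j) \<rho>\<^sub>0 0)"

text \<open>Invertibility of the matrix is what writing its inverse in the equations presupposes;
  it is stated because \<^const>\<open>matrix_inv\<close> is total.\<close>

definition flow_equations ::
  "real \<Rightarrow> real \<Rightarrow> real \<Rightarrow> (real \<Rightarrow> real) \<Rightarrow>
   (real \<Rightarrow> real \<Rightarrow> real) \<Rightarrow> (real \<Rightarrow> real \<Rightarrow> real) \<Rightarrow> bool" where
  "flow_equations L \<mu> c\<^sub>0 \<beta> \<theta> \<rho> \<longleftrightarrow>
     (\<forall>t>0. invertible (Pi_matrix L (\<theta> t)) \<and>
       (\<forall>s\<in>{0..L}.
          deriv (\<lambda>\<tau>. \<theta> \<tau> s) t =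
            deriv_within {0..L} (\<lambda>r. \<beta> (\<rho> t r) * (deriv_within {0..L} (\<theta> t) r - c\<^sub>0)) s
            + lambda_theta L c\<^sub>0 \<beta> (\<theta> t) (\<rho> t) $ 1 * sin (\<theta> t s)
            - lambda_theta L c\<^sub>0 \<beta> (\<theta> t) (\<rho> t) $ 2 * cos (\<theta> t s) \<and>
          deriv (\<lambda>\<tau>. \<rho> \<tau> s) t =
            \<mu> * (deriv_within {0..L} ^^ 2) (\<rho> t) s
            - 1 / 2 * deriv \<beta> (\<rho> t s) * (deriv_within {0..L} (\<theta> t) s - c\<^sub>0)\<^sup>2
            - lambda_rho L c\<^sub>0 \<beta> (\<theta> t) (\<rho> t)))"

definition boundary_conditions ::
  "real \<Rightarrow> int \<Rightarrow> (real \<Rightarrow> real \<Rightarrow> real) \<Rightarrow> (real \<Rightarrow> real \<Rightarrow> real) \<Rightarrow> bool" where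
  "boundary_conditions L \<omega> \<theta> \<rho> \<longleftrightarrow>
     (\<forall>t>0. \<theta> t L - \<theta> t 0 = 2 * pi * of_int \<omega> \<and> \<rho> t L = \<rho> t 0 \<and>
        deriv_within {0..L} (\<theta> t) L = deriv_within {0..L} (\<theta> t) 0 \<and>
        deriv_within {0..L} (\<rho> t) L = deriv_within {0..L} (\<rho> t) 0)"

definition global_solution ::
  "real \<Rightarrow> real \<Rightarrow> int \<Rightarrow> real \<Rightarrow> (real \<Rightarrow> real) \<Rightarrow> (real \<Rightarrow> real) \<Rightarrow> (real \<Rightarrow> real) \<Rightarrow>
   (real \<Rightarrow> real \<Rightarrow> real) \<Rightarrow> (real \<Rightarrow> real \<Rightarrow> real) \<Rightarrow> bool" where
  "global_solution L \<mu> \<omega> c\<^sub>0 \<beta> \<theta>\<^sub>0 \<rho>\<^sub>0 \<theta> \<rho> \<longleftrightarrow>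
     Cinf_strip L \<theta> \<and> Cinf_strip L \<rho> \<and> C0_C2 L \<theta> \<and> C0_C2 L \<rho> \<and>
     flow_equations L \<mu> c\<^sub>0 \<beta> \<theta> \<rho> \<and> boundary_conditions L \<omega> \<theta> \<rho> \<and>
     (\<forall>s\<in>{0..L}. \<theta> 0 s = \<theta>\<^sub>0 s \<and> \<rho> 0 s = \<rho>\<^sub>0 s)"

definition ecard :: "'a set \<Rightarrow> enat" where
  "ecard A = (if finite A then enat (card A) else \<infinity>)"

definition periodic_extension :: "real \<Rightarrow> (real \<Rightarrow> real) \<Rightarrow> real \<Rightarrow> real" where
  "periodic_extension L f s = f (s rmod L)"

definition num_zeros :: "real \<Rightarrow> (real \<Rightarrow> real) \<Rightarrow> enat" where
  "num_zeros L f = ecard {s \<in> {0..<L}. f s = 0}"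

text \<open>The supremum is taken in \<^typ>\<open>enat\<close>, where the supremum of the empty set is 0.\<close>

definition num_sign_changes :: "real \<Rightarrow> (real \<Rightarrow> real) \<Rightarrow> enat" where
  "num_sign_changes L f = Sup {enat m | m. \<exists>x :: nat \<Rightarrow> real.
     strict_mono_on {1..m + 1} x \<and> x (m + 1) = x 1 + L \<and>
     (\<forall>i\<in>{1..m}. periodic_extension L f (x i) * periodic_extension L f (x (i + 1)) < 0)}"

definition num_inflection_points :: "real \<Rightarrow> (real \<Rightarrow> real) \<Rightarrow> enat" where
  "num_inflection_points L \<theta> = num_sign_changes L (curvature L \<theta>)"

end

theory Submission
  imports Defs
begin

text \<open>
  For \<open>c\<^sub>0 = 0\<close> differentiating the first flow equation shows that the curvature is a periodic
  solution of a linear parabolic equation \<open>u\<^sub>t = a u\<^sub>x\<^sub>x + b u\<^sub>x + c u\<close> with bounded coefficients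
  and \<open>a\<close> bounded away from zero, down to time zero.

  Among the cyclic configurations of points at which a function takes values of alternating sign and
  of size at least \<open>l\<close>, one with maximal sum of sizes consists of local maxima of the signed values.
  By the maximum principle such a configuration persists backwards in time, with \<open>l\<close> decreasing at
  most exponentially. Hence the number of sign changes is nonincreasing.

  For the zeros let \<open>n\<close> be the final number of sign changes before \<open>t2\<close>. The backward persistence
  also holds for \<open>u + \<epsilon> \<phi>\<close> with a fixed sum of bumps \<open>\<phi>\<close>, over a time interval that does not depend
  on \<open>\<epsilon>\<close>. Thus bumps of alternating sign at zeros of \<open>u\<close> at some time, on whose supports \<open>u\<close> has
  no zeros slightly earlier, create sign changes that were already there. This and the strong maximum
  principle show that at times shortly before \<open>t2\<close> there is exactly one zero between neighbouring
  points of an alternating configuration, and that there is no interval of zeros at time \<open>t2\<close>. Then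
  \<open>n + 1\<close> zeros at \<open>t2\<close> would be separated by nonzero values and, by the maximum principle, would
  stem from \<open>n + 1\<close> zeros at an earlier time.
\<close>


subsection \<open>Alternating configurations of a periodic function\<close>

text \<open>The zeros are the difficulty: a zero without change of sign leaves no trace in
  alternating configurations, and zeros might fill intervals. The argument has to work with
  coefficients that are merely bounded and down to time zero, where the solution is only known to be
  continuous, so it rests on comparison alone.

  The role of \<epsilon> is as follows. The function \<open>u + \<epsilon> * \<phi>\<close> fails to
  solve the equation by an error of order \<epsilon>, and its values at the perturbed zeros are of
  order \<epsilon> too, so the length of the backward time interval is a ratio in which \<epsilon>
  cancels. Hence the earlier time can be fixed before \<epsilon> is made small compared with
  \<bar>u\<bar> at that time, and an alternation of the perturbed function is then one of
  \<open>u\<close> itself.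

  Signs that alternate around a period force an even number of points. Sign changes in excess of the
  maximal number \<open>n\<close> therefore come as \<open>n + 2\<close>, not
  \<open>n + 1\<close>.\<close>

definition alternates :: "real \<Rightarrow> (real \<Rightarrow> real) \<Rightarrow> nat \<Rightarrow> (nat \<Rightarrow> real) \<Rightarrow> bool" where
  "alternates L f m x \<longleftrightarrow>
     (\<forall>i<m. x i < x (Suc i) \<and> f (x i) * f (x (Suc i)) < 0) \<and> x m = x 0 + L"

lemma periodic_shift_of_int:
  fixes f :: "real \<Rightarrow> 'a"
  assumes per: "\<And>x. f (x + L) = f x"
  shows "f (x + of_int k * L) = f x"
proof (induction k rule: int_induct[where k = 0])
  case (step1 i)
  have "x + of_int (i + 1) * L = (x + of_int i * L) + L" by (simp add: algebra_simps)
  then show ?case using per[of "x + of_int i * L"] step1(2) by metis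
next
  case (step2 i)
  have "x + of_int i * L = (x + of_int (i - 1) * L) + L" by (simp add: algebra_simps)
  then show ?case using per[of "x + of_int (i - 1) * L"] step2(2) by metis
qed simp

text \<open>A configuration of any length is stored as a sequence
  \<open>nat \<Rightarrow> real\<close>, so compactness is that of an infinite product of intervals,
  and one existence argument for extremal configurations serves every \<open>m\<close>.\<close>

lemma compact_cube: "compact {y :: nat \<Rightarrow> real. \<forall>i. y i \<in> {a..b}}"
proof -
  have "{y :: nat \<Rightarrow> real. \<forall>i. y i \<in> {a..b}} = PiE UNIV (\<lambda>_. {a..b})" by auto
  moreover have "compactin (product_topology (\<lambda>_. euclidean) UNIV)
     (PiE UNIV (\<lambda>_::nat. {a..b::real}))"
    by (subst compactin_PiE) auto
  ultimately show ?thesis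
    by (simp add: euclidean_product_topology)
qed

text \<open>A closed variant of \<open>alternates\<close>: the signs \<open>s\<close> are prescribed
  and all inequalities are weak, so limits of configurations are configurations. A level
  \<open>l > 0\<close> and alternating \<open>s\<close> restore strictness, because neighbouring
  points carry values of opposite sign.\<close>

definition config ::
  "real \<Rightarrow> nat \<Rightarrow> (nat \<Rightarrow> real) \<Rightarrow> (real \<Rightarrow> real) \<Rightarrow> real \<Rightarrow> (nat \<Rightarrow> real) \<Rightarrow> bool" where
  "config L m s f l y \<longleftrightarrow> (\<forall>i<m. y i \<le> y (Suc i)) \<and> y m = y 0 + L \<and> (\<forall>i\<le>m. l \<le> s i * f (y i))"

lemma config_normalize:
  assumes L: "L > 0" and per: "\<And>x. f (x + L) = f x" and Q: "config L m s f l y"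
  obtains y' where "config L m s f l y'" "y' 0 \<in> {0..L}" "\<And>i. y' i \<in> {0..2 * L}"
    "\<And>i. i \<le> m \<Longrightarrow> f (y' i) = f (y i)"
proof -
  define k where "k = - \<lfloor>y 0 / L\<rfloor>"
  \<comment> \<open>The value 0 beyond \<open>m\<close> is a default that keeps all coordinates in
    the cube.\<close>
  define y' where "y' = (\<lambda>i. if i \<le> m then y i + of_int k * L else 0)"
  have f: "f (y' i) = f (y i)" if "i \<le> m" for i
    using that periodic_shift_of_int[of f L, OF per] by (simp add: y'_def)
  have 0: "y' 0 \<in> {0..L}"
    using floor_divide_lower[OF L, of "y 0"] floor_divide_upper[OF L, of "y 0"]
    by (simp add: y'_def k_def algebra_simps)
  have mono: "\<forall>i<m. y' i \<le> y' (Suc i)" and last: "y' m = y' 0 + L"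
    using Q by (auto simp: config_def y'_def)
  have "y' 0 \<le> y' i \<and> y' i \<le> y' m" if "i \<le> m" for i
  proof
    show "y' 0 \<le> y' i" using that
    proof (induction i)
      case (Suc i)
      then show ?case using mono by (meson Suc_le_lessD less_imp_le order_trans)
    qed simp
    show "y' i \<le> y' m" using that
    proof (induction rule: inc_induct)
      case (step n)
      then show ?case using mono by (meson order_trans)
    qed simp
  qed
  then have "y' i \<in> {0..2 * L}" if "i \<le> m" for i
    using that 0 last by fastforce
  then have "y' i \<in> {0..2 * L}" for i using L by (cases "i \<le> m") (auto simp: y'_def)
  moreover have "config L m s f l y'" using mono last f Q by (simp add: config_def)
  ultimately show ?thesis using that 0 f by blast
qed

text \<open>Among all configurations whose values are at least \<open>l\<close> pick one with the largest sum of
  signed values; moving one of its points cannot increase the value at that point.\<close>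

lemma config_local_max:
  assumes L: "L > 0" and per: "\<And>x. f (x + L) = f x" and cont: "continuous_on UNIV f"
    and l: "l > 0" and s: "\<And>i. s i \<in> {1, -1}" "\<And>i. i < m \<Longrightarrow> s (Suc i) = - s i" "s m = s 0"
    and Q: "config L m s f l y"
  obtains z d where "config L m s f l z" "d > 0"
    "\<And>i x. i \<le> m \<Longrightarrow> \<bar>x - z i\<bar> < d \<Longrightarrow> s i * f x \<le> s i * f (z i)"
proof -
  define E where "E = {y :: nat \<Rightarrow> real. \<forall>i. y i \<in> {0..2 * L}}"
  define A where "A = {y \<in> E. config L m s f l y}"
  have compE: "compact E" unfolding E_def by (rule compact_cube)
  have coord: "continuous_on S (\<lambda>y :: nat \<Rightarrow> real. y i)" for S i
    by (rule continuous_on_product_then_coordinatewise[OF continuous_on_id])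
  have contf: "continuous_on S (\<lambda>y. f (y i))" for S and i :: nat
    by (intro continuous_on_compose2[OF cont] coord) auto
  have closed_le: "closed {y \<in> E. g y \<le> h y}" if "continuous_on E g" "continuous_on E h"
    for g h :: "(nat \<Rightarrow> real) \<Rightarrow> real"
    using that compE by (intro continuous_on_closed_Collect_le compact_imp_closed) auto
  have "A = E \<inter> (\<Inter>i\<in>{..<m}. {y \<in> E. y i \<le> y (Suc i)}) \<inter>
      {y \<in> E. y m \<le> y 0 + L} \<inter> {y \<in> E. y 0 + L \<le> y m} \<inter>
      (\<Inter>i\<in>{..m}. {y \<in> E. l \<le> s i * f (y i)})"
    unfolding A_def config_def by auto
  moreover have "closed \<dots>"
    by (intro closed_Int closed_INT ballI closed_le compact_imp_closed[OF compE]
        continuous_intros contf coord)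
  ultimately have "closed A" by metis
  moreover have "E \<inter> A = A" by (auto simp: A_def)
  ultimately have compA: "compact A"
    using compact_Int_closed[OF compE] by metis
  have norm: "\<exists>y'\<in>A. \<forall>i\<le>m. f (y' i) = f (y i)" if Qy: "config L m s f l y" for y
    by (rule config_normalize[OF L per Qy]) (auto simp: A_def E_def)
  then have "A \<noteq> {}" using Q by blast
  moreover have "continuous_on A (\<lambda>y. \<Sum>i<m. s i * f (y i))"
    by (intro continuous_intros contf)
  ultimately obtain z where z: "z \<in> A"
    and zmax: "\<And>y. y \<in> A \<Longrightarrow> (\<Sum>i<m. s i * f (y i)) \<le> (\<Sum>i<m. s i * f (z i))"
    using continuous_attains_sup[OF compA] by blast
  have Qz: "config L m s f l z" using z by (simp add: A_def)
  \<comment> \<open>Maximality holds among all configurations, not only those in the cube, since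
    translation by periods preserves the values.\<close>
  have zmax': "(\<Sum>i<m. s i * f (y i)) \<le> (\<Sum>i<m. s i * f (z i))" if Qy: "config L m s f l y" for y
  proof -
    obtain y' where "y' \<in> A" "\<forall>i\<le>m. f (y' i) = f (y i)" using norm[OF Qy] by blast
    then show ?thesis using zmax[of y'] by simp
  qed
  have gap: "z i < z (Suc i)" if "i < m" for i
  proof -
    have "l \<le> s i * f (z i)" "l \<le> s (Suc i) * f (z (Suc i))" "z i \<le> z (Suc i)"
      using Qz that by (auto simp: config_def)
    with s(2)[OF that] l show ?thesis by (cases "z i = z (Suc i)") auto
  qed
  have m: "m > 0" using Qz L by (auto simp: config_def intro: gr0I)
  define d where "d = Min ((\<lambda>i. z (Suc i) - z i) ` {..<m})"
  have d: "d > 0" unfolding d_def using gap m by (subst Min_gr_iff) auto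
  have dle: "d \<le> z (Suc i) - z i" if "i < m" for i
    unfolding d_def using that by (intro Min_le) auto
  have key: "s i * f x \<le> s i * f (z i)" if i: "i < m" and x: "\<bar>x - z i\<bar> < d" for i x
  proof (rule ccontr)
    assume "\<not> ?thesis"
    then have gt: "s i * f (z i) < s i * f x" by simp
    \<comment> \<open>The index is read modulo \<open>m\<close> because the points \<open>0\<close>
      and \<open>m\<close> are one point of the circle and have to move together.\<close>
    define y where "y = (\<lambda>j. if j mod m = i then z j + (x - z i) else z j)"
    have mod: "j mod m = i \<longleftrightarrow> j = i \<or> j = m \<and> i = 0" if "j \<le> m" for j
      using that i by (cases "j = m") auto
    have fy: "f (y j) = (if j mod m = i then f x else f (z j))" if "j \<le> m" for j
    proof (cases "j = m \<and> i = 0")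
      case True
      then show ?thesis using Qz per[of x] by (simp add: y_def config_def algebra_simps)
    next
      case False
      then show ?thesis using mod[OF that] by (auto simp: y_def)
    qed
    have "y j \<le> y (Suc j)" if "j < m" for j
      using dle[OF that] x gap[OF that] by (auto simp: y_def)
    moreover have "y m = y 0 + L"
      using Qz m by (auto simp: y_def config_def)
    moreover have "l \<le> s j * f (y j)" if j: "j \<le> m" for j
    proof (cases "j mod m = i")
      case True
      then have "s j = s i" using mod[OF j] s(3) by auto
      moreover have "l \<le> s i * f (z i)" using Qz i by (simp add: config_def)
      ultimately show ?thesis using True fy[OF j] gt by simp
    next
      case False
      then show ?thesis using fy[OF j] Qz j by (simp add: config_def)
    qed
    ultimately have "config L m s f l y" by (simp add: config_def)
    then have le: "(\<Sum>j<m. s j * f (y j)) \<le> (\<Sum>j<m. s j * f (z j))" by (rule zmax')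
    have "s j * f (z j) \<le> s j * f (y j)" if "j < m" for j
      using fy[of j] that gt by auto
    moreover have "s i * f (z i) < s i * f (y i)" using fy[of i] i gt by simp
    ultimately have "(\<Sum>j<m. s j * f (z j)) < (\<Sum>j<m. s j * f (y j))"
      using i by (intro sum_strict_mono_ex1) auto
    then show False using le by simp
  qed
  show ?thesis
  proof (rule that[OF Qz d])
    fix i x assume i: "i \<le> m" and x: "\<bar>x - z i\<bar> < d"
    show "s i * f x \<le> s i * f (z i)"
    proof (cases "i = m")
      case True
      then have zi: "z i = z 0 + L" using Qz by (simp add: config_def)
      have "s 0 * f (x - L) \<le> s 0 * f (z 0)" using key[of 0 "x - L"] m x zi by (simp add: algebra_simps)
      then show ?thesis using True zi s(3) per[of "x - L"] per[of "z 0"] by simp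
    qed (use key i x in auto)
  qed
qed

text \<open>Configurations over all times can be taken from a compact set, so there is an earliest
  time at which one exists. If it exceeded \<open>t1\<close>, one could take a configuration of
  local maxima at that time: where the value equals the level, \<open>step\<close> says that the
  level drops faster than the signed value as time decreases, and elsewhere the inequality is strict
  and survives by continuity. The same points would form a configuration slightly earlier. The
  function \<open>w\<close> is not tied to an equation because it will be a solution in one
  application and a perturbed solution in the other.\<close>

lemma config_backward:
  fixes w :: "real \<Rightarrow> real \<Rightarrow> real" and l :: "real \<Rightarrow> real"
  assumes L: "L > 0" and t12: "t1 \<le> t2"
    and per: "\<And>t x. t \<in> {t1..t2} \<Longrightarrow> w t (x + L) = w t x"
    and cont: "continuous_on ({t1..t2} \<times> UNIV) (\<lambda>(t, x). w t x)"
    and contl: "continuous_on {t1..t2} l" and l: "\<And>t. t \<in> {t1..t2} \<Longrightarrow> l t > 0"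
    and step: "\<And>t x \<sigma> d. t1 < t \<Longrightarrow> t \<le> t2 \<Longrightarrow> \<sigma> \<in> {1, -1} \<Longrightarrow> 0 < d \<Longrightarrow>
      (\<And>y. \<bar>y - x\<bar> < d \<Longrightarrow> \<sigma> * w t y \<le> \<sigma> * w t x) \<Longrightarrow> \<sigma> * w t x = l t \<Longrightarrow>
      \<exists>D D'. ((\<lambda>\<tau>. w \<tau> x) has_real_derivative D) (at t) \<and>
        (l has_real_derivative D') (at t) \<and> \<sigma> * D < D'"
    and s: "\<And>i. s i \<in> {1, -1}" "\<And>i. i < m \<Longrightarrow> s (Suc i) = - s i" "s m = s 0"
    and Q: "config L m s (w t2) (l t2) y"
  obtains z where "config L m s (w t1) (l t1) z"
proof -
  define E where "E = {y :: nat \<Rightarrow> real. \<forall>i. y i \<in> {0..2 * L}}"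
  define K where "K = {t1..t2} \<times> E"
  define A where "A = {p \<in> K. config L m s (w (fst p)) (l (fst p)) (snd p)}"
  have compK: "compact K" unfolding K_def E_def by (intro compact_Times compact_cube compact_Icc)
  have contc: "continuous_on K (\<lambda>p. snd p i)" for i
    by (rule continuous_on_product_then_coordinatewise) (intro continuous_intros)
  have contw: "continuous_on K (\<lambda>p. w (fst p) (snd p i))" for i
  proof -
    have "continuous_on K (\<lambda>p. case (fst p, snd p i) of (t, x) \<Rightarrow> w t x)"
      by (rule continuous_on_compose2[OF cont])
        (auto simp: K_def intro!: continuous_intros contc[unfolded K_def])
    then show ?thesis by simp
  qed
  have contl': "continuous_on K (\<lambda>p. l (fst p))"
    by (rule continuous_on_compose2[OF contl]) (auto simp: K_def intro!: continuous_intros)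
  have closed_le: "closed {y \<in> K. g y \<le> h y}" if "continuous_on K g" "continuous_on K h"
    for g h :: "real \<times> (nat \<Rightarrow> real) \<Rightarrow> real"
    using that compK by (intro continuous_on_closed_Collect_le compact_imp_closed) auto
  have "A = K \<inter> (\<Inter>i\<in>{..<m}. {p \<in> K. snd p i \<le> snd p (Suc i)}) \<inter>
      {p \<in> K. snd p m \<le> snd p 0 + L} \<inter> {p \<in> K. snd p 0 + L \<le> snd p m} \<inter>
      (\<Inter>i\<in>{..m}. {p \<in> K. l (fst p) \<le> s i * w (fst p) (snd p i)})"
    unfolding A_def config_def by auto
  moreover have "closed \<dots>"
    by (intro closed_Int closed_INT ballI closed_le compact_imp_closed[OF compK]
        continuous_intros contw contl' contc)
  ultimately have "closed A" by metis
  moreover have "K \<inter> A = A" by (auto simp: A_def)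
  ultimately have compA: "compact A"
    using compact_Int_closed[OF compK] by metis
  have norm: "\<exists>y'. (t, y') \<in> A" if t: "t \<in> {t1..t2}" and Qy: "config L m s (w t) (l t) y" for t y
  proof -
    obtain y' where "config L m s (w t) (l t) y'" "\<And>i. y' i \<in> {0..2 * L}"
      by (rule config_normalize[OF L per[OF t] Qy]) blast
    then show ?thesis using t by (auto simp: A_def K_def E_def)
  qed
  from this[OF _ Q] have "A \<noteq> {}" using t12 by auto
  moreover have "continuous_on A fst" by (intro continuous_intros)
  ultimately obtain p where p: "p \<in> A" and pmin: "\<And>q. q \<in> A \<Longrightarrow> fst p \<le> fst q"
    using continuous_attains_inf[OF compA, of fst] by blast
  define t where "t = fst p"
  have t: "t \<in> {t1..t2}" and Qt: "config L m s (w t) (l t) (snd p)"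
    using p by (auto simp: A_def K_def t_def)
  have cont_t: "continuous_on UNIV (w t)"
  proof -
    have "continuous_on UNIV (\<lambda>x. case (t, x) of (t, x) \<Rightarrow> w t x)"
      by (rule continuous_on_compose2[OF cont]) (use t in \<open>auto intro!: continuous_intros\<close>)
    then show ?thesis by simp
  qed
  have "t = t1"
  proof (rule ccontr)
    assume "t \<noteq> t1"
    then have t1: "t1 < t" using t by simp
    obtain z d where z: "config L m s (w t) (l t) z" and d: "d > 0" and
      zmax: "\<And>i x. i \<le> m \<Longrightarrow> \<bar>x - z i\<bar> < d \<Longrightarrow> s i * w t x \<le> s i * w t (z i)"
      by (rule config_local_max[OF L per[OF t] cont_t l[OF t] s Qt]) (assumption, rule that)
    have ev: "\<forall>\<^sub>F \<tau> in at_left t. l \<tau> \<le> s i * w \<tau> (z i)" if i: "i \<le> m" for i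
    proof (cases "l t = s i * w t (z i)")
      case True
      have "\<exists>D D'. ((\<lambda>\<tau>. w \<tau> (z i)) has_real_derivative D) (at t) \<and>
        (l has_real_derivative D') (at t) \<and> s i * D < D'"
        using t t1 True by (intro step[where d = d]) (use s(1)[of i] d zmax[OF i] in auto)
      then obtain D D' where D: "((\<lambda>\<tau>. w \<tau> (z i)) has_real_derivative D) (at t)"
        "(l has_real_derivative D') (at t)" "s i * D < D'" by blast
      have "((\<lambda>\<tau>. l \<tau> - s i * w \<tau> (z i)) has_real_derivative D' - s i * D) (at t)"
        by (intro derivative_intros DERIV_cmult D)
      then obtain e where e: "e > 0" "\<And>h. 0 < h \<Longrightarrow> h < e \<Longrightarrow>
          l (t - h) - s i * w (t - h) (z i) < l t - s i * w t (z i)"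
        using DERIV_pos_inc_left[of _ "D' - s i * D" t] D(3) by auto
      have "l \<tau> \<le> s i * w \<tau> (z i)" if "t - e < \<tau>" "\<tau> < t" for \<tau>
        using e(2)[of "t - \<tau>"] that True by auto
      then show ?thesis using e(1) by (auto simp: eventually_at_left_field intro: exI[of _ "t - e"])
    next
      case False
      have c: "continuous_on {t1..t2} (\<lambda>\<tau>. s i * w \<tau> (z i) - l \<tau>)"
      proof (intro continuous_intros contl)
        have "continuous_on {t1..t2} (\<lambda>\<tau>. case (\<tau>, z i) of (t, x) \<Rightarrow> w t x)"
          by (rule continuous_on_compose2[OF cont]) (auto intro!: continuous_intros)
        then show "continuous_on {t1..t2} (\<lambda>\<tau>. w \<tau> (z i))" by simp
      qed
      have pos: "0 < s i * w t (z i) - l t" using False z i unfolding config_def by force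
      have "((\<lambda>\<tau>. s i * w \<tau> (z i) - l \<tau>) \<longlongrightarrow> s i * w t (z i) - l t) (at t within {t1..t2})"
        using c t by (simp add: continuous_on_def)
      then have "\<forall>\<^sub>F \<tau> in at t within {t1..t2}. 0 < s i * w \<tau> (z i) - l \<tau>"
        using pos by (rule order_tendstoD)
      then have "\<forall>\<^sub>F \<tau> in at t within {t1..t}. 0 < s i * w \<tau> (z i) - l \<tau>"
        using t by (elim filter_leD[rotated]) (intro at_le, auto)
      then show ?thesis
        using t1 at_within_Icc_at_left[OF t1] by (auto elim: eventually_mono)
    qed
    have "\<forall>\<^sub>F \<tau> in at_left t. \<forall>i\<in>{..m}. l \<tau> \<le> s i * w \<tau> (z i)"
      using ev by (intro eventually_ball_finite) auto
    moreover have "\<forall>\<^sub>F \<tau> in at_left t. t1 < \<tau> \<and> \<tau> < t"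
      using t1 by (auto simp: eventually_at_left_field)
    ultimately have "\<forall>\<^sub>F \<tau> in at_left t. (\<forall>i\<in>{..m}. l \<tau> \<le> s i * w \<tau> (z i)) \<and> t1 < \<tau> \<and> \<tau> < t"
      by eventually_elim auto
    then obtain \<tau> where \<tau>: "\<forall>i\<in>{..m}. l \<tau> \<le> s i * w \<tau> (z i)" "t1 < \<tau>" "\<tau> < t"
      using eventually_happens'[OF trivial_limit_at_left_real] by force
    then have "config L m s (w \<tau>) (l \<tau>) z" using z by (auto simp: config_def)
    then obtain y' where "(\<tau>, y') \<in> A" using norm[of \<tau> z] \<tau> t by auto
    then show False using pmin[of "(\<tau>, y')"] \<tau> by (auto simp: t_def)
  qed
  then show ?thesis using that Qt by blast
qed


subsection \<open>Derivative tests\<close>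

lemma local_max_second_derivative:
  fixes f g :: "real \<Rightarrow> real"
  assumes f: "\<And>y. (f has_real_derivative g y) (at y)" and g: "(g has_real_derivative D) (at x)"
    and d: "d > 0" and max: "\<And>y. \<bar>y - x\<bar> < d \<Longrightarrow> f y \<le> f x"
  shows "g x = 0" and "D \<le> 0"
proof -
  show gx: "g x = 0"
    by (rule DERIV_local_max[OF f d]) (use max in \<open>auto simp: abs_minus_commute\<close>)
  show "D \<le> 0"
  proof (rule ccontr)
    assume "\<not> ?thesis"
    then obtain e where e: "e > 0" "\<And>h. 0 < h \<Longrightarrow> h < e \<Longrightarrow> g x < g (x + h)"
      using DERIV_pos_inc_right[OF g] by auto
    define h where "h = min (d / 2) (e / 2)"
    have h: "0 < h" "h < d" "h < e" using d e(1) by (auto simp: h_def)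
    obtain z where z: "x < z" "z < x + h" "f (x + h) - f x = (x + h - x) * g z"
      using MVT2[of x "x + h" f g] f h(1) by auto
    have "g z > 0" using e(2)[of "z - x"] z h gx by auto
    then have "f (x + h) > f x" using z(3) h(1) by (simp add: algebra_simps)
    then show False using max[of "x + h"] h by auto
  qed
qed

text \<open>Only the past of \<open>t\<close> enters, since minima may be attained at the final
  time.\<close>

lemma deriv_nonpos_at_left_min:
  fixes f :: "real \<Rightarrow> real"
  assumes "(f has_real_derivative D) (at t)" "t0 < t"
    and "\<And>s. t0 \<le> s \<Longrightarrow> s \<le> t \<Longrightarrow> f t \<le> f s"
  shows "D \<le> 0"
proof (rule ccontr)
  assume "\<not> ?thesis"
  then obtain e where e: "e > 0" "\<And>h. 0 < h \<Longrightarrow> h < e \<Longrightarrow> f (t - h) < f t"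
    using DERIV_pos_inc_left[OF assms(1)] by auto
  define h where "h = min (e / 2) (t - t0)"
  have "0 < h" "h < e" "h \<le> t - t0" using e(1) assms(2) by (auto simp: h_def)
  then show False using e(2)[of h] assms(3)[of "t - h"] by auto
qed

text \<open>A negative minimum of \<open>exp (- K * t) * v\<close> cannot lie on the bottom or the
  sides; at it the time derivative of the weighted function is at most 0, that is,
  \<open>D \<le> K * v\<close>, contrary to \<open>interior\<close>. That hypothesis speaks of
  spatial minima with negative value so that it can be checked for a solution as well as for a
  solution minus a barrier.\<close>

lemma box_minimum_principle:
  fixes v :: "real \<Rightarrow> real \<Rightarrow> real"
  assumes cont: "continuous_on ({t0..t1} \<times> {p..q}) (\<lambda>(t, x). v t x)"
    and bottom: "\<And>x. x \<in> {p..q} \<Longrightarrow> 0 \<le> v t0 x"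
    and left: "\<And>t. t \<in> {t0..t1} \<Longrightarrow> 0 \<le> v t p" and right: "\<And>t. t \<in> {t0..t1} \<Longrightarrow> 0 \<le> v t q"
    and interior: "\<And>t x d. t0 < t \<Longrightarrow> t \<le> t1 \<Longrightarrow> p < x \<Longrightarrow> x < q \<Longrightarrow> v t x < 0 \<Longrightarrow> 0 < d \<Longrightarrow>
      (\<And>y. \<bar>y - x\<bar> < d \<Longrightarrow> v t x \<le> v t y) \<Longrightarrow>
      \<exists>D. ((\<lambda>s. v s x) has_real_derivative D) (at t) \<and> K * v t x < D"
    and t: "t \<in> {t0..t1}" and x: "x \<in> {p..q}"
  shows "0 \<le> v t x"
proof (rule ccontr)
  assume neg: "\<not> ?thesis"
  define g where "g = (\<lambda>z. exp (- K * fst z) * (case z of (t, x) \<Rightarrow> v t x))"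
  have "continuous_on ({t0..t1} \<times> {p..q}) g"
    unfolding g_def by (intro continuous_intros cont)
  moreover have "compact ({t0..t1} \<times> {p..q})" "{t0..t1} \<times> {p..q} \<noteq> {}"
    using t x by (auto intro: compact_Times)
  ultimately obtain z where z: "z \<in> {t0..t1} \<times> {p..q}"
    and min: "\<And>z'. z' \<in> {t0..t1} \<times> {p..q} \<Longrightarrow> g z \<le> g z'"
    using continuous_attains_inf[of "{t0..t1} \<times> {p..q}" g] by blast
  obtain s y where sy: "z = (s, y)" by (cases z)
  have sy_in: "s \<in> {t0..t1}" "y \<in> {p..q}" using z sy by auto
  have "g z \<le> g (t, x)" using min t x by auto
  also have "g (t, x) < 0" using neg by (simp add: g_def mult_less_0_iff)
  finally have vneg: "v s y < 0" by (simp add: g_def sy mult_less_0_iff)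
  have "s \<noteq> t0" "y \<noteq> p" "y \<noteq> q" using bottom[of y] left[of s] right[of s] sy_in vneg by auto
  then have s: "t0 < s" and y: "p < y" "y < q" using sy_in by auto
  have "v s y \<le> v s y'" if "\<bar>y' - y\<bar> < min (y - p) (q - y)" for y'
  proof -
    have "g z \<le> g (s, y')" using that y sy_in by (intro min) auto
    then show ?thesis by (simp add: g_def sy)
  qed
  then obtain D where D: "((\<lambda>s. v s y) has_real_derivative D) (at s)" "K * v s y < D"
    using interior[of s y "min (y - p) (q - y)"] s y sy_in vneg by auto
  have "((\<lambda>s. exp (- K * s) * v s y) has_real_derivative
      exp (- K * s) * (D - K * v s y)) (at s)"
    by (rule derivative_eq_intros D(1) refl)+ (simp add: algebra_simps)
  then have "exp (- K * s) * (D - K * v s y) \<le> 0"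
  proof (rule deriv_nonpos_at_left_min[OF _ s])
    fix s' assume "t0 \<le> s'" "s' \<le> s"
    then have "g z \<le> g (s', y)" using sy_in by (intro min) auto
    then show "exp (- K * s) * v s y \<le> exp (- K * s') * v s' y" by (simp add: g_def sy)
  qed
  then show False using D(2) by (simp add: mult_le_0_iff)
qed

subsection \<open>Periodic solutions of linear parabolic equations\<close>

text \<open>The coefficients are chosen point by point, and only their bound \<open>C\<close> is
  uniform on each time interval \<open>(0, T]\<close>. Together with the continuity of
  \<open>u\<close> at time 0 this makes comparison possible down to the initial time.\<close>

locale parabolic =
  fixes L :: real and u ux uxx :: "real \<Rightarrow> real \<Rightarrow> real"
  assumes L: "L > 0"
    and per: "0 \<le> t \<Longrightarrow> u t (x + L) = u t x"
    and cont: "continuous_on ({0..} \<times> UNIV) (\<lambda>(t, x). u t x)"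
    and ux: "0 < t \<Longrightarrow> (u t has_real_derivative ux t x) (at x)"
    and uxx: "0 < t \<Longrightarrow> (ux t has_real_derivative uxx t x) (at x)"
    and pde: "\<exists>C>0. \<forall>t x. 0 < t \<longrightarrow> t \<le> T \<longrightarrow>
      (\<exists>a b c. 1 / C \<le> a \<and> a \<le> C \<and> \<bar>b\<bar> \<le> C \<and> \<bar>c\<bar> \<le> C \<and>
        ((\<lambda>\<tau>. u \<tau> x) has_real_derivative a * uxx t x + b * ux t x + c * u t x) (at t))"
begin

text \<open>The equation is linear and homogeneous, so negation keeps the coefficients; this reduces
  statements about negative values to positive ones.\<close>

lemma parabolic_uminus: "parabolic L (\<lambda>t x. - u t x) (\<lambda>t x. - ux t x) (\<lambda>t x. - uxx t x)"
proof
  show "continuous_on ({0..} \<times> UNIV) (\<lambda>(t, x). - u t x)"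
    using continuous_on_minus[OF cont] by (simp add: case_prod_unfold)
  fix T
  obtain C where "C > 0" and C: "\<And>t x. 0 < t \<Longrightarrow> t \<le> T \<Longrightarrow>
    \<exists>a b c. 1 / C \<le> a \<and> a \<le> C \<and> \<bar>b\<bar> \<le> C \<and> \<bar>c\<bar> \<le> C \<and>
      ((\<lambda>\<tau>. u \<tau> x) has_real_derivative a * uxx t x + b * ux t x + c * u t x) (at t)"
    using pde[of T] by blast
  show "\<exists>C>0. \<forall>t x. 0 < t \<longrightarrow> t \<le> T \<longrightarrow> (\<exists>a b c. 1 / C \<le> a \<and> a \<le> C \<and> \<bar>b\<bar> \<le> C \<and> \<bar>c\<bar> \<le> C \<and>
      ((\<lambda>\<tau>. - u \<tau> x) has_real_derivative a * - uxx t x + b * - ux t x + c * - u t x) (at t))"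
  proof (rule exI[of _ C], intro conjI allI impI \<open>C > 0\<close>)
    fix t x :: real assume "0 < t" "t \<le> T"
    from C[OF this] obtain a b c where *: "1 / C \<le> a" "a \<le> C" "\<bar>b\<bar> \<le> C" "\<bar>c\<bar> \<le> C"
      "((\<lambda>\<tau>. u \<tau> x) has_real_derivative a * uxx t x + b * ux t x + c * u t x) (at t)" by blast
    have "((\<lambda>\<tau>. - u \<tau> x) has_real_derivative a * - uxx t x + b * - ux t x + c * - u t x) (at t)"
      using DERIV_minus[OF *(5)] by (simp add: algebra_simps)
    with * show "\<exists>a b c. 1 / C \<le> a \<and> a \<le> C \<and> \<bar>b\<bar> \<le> C \<and> \<bar>c\<bar> \<le> C \<and>
      ((\<lambda>\<tau>. - u \<tau> x) has_real_derivative a * - uxx t x + b * - ux t x + c * - u t x) (at t)" by blast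
  qed
qed (use L per ux uxx in \<open>auto intro!: DERIV_minus\<close>)

text \<open>Reflection only reverses the sign of the drift \<open>b\<close>; it turns propagation of
  positivity to the right into propagation to the left.\<close>

lemma parabolic_reflect: "parabolic L (\<lambda>t x. u t (- x)) (\<lambda>t x. - ux t (- x)) (\<lambda>t x. uxx t (- x))"
proof
  have "continuous_on ({0..} \<times> UNIV) (\<lambda>z. case (fst z, - snd z) of (t, x) \<Rightarrow> u t x)"
    by (rule continuous_on_compose2[OF cont]) (auto intro!: continuous_intros)
  then show "continuous_on ({0..} \<times> UNIV) (\<lambda>(t, x). u t (- x))"
    by (simp add: case_prod_unfold)
  show "u t (- (x + L)) = u t (- x)" if "0 \<le> t" for t x
    using per[OF that, of "- x - L"] by simp
  have inner: "(uminus has_real_derivative - 1) (at x)" for x :: real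
    by (auto intro!: derivative_eq_intros)
  show "((\<lambda>x. u t (- x)) has_real_derivative - ux t (- x)) (at x)" if "0 < t" for t x
    using DERIV_chain2[OF ux[OF that] inner, of x] by simp
  show "((\<lambda>x. - ux t (- x)) has_real_derivative uxx t (- x)) (at x)" if "0 < t" for t x
    using DERIV_minus[OF DERIV_chain2[OF uxx[OF that] inner, of x]] by simp
  fix T
  obtain C where "C > 0" and C: "\<And>t x. 0 < t \<Longrightarrow> t \<le> T \<Longrightarrow>
    \<exists>a b c. 1 / C \<le> a \<and> a \<le> C \<and> \<bar>b\<bar> \<le> C \<and> \<bar>c\<bar> \<le> C \<and>
      ((\<lambda>\<tau>. u \<tau> x) has_real_derivative a * uxx t x + b * ux t x + c * u t x) (at t)"
    using pde[of T] by blast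
  show "\<exists>C>0. \<forall>t x. 0 < t \<longrightarrow> t \<le> T \<longrightarrow> (\<exists>a b c. 1 / C \<le> a \<and> a \<le> C \<and> \<bar>b\<bar> \<le> C \<and> \<bar>c\<bar> \<le> C \<and>
      ((\<lambda>\<tau>. u \<tau> (- x)) has_real_derivative
        a * uxx t (- x) + b * - ux t (- x) + c * u t (- x)) (at t))"
  proof (rule exI[of _ C], intro conjI allI impI \<open>C > 0\<close>)
    fix t x :: real assume "0 < t" "t \<le> T"
    from C[OF this, of "- x"] obtain a b c where *: "1 / C \<le> a" "a \<le> C" "\<bar>b\<bar> \<le> C" "\<bar>c\<bar> \<le> C"
      "((\<lambda>\<tau>. u \<tau> (- x)) has_real_derivative a * uxx t (- x) + b * ux t (- x) + c * u t (- x)) (at t)"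
      by blast
    then show "\<exists>a b c. 1 / C \<le> a \<and> a \<le> C \<and> \<bar>b\<bar> \<le> C \<and> \<bar>c\<bar> \<le> C \<and>
      ((\<lambda>\<tau>. u \<tau> (- x)) has_real_derivative
        a * uxx t (- x) + b * - ux t (- x) + c * u t (- x)) (at t)"
      by (intro exI[of _ a] exI[of _ "- b"] exI[of _ c]) auto
  qed
qed (fact L)

section \<open>Persistence of signs, weak and strong maximum principle\<close>

lemma cont_compose:
  assumes "continuous_on S f" "continuous_on S g" "\<And>z. z \<in> S \<Longrightarrow> 0 \<le> f z"
  shows "continuous_on S (\<lambda>z. u (f z) (g z))"
proof -
  have "continuous_on S (\<lambda>z. case (f z, g z) of (t, x) \<Rightarrow> u t x)"
    by (rule continuous_on_compose2[OF cont]) (use assms in \<open>auto intro!: continuous_intros\<close>)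
  then show ?thesis by simp
qed

lemma cont_slice: "0 \<le> t \<Longrightarrow> continuous_on S (u t)"
  by (intro cont_compose continuous_intros) auto

lemma persistent_sign:
  assumes \<tau>: "0 < \<tau>" and pos: "0 < \<sigma> * u \<tau> x"
  obtains s where "0 \<le> s" "s < \<tau>" "\<And>t. s \<le> t \<Longrightarrow> t \<le> \<tau> \<Longrightarrow> 0 < \<sigma> * u t x"
proof -
  have "continuous_on {0..\<tau>} (\<lambda>t. \<sigma> * u t x)"
    by (intro continuous_intros cont_compose) auto
  then have "((\<lambda>t. \<sigma> * u t x) \<longlongrightarrow> \<sigma> * u \<tau> x) (at \<tau> within {0..\<tau>})"
    using \<tau> by (simp add: continuous_on_def)
  then have "((\<lambda>t. \<sigma> * u t x) \<longlongrightarrow> \<sigma> * u \<tau> x) (at_left \<tau>)"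
    by (simp add: at_within_Icc_at_left[OF \<tau>])
  then have "\<forall>\<^sub>F t in at_left \<tau>. 0 < \<sigma> * u t x" using pos by (rule order_tendstoD)
  then obtain s where s: "s < \<tau>" "\<And>t. s < t \<Longrightarrow> t < \<tau> \<Longrightarrow> 0 < \<sigma> * u t x"
    unfolding eventually_at_left_field by blast
  show ?thesis
  proof (rule that[of "max 0 ((s + \<tau>) / 2)"])
    fix t assume "max 0 ((s + \<tau>) / 2) \<le> t" "t \<le> \<tau>"
    then show "0 < \<sigma> * u t x" using s pos by (cases "t = \<tau>") auto
  qed (use \<tau> s in auto)
qed

text \<open>At a negative spatial minimum \<open>ux = 0\<close> and \<open>uxx \<ge> 0\<close>, so
  the time derivative is at least \<open>c * u\<close>, which exceeds \<open>(C + 1) * u\<close>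
  because \<open>u < 0\<close> and \<open>c \<le> C\<close>.\<close>

lemma nonneg_in_box:
  assumes t0: "0 \<le> t0"
    and bottom: "\<And>x. x \<in> {p..q} \<Longrightarrow> 0 \<le> u t0 x"
    and sides: "\<And>t. t \<in> {t0..t1} \<Longrightarrow> 0 \<le> u t p" "\<And>t. t \<in> {t0..t1} \<Longrightarrow> 0 \<le> u t q"
    and tx: "t \<in> {t0..t1}" "x \<in> {p..q}"
  shows "0 \<le> u t x"
proof -
  obtain C where "C > 0" and C: "\<And>t x. 0 < t \<Longrightarrow> t \<le> t1 \<Longrightarrow>
    \<exists>a b c. 1 / C \<le> a \<and> a \<le> C \<and> \<bar>b\<bar> \<le> C \<and> \<bar>c\<bar> \<le> C \<and>
      ((\<lambda>\<tau>. u \<tau> x) has_real_derivative a * uxx t x + b * ux t x + c * u t x) (at t)"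
    using pde[of t1] by blast
  show ?thesis
  proof (rule box_minimum_principle[where v = u and K = "C + 1" and p = p and q = q])
    show "continuous_on ({t0..t1} \<times> {p..q}) (\<lambda>(t, x). u t x)"
      by (rule continuous_on_subset[OF cont]) (use t0 in auto)
    fix t x d assume *: "t0 < t" "t \<le> t1" "u t x < 0" "0 < d"
      "\<And>y. \<bar>y - x\<bar> < d \<Longrightarrow> u t x \<le> u t y"
    have t: "0 < t" using t0 * by simp
    obtain a b c where abc: "1 / C \<le> a" "\<bar>c\<bar> \<le> C"
      "((\<lambda>\<tau>. u \<tau> x) has_real_derivative a * uxx t x + b * ux t x + c * u t x) (at t)"
      using C[OF t *(2)] by blast
    have "- u t y \<le> - u t x" if "\<bar>y - x\<bar> < d" for y
      using *(5)[OF that] by simp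
    note ext = local_max_second_derivative[OF DERIV_minus[OF ux[OF t]] DERIV_minus[OF uxx[OF t]] *(4) this]
    have "0 \<le> a" using abc(1) \<open>C > 0\<close> by (meson divide_nonneg_pos le_less_trans not_less zero_le_one order_trans)
    then have "0 \<le> a * uxx t x" using ext(2) by simp
    moreover have "(C + 1) * u t x < c * u t x"
      using *(3) abc(2) by (intro mult_strict_right_mono_neg) auto
    ultimately show "\<exists>D. ((\<lambda>s. u s x) has_real_derivative D) (at t) \<and> (C + 1) * u t x < D"
      using abc(3) ext(1) by (intro exI[of _ "a * uxx t x + b * ux t x + c * u t x"]) auto
  qed (use tx bottom sides in auto)
qed

text \<open>The barrier is the travelling front \<open>\<epsilon> (exp (M y) - 1)\<close> with \<open>y = B (t - t0) - (x - p)\<close>, which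
  is nonpositive at time \<open>t0\<close> and on the right side, and positive at time \<open>t1\<close> left of \<open>q\<close>.\<close>

lemma positive_from_left_aux:
  assumes t0: "0 \<le> t0" "t0 < t1" and x: "p < x" "x < q"
    and nonneg: "\<And>t y. t \<in> {t0..t1} \<Longrightarrow> y \<in> {p..q} \<Longrightarrow> 0 \<le> u t y"
    and left: "\<And>t. t \<in> {t0..t1} \<Longrightarrow> 0 < u t p"
  shows "0 < u t1 x"
proof -
  obtain C where "C > 0" and C: "\<And>t x. 0 < t \<Longrightarrow> t \<le> t1 \<Longrightarrow>
    \<exists>a b c. 1 / C \<le> a \<and> a \<le> C \<and> \<bar>b\<bar> \<le> C \<and> \<bar>c\<bar> \<le> C \<and>
      ((\<lambda>\<tau>. u \<tau> x) has_real_derivative a * uxx t x + b * ux t x + c * u t x) (at t)"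
    using pde[of t1] by blast
  have "continuous_on {t0..t1} (\<lambda>t. u t p)"
    using t0 by (intro cont_compose continuous_intros) auto
  then obtain tm where tm: "tm \<in> {t0..t1}" "\<And>t. t \<in> {t0..t1} \<Longrightarrow> u tm p \<le> u t p"
    using continuous_attains_inf[of "{t0..t1}" "\<lambda>t. u t p"] t0 by auto
  \<comment> \<open>With this speed the front moves from \<open>p\<close> to \<open>q\<close>
    exactly during \<open>{t0..t1}\<close>.\<close>
  define B where "B = (q - p) / (t1 - t0)"
  \<comment> \<open>The steepness makes \<open>M\<^sup>2 / C\<close>, a lower bound for the
    diffusion term, exceed the contributions \<open>M * B\<close> of the motion,
    \<open>C * M\<close> of the drift and \<open>C\<close> of the zeroth order term.\<close>
  define M where "M = C * (C + B) + C + 1"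
  \<comment> \<open>With this factor the front stays below the minimum \<open>u tm p\<close> of
    \<open>u\<close> on the left side.\<close>
  define \<epsilon> where "\<epsilon> = u tm p * exp (- M * (q - p))"
  define E where "E = (\<lambda>t y. exp (M * (B * (t - t0) - (y - p))))"
  define h where "h = (\<lambda>t y. \<epsilon> * (E t y - 1))"
  have B: "B > 0" using t0 x by (simp add: B_def)
  have M: "M > 0" "M \<ge> C + 1" using B \<open>C > 0\<close> by (auto simp: M_def intro: add_nonneg_pos)
  have \<epsilon>: "\<epsilon> > 0" using left[OF tm(1)] by (simp add: \<epsilon>_def)
  have h_sgn: "0 < h t y \<longleftrightarrow> y - p < B * (t - t0)" for t y
    using \<epsilon> M by (simp add: h_def E_def zero_less_mult_iff)
  have Bt: "B * (t - t0) \<le> q - p" if "t \<in> {t0..t1}" for t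
  proof -
    have "B * (t - t0) \<le> B * (t1 - t0)" using B that by (intro mult_left_mono) auto
    then show ?thesis using t0 by (simp add: B_def)
  qed
  have "0 \<le> u t1 x - h t1 x"
  proof (rule box_minimum_principle[where v = "\<lambda>t y. u t y - h t y" and K = C and q = q and p = p])
    have "continuous_on ({t0..t1} \<times> {p..q}) (\<lambda>z. u (fst z) (snd z) - h (fst z) (snd z))"
      unfolding h_def E_def
      by (intro continuous_intros cont_compose) (use t0 in auto)
    then show "continuous_on ({t0..t1} \<times> {p..q}) (\<lambda>(t, y). u t y - h t y)"
      by (simp add: case_prod_unfold)
    show "0 \<le> u t0 y - h t0 y" if "y \<in> {p..q}" for y
      using h_sgn[of t0 y] that nonneg[of t0 y] t0 by auto
    show "0 \<le> u t q - h t q" if "t \<in> {t0..t1}" for t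
      using h_sgn[of t q] that nonneg[of t q] Bt[OF that] x by auto
    show "0 \<le> u t p - h t p" if t: "t \<in> {t0..t1}" for t
    proof -
      have "E t p \<le> exp (M * (q - p))"
        unfolding E_def using Bt[OF t] M by (simp add: mult_left_mono)
      then have "\<epsilon> * (E t p - 1) \<le> \<epsilon> * exp (M * (q - p))" using \<epsilon> by (intro mult_left_mono) auto
      also have "\<dots> = u tm p" by (simp add: \<epsilon>_def exp_minus field_simps flip: exp_add)
      finally show ?thesis using tm(2)[OF t] by (simp add: h_def)
    qed
    fix t y d assume *: "t0 < t" "t \<le> t1" "p < y" "y < q" "u t y - h t y < 0" "0 < d"
      "\<And>y'. \<bar>y' - y\<bar> < d \<Longrightarrow> u t y - h t y \<le> u t y' - h t y'"
    have t: "0 < t" using t0 * by simp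
    obtain a b c where abc: "1 / C \<le> a" "\<bar>b\<bar> \<le> C" "\<bar>c\<bar> \<le> C"
      "((\<lambda>\<tau>. u \<tau> y) has_real_derivative a * uxx t y + b * ux t y + c * u t y) (at t)"
      using C[OF t *(2)] by blast
    have h1: "((\<lambda>y. h t y) has_real_derivative - \<epsilon> * M * E t y) (at y)" for y
      unfolding h_def E_def by (auto intro!: derivative_eq_intros)
    have h2: "((\<lambda>y. - \<epsilon> * M * E t y) has_real_derivative \<epsilon> * M\<^sup>2 * E t y) (at y)" for y
      unfolding E_def by (auto intro!: derivative_eq_intros simp: power2_eq_square)
    have ht: "((\<lambda>t. h t y) has_real_derivative \<epsilon> * M * B * E t y) (at t)"
      unfolding h_def E_def by (auto intro!: derivative_eq_intros)
    have "- (u t y' - h t y') \<le> - (u t y - h t y)" if "\<bar>y' - y\<bar> < d" for y'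
      using *(7)[OF that] by simp
    note ext = local_max_second_derivative[OF DERIV_minus[OF DERIV_diff[OF ux[OF t] h1]]
        DERIV_minus[OF DERIV_diff[OF uxx[OF t] h2]] *(6) this]
    have a0: "0 < a" using abc(1) \<open>C > 0\<close> by (meson less_le_trans zero_less_divide_1_iff)
    \<comment> \<open>Since \<open>u\<close> is nonnegative, \<open>u - h\<close> can be negative
      only where the front is positive; there \<open>0 < h \<le> e\<close>, which controls the
      zeroth order term.\<close>
    have "0 \<le> u t y" using nonneg * by auto
    then have hpos: "0 < h t y" using *(5) by simp
    define e where "e = \<epsilon> * E t y"
    have e: "e > 0" using \<epsilon> by (simp add: e_def E_def)
    have h_le: "h t y \<le> e" using \<epsilon> by (simp add: h_def e_def algebra_simps)
    have "C * M * B + C * (C * M + C) < M\<^sup>2"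
    proof -
      have "M\<^sup>2 = C * M * B + C * (C * M) + (C + 1) * M"
        by (simp add: M_def power2_eq_square algebra_simps)
      moreover have "C * C < (C + 1) * M" using \<open>C > 0\<close> M by (intro mult_strict_mono) auto
      ultimately show ?thesis by (simp add: algebra_simps)
    qed
    then have "M * B + C * M + C < M\<^sup>2 / C" using \<open>C > 0\<close> by (simp add: field_simps)
    also have "\<dots> \<le> a * M\<^sup>2" using mult_right_mono[OF abc(1), of "M\<^sup>2"] by simp
    finally have key: "e * (M * B + C * M + C) < e * (a * M\<^sup>2)" using e by simp
    have "\<bar>b * M\<bar> \<le> C * M" using abc(2) M by (simp add: abs_mult mult_right_mono)
    then have 1: "e * (b * M) \<le> e * (C * M)" using e by (intro mult_left_mono) auto
    have "\<bar>c * h t y\<bar> \<le> C * e" using abc(3) hpos h_le e \<open>C > 0\<close>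
      by (simp add: abs_mult mult_mono)
    then have 2: "- (C * e) \<le> c * h t y" by linarith
    have 3: "C * (u t y - h t y) \<le> c * (u t y - h t y)"
      using abc(3) *(5) by (intro mult_right_mono_neg) auto
    have 4: "a * (e * M\<^sup>2) \<le> a * uxx t y"
      using ext(2) a0 by (intro mult_left_mono) (auto simp: e_def mult_ac)
    have 5: "b * ux t y = - (e * (b * M))"
    proof -
      have "ux t y = - (e * M)" using ext(1) by (simp add: e_def mult_ac)
      then show ?thesis by simp
    qed
    have "C * (u t y - h t y) < a * uxx t y + b * ux t y + c * u t y - \<epsilon> * M * B * E t y"
      using key 1 2 3 4 5 by (simp add: e_def algebra_simps)
    then show "\<exists>D. ((\<lambda>s. u s y - h s y) has_real_derivative D) (at t) \<and>
        C * (u t y - h t y) < D"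
      using DERIV_diff[OF abc(4) ht] by blast
  qed (use x t0 in auto)
  moreover have "0 < h t1 x" using h_sgn[of t1 x] x t0 by (simp add: B_def)
  ultimately show ?thesis by simp
qed

end

lemma (in parabolic) positive_from_left:
  assumes "0 \<le> t0" "t0 < t1" "p < x" "x < q" and \<sigma>: "\<sigma> \<in> {1, - 1}"
    and "\<And>t y. t0 \<le> t \<Longrightarrow> t \<le> t1 \<Longrightarrow> p \<le> y \<Longrightarrow> y \<le> q \<Longrightarrow> 0 \<le> \<sigma> * u t y"
    and "\<And>t. t0 \<le> t \<Longrightarrow> t \<le> t1 \<Longrightarrow> 0 < \<sigma> * u t p"
  shows "0 < \<sigma> * u t1 x"
proof (cases "\<sigma> = 1")
  case True
  then show ?thesis using positive_from_left_aux[of t0 t1 p x q] assms by auto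
next
  case False
  then show ?thesis
    using parabolic.positive_from_left_aux[OF parabolic_uminus, of t0 t1 p x q] assms by auto
qed

lemma (in parabolic) positive_from_right:
  assumes "0 \<le> t0" "t0 < t1" "p < x" "x < q" and \<sigma>: "\<sigma> \<in> {1, - 1}"
    and "\<And>t y. t0 \<le> t \<Longrightarrow> t \<le> t1 \<Longrightarrow> p \<le> y \<Longrightarrow> y \<le> q \<Longrightarrow> 0 \<le> \<sigma> * u t y"
    and "\<And>t. t0 \<le> t \<Longrightarrow> t \<le> t1 \<Longrightarrow> 0 < \<sigma> * u t q"
  shows "0 < \<sigma> * u t1 x"
  using parabolic.positive_from_left[OF parabolic_reflect, of t0 t1 "- q" "- x" "- p" \<sigma>] assms
  by auto


section \<open>Sign changes persist backwards in time\<close>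

lemma config_alternates:
  assumes Q: "config L m s f l z" and l: "l > 0"
    and s: "\<And>i. s i \<in> {1, -1}" "\<And>i. i < m \<Longrightarrow> s (Suc i) = - s i"
  shows "alternates L f m z"
proof -
  have "z i < z (Suc i) \<and> f (z i) * f (z (Suc i)) < 0" if i: "i < m" for i
  proof -
    have "l \<le> s i * f (z i)" "l \<le> s (Suc i) * f (z (Suc i))" "z i \<le> z (Suc i)"
      using Q i by (auto simp: config_def)
    then have *: "l \<le> s i * f (z i)" "l \<le> - s i * f (z (Suc i))" "z i \<le> z (Suc i)"
      using s(2)[OF i] by auto
    from s(1)[of i] have "f (z i) * f (z (Suc i)) < 0"
    proof
      assume "s i = 1"
      then show ?thesis using * l by (intro mult_pos_neg) auto
    next
      assume "s i \<in> {- 1}"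
      then show ?thesis using * l by (intro mult_neg_pos) auto
    qed
    moreover from this have "z i \<noteq> z (Suc i)" by (auto simp: mult_less_0_iff)
    ultimately show ?thesis using *(3) by simp
  qed
  then show ?thesis using Q by (simp add: alternates_def config_def)
qed

text \<open>The signs of the values serve as \<open>s\<close>, the smallest of the finitely many
  absolute values as \<open>l\<close>. The pattern closes up since \<open>f\<close> is
  periodic.\<close>

lemma alternates_config:
  assumes alt: "alternates L f m x" and L: "L > 0" and per: "\<And>x. f (x + L) = f x"
  obtains s l where "\<And>i. s i \<in> {1, -1 :: real}" "\<And>i. i < m \<Longrightarrow> s (Suc i) = - s i" "s m = s 0"
    "l > 0" "config L m s f l x" "\<And>i. i \<le> m \<Longrightarrow> 0 < s i * f (x i)"
proof -
  define s where "s = (\<lambda>i. if 0 < f (x i) then 1 else -1 :: real)"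
  define l where "l = Min ((\<lambda>i. \<bar>f (x i)\<bar>) ` {..m})"
  have prod: "f (x i) * f (x (Suc i)) < 0" if "i < m" for i
    using alt that by (simp add: alternates_def)
  have last: "x m = x 0 + L" using alt by (simp add: alternates_def)
  have m: "m > 0" using last L by (intro gr0I) auto
  have nz: "f (x i) \<noteq> 0" if "i \<le> m" for i
  proof (cases "i = m")
    case True
    then show ?thesis using prod[OF m] per last by auto
  next
    case False
    then show ?thesis using prod[of i] that by auto
  qed
  have sf: "s i * f (x i) = \<bar>f (x i)\<bar>" for i by (simp add: s_def)
  have "l \<le> \<bar>f (x i)\<bar>" if "i \<le> m" for i unfolding l_def using that by (intro Min_le) auto
  then have "config L m s f l x"
    using alt sf by (auto simp: config_def alternates_def less_imp_le)
  moreover have "l > 0" unfolding l_def using nz by (subst Min_gr_iff) auto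
  moreover have "s (Suc i) = - s i" if "i < m" for i
    using prod[OF that] by (auto simp: s_def mult_less_0_iff)
  moreover have "s m = s 0" using per last by (simp add: s_def)
  moreover have "0 < s i * f (x i)" if "i \<le> m" for i using nz[OF that] sf by simp
  moreover have "s i \<in> {1, -1}" for i by (simp add: s_def)
  ultimately show ?thesis using that by blast
qed

text \<open>The sign flips at each of the \<open>m\<close> steps and returns to itself after one
  period.\<close>

lemma alternates_even:
  assumes alt: "alternates L f m x" and L: "L > 0" and per: "\<And>x. f (x + L) = f x"
  shows "even m"
proof -
  obtain s l where s: "\<And>i. s i \<in> {1, -1 :: real}" "\<And>i. i < m \<Longrightarrow> s (Suc i) = - s i" "s m = s 0"
    by (rule alternates_config[OF alt L per]) (rule that)
  have "s i = (- 1) ^ i * s 0" if "i \<le> m" for i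
    using that by (induction i) (use s(2) in auto)
  from this[of m] have "s 0 = (- 1) ^ m * s 0" using s(3) by simp
  moreover have "s 0 \<noteq> 0" using s(1)[of 0] by auto
  ultimately show ?thesis by (cases "even m") auto
qed

context parabolic
begin

text \<open>At a spatial maximum of \<open>\<sigma> * u\<close> with value \<open>l t\<close>, the
  equation bounds the time derivative of \<open>\<sigma> * u\<close> by \<open>c * l t\<close>,
  while \<open>l\<close> grows at the larger rate \<open>C + 1\<close>. So the level
  \<open>\<delta> * exp ((C + 1) * (t - t2))\<close> is admissible in
  \<open>config_backward\<close>, and it is still positive at \<open>t1\<close>.\<close>

lemma alternates_backward:
  assumes t: "0 \<le> t1" "t1 \<le> t2" and alt: "alternates L (u t2) m x"
  obtains y where "alternates L (u t1) m y"
proof -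
  have t2: "0 \<le> t2" using t by simp
  obtain s \<delta> where s: "\<And>i. s i \<in> {1, -1 :: real}" "\<And>i. i < m \<Longrightarrow> s (Suc i) = - s i" "s m = s 0"
    and \<delta>: "\<delta> > 0" "config L m s (u t2) \<delta> x"
    by (rule alternates_config[OF alt L per[OF t2]]) (rule that)
  obtain C where "C > 0" and C: "\<And>t x. 0 < t \<Longrightarrow> t \<le> t2 \<Longrightarrow>
    \<exists>a b c. 1 / C \<le> a \<and> a \<le> C \<and> \<bar>b\<bar> \<le> C \<and> \<bar>c\<bar> \<le> C \<and>
      ((\<lambda>\<tau>. u \<tau> x) has_real_derivative a * uxx t x + b * ux t x + c * u t x) (at t)"
    using pde[of t2] by blast
  define l where "l = (\<lambda>t. \<delta> * exp ((C + 1) * (t - t2)))"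
  have Q: "config L m s (u t2) (l t2) x" using \<delta> by (simp add: l_def)
  show ?thesis
  proof (rule config_backward[where w = u and l = l and ?t1.0 = t1 and ?t2.0 = t2, OF L t(2) _ _ _ _ _ s Q])
    show "continuous_on ({t1..t2} \<times> UNIV) (\<lambda>(t, x). u t x)"
      by (rule continuous_on_subset[OF cont]) (use t in auto)
    show "continuous_on {t1..t2} l" unfolding l_def by (intro continuous_intros)
    show "0 < l t" for t using \<delta> by (simp add: l_def)
    fix t x \<sigma> d :: real assume *: "t1 < t" "t \<le> t2" "\<sigma> \<in> {1, - 1}" "0 < d"
      "\<And>y. \<bar>y - x\<bar> < d \<Longrightarrow> \<sigma> * u t y \<le> \<sigma> * u t x" "\<sigma> * u t x = l t"
    have t0: "0 < t" using t * by simp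
    obtain a b c where abc: "1 / C \<le> a" "\<bar>c\<bar> \<le> C"
      "((\<lambda>\<tau>. u \<tau> x) has_real_derivative a * uxx t x + b * ux t x + c * u t x) (at t)"
      using C[OF t0 *(2)] by blast
    note ext = local_max_second_derivative[OF DERIV_cmult[OF ux[OF t0]]
        DERIV_cmult[OF uxx[OF t0]] *(4,5)]
    have "0 < a" using abc(1) \<open>C > 0\<close> by (meson less_le_trans zero_less_divide_1_iff)
    then have "a * (\<sigma> * uxx t x) \<le> 0" using ext(2) by (simp add: mult_le_0_iff)
    moreover have "\<sigma> * (b * ux t x) = 0" using ext(1) by auto
    moreover have "c * l t < (C + 1) * l t" using \<delta> abc(2) by (simp add: l_def)
    moreover have "\<sigma> * (a * uxx t x + b * ux t x + c * u t x) =
        a * (\<sigma> * uxx t x) + \<sigma> * (b * ux t x) + c * l t"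
      unfolding *(6)[symmetric] by (simp add: algebra_simps)
    ultimately have "\<sigma> * (a * uxx t x + b * ux t x + c * u t x) < (C + 1) * l t"
      by linarith
    moreover have "(l has_real_derivative (C + 1) * l t) (at t)"
      unfolding l_def by (auto intro!: derivative_eq_intros)
    ultimately show "\<exists>D D'. ((\<lambda>\<tau>. u \<tau> x) has_real_derivative D) (at t) \<and>
        (l has_real_derivative D') (at t) \<and> \<sigma> * D < D'"
      using abc(3) by blast
  next
    fix z assume "config L m s (u t1) (l t1) z"
    then show ?thesis using that config_alternates s \<delta>
      by (metis l_def exp_gt_zero mult_pos_pos)
  qed (use t per in auto)
qed

end

subsection \<open>Periodic bumps\<close>

text \<open>Only the point 0 is an issue; there the difference quotient is bounded by
  \<open>\<bar>h\<bar> ^ Suc n\<close>.\<close>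

lemma DERIV_positive_part_power:
  "((\<lambda>y :: real. max 0 y ^ Suc (Suc n)) has_real_derivative (of_nat n + 2) * max 0 y ^ Suc n) (at y)"
proof -
  consider "y < 0" | "y = 0" | "y > 0" by linarith
  then show ?thesis
  proof cases
    case 1
    have "((\<lambda>y. 0 :: real) has_real_derivative 0) (at y)" by simp
    then have "((\<lambda>y :: real. max 0 y ^ Suc (Suc n)) has_real_derivative 0) (at y)"
      by (rule has_field_derivative_transform_within_open[of _ _ _ "{..<0}"]) (use 1 in auto)
    then show ?thesis using 1 by simp
  next
    case 3
    have "((\<lambda>y. y ^ Suc (Suc n)) has_real_derivative (of_nat n + 2) * y ^ Suc n) (at y)"
      using DERIV_pow[of "Suc (Suc n)" y] by (simp add: algebra_simps)
    then have "((\<lambda>y :: real. max 0 y ^ Suc (Suc n)) has_real_derivative (of_nat n + 2) * y ^ Suc n) (at y)"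
      by (rule has_field_derivative_transform_within_open[of _ _ _ "{0<..}"]) (use 3 in auto)
    then show ?thesis using 3 by simp
  next
    case 2
    have "((\<lambda>h. max 0 h ^ Suc (Suc n) / h) \<longlongrightarrow> 0) (at (0::real))"
    proof (rule Lim_null_comparison)
      show "\<forall>\<^sub>F h in at 0. norm (max 0 h ^ Suc (Suc n) / h) \<le> \<bar>h\<bar> ^ Suc n"
      proof (intro always_eventually allI)
        show "norm (max 0 h ^ Suc (Suc n) / h) \<le> \<bar>h\<bar> ^ Suc n" for h :: real
          by (cases "h > 0") (auto simp: max_def mult_le_0_iff)
      qed
      show "((\<lambda>h :: real. \<bar>h\<bar> ^ Suc n) \<longlongrightarrow> 0) (at 0)"
        by (auto intro!: tendsto_eq_intros)
    qed
    then show ?thesis using 2 by (simp add: DERIV_def)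
  qed
qed

text \<open>With \<open>q = 2 * pi / L\<close> and \<open>k = cos (q * r)\<close> this is an
  \<open>L\<close>-periodic bump living within distance \<open>r\<close> of \<open>c\<close> modulo
  \<open>L\<close>. The cosine supplies the periodicity, and the third power makes the positive part
  twice differentiable, as the second derivative test requires. \<open>bump1\<close> and
  \<open>bump2\<close> are the first two derivatives.\<close>

definition bump :: "real \<Rightarrow> real \<Rightarrow> real \<Rightarrow> real \<Rightarrow> real" where
  "bump q k c x = max 0 (cos (q * (x - c)) - k) ^ 3"

definition bump1 :: "real \<Rightarrow> real \<Rightarrow> real \<Rightarrow> real \<Rightarrow> real" where
  "bump1 q k c x = 3 * max 0 (cos (q * (x - c)) - k) ^ 2 * (- q * sin (q * (x - c)))"

definition bump2 :: "real \<Rightarrow> real \<Rightarrow> real \<Rightarrow> real \<Rightarrow> real" where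
  "bump2 q k c x = 6 * max 0 (cos (q * (x - c)) - k) * (q * sin (q * (x - c)))\<^sup>2
     - 3 * max 0 (cos (q * (x - c)) - k) ^ 2 * (q\<^sup>2 * cos (q * (x - c)))"

lemma DERIV_bump: "(bump q k c has_real_derivative bump1 q k c x) (at x)"
proof -
  have "((\<lambda>x. cos (q * (x - c)) - k) has_real_derivative - q * sin (q * (x - c))) (at x)"
    by (auto intro!: derivative_eq_intros)
  from DERIV_chain2[OF DERIV_positive_part_power[of 1] this] show ?thesis
    by (simp add: bump_def[abs_def] bump1_def numeral_eq_Suc)
qed

lemma DERIV_bump1: "(bump1 q k c has_real_derivative bump2 q k c x) (at x)"
proof -
  have "((\<lambda>x. cos (q * (x - c)) - k) has_real_derivative - q * sin (q * (x - c))) (at x)"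
    by (auto intro!: derivative_eq_intros)
  note * = DERIV_chain2[OF DERIV_positive_part_power[of 0] this]
  have "((\<lambda>x. 3 * max 0 (cos (q * (x - c)) - k) ^ Suc (Suc 0) * (- q * sin (q * (x - c)))) has_real_derivative bump2 q k c x) (at x)"
    by (rule derivative_eq_intros * refl)+
      (simp add: bump2_def power2_eq_square algebra_simps)
  then show ?thesis by (simp add: bump1_def[abs_def] numeral_eq_Suc)
qed

text \<open>The positive part lies between 0 and 2. What matters is that the bounds are independent
  of \<open>c\<close> and \<open>x\<close>; sharpness is not aimed at.\<close>

lemma bump_bounds:
  assumes "q \<ge> 0" "-1 \<le> k"
  shows "0 \<le> bump q k c x" "bump q k c x \<le> 8" "\<bar>bump1 q k c x\<bar> \<le> 12 * q" "\<bar>bump2 q k c x\<bar> \<le> 36 * q\<^sup>2"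
proof -
  define p where "p = max 0 (cos (q * (x - c)) - k)"
  have "cos (q * (x - c)) - k \<le> 2" using assms(2) cos_le_one[of "q * (x - c)"] by linarith
  then have p: "0 \<le> p" "p \<le> 2" by (auto simp: p_def)
  have p2: "p\<^sup>2 \<le> 2\<^sup>2" and p3: "p ^ 3 \<le> 2 ^ 3" using p by (intro power_mono; simp)+
  show "0 \<le> bump q k c x" "bump q k c x \<le> 8" using p p3 by (auto simp: bump_def p_def)
  have "\<bar>bump1 q k c x\<bar> = 3 * p\<^sup>2 * (q * \<bar>sin (q * (x - c))\<bar>)"
    using assms by (simp add: bump1_def p_def abs_mult)
  also have "\<dots> \<le> 3 * 2\<^sup>2 * (q * 1)" using assms p2 by (intro mult_mono) auto
  finally show "\<bar>bump1 q k c x\<bar> \<le> 12 * q" by simp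
  have s: "(sin (q * (x - c)))\<^sup>2 \<le> 1" by (simp add: power2_le_iff_abs_le abs_square_le_1)
  have "\<bar>bump2 q k c x\<bar> \<le> \<bar>6 * p * (q * sin (q * (x - c)))\<^sup>2\<bar> + \<bar>3 * p\<^sup>2 * (q\<^sup>2 * cos (q * (x - c)))\<bar>"
    unfolding bump2_def p_def by (rule abs_triangle_ineq4)
  also have "\<dots> = 6 * p * (q\<^sup>2 * (sin (q * (x - c)))\<^sup>2) + 3 * p\<^sup>2 * (q\<^sup>2 * \<bar>cos (q * (x - c))\<bar>)"
    using p by (simp add: abs_mult power_mult_distrib)
  also have "\<dots> \<le> 6 * 2 * (q\<^sup>2 * 1) + 3 * 2\<^sup>2 * (q\<^sup>2 * 1)"
    using p p2 s by (intro add_mono mult_mono) auto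
  also have "\<dots> \<le> 36 * q\<^sup>2" by simp
  finally show "\<bar>bump2 q k c x\<bar> \<le> 36 * q\<^sup>2" .
qed

text \<open>The distance from \<open>d\<close> to the nearest multiple of \<open>L\<close> is at
  least \<open>r\<close>, and the cosine decreases with this distance.\<close>

lemma cos_le_cos_periodic:
  assumes L: "L > 0" and r: "0 < r" "r \<le> \<bar>d\<bar>" "\<bar>d\<bar> \<le> L - r"
  shows "cos (2 * pi / L * d) \<le> cos (2 * pi / L * r)"
proof -
  define q where "q = 2 * pi / L"
  have q: "q > 0" "q * L = 2 * pi" using L by (auto simp: q_def)
  have cosd: "cos (q * d) = cos (q * \<bar>d\<bar>)" by (cases "d \<ge> 0") auto
  have r2: "r \<le> L / 2" using r by simp
  show ?thesis
  proof (cases "\<bar>d\<bar> \<le> L / 2")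
    case True
    have "q * r \<le> q * \<bar>d\<bar>" "q * \<bar>d\<bar> \<le> q * (L / 2)" using True r q by (intro mult_left_mono; simp)+
    then have "cos (q * \<bar>d\<bar>) \<le> cos (q * r)" using q r by (intro cos_monotone_0_pi_le) auto
    then show ?thesis using cosd by (simp add: q_def)
  next
    case False
    have "q * r \<le> q * (L - \<bar>d\<bar>)" "q * (L - \<bar>d\<bar>) \<le> q * (L / 2)"
      using False r q by (intro mult_left_mono; simp)+
    then have "cos (q * (L - \<bar>d\<bar>)) \<le> cos (q * r)" using q r by (intro cos_monotone_0_pi_le) auto
    moreover have "q * (L - \<bar>d\<bar>) = 2 * pi - q * \<bar>d\<bar>" using q by (simp add: algebra_simps)
    ultimately show ?thesis using cosd by (simp add: q_def cos_diff)
  qed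
qed

lemma bump_periodic: "L > 0 \<Longrightarrow> bump (2 * pi / L) k c (x + L) = bump (2 * pi / L) k c x"
proof -
  assume "L > 0"
  then have "2 * pi / L * (x + L - c) = 2 * pi / L * (x - c) + 2 * pi" by (simp add: field_simps)
  then show ?thesis by (simp only: bump_def cos_periodic)
qed

lemma bump_support:
  assumes L: "L > 0" and r: "0 < r" "r \<le> L / 2"
    and nz: "bump (2 * pi / L) (cos (2 * pi / L * r)) c x \<noteq> 0"
  obtains k :: int where "\<bar>x + of_int k * L - c\<bar> \<le> r"
proof -
  \<comment> \<open>This shift brings \<open>x\<close> to within half a period of
    \<open>c\<close>.\<close>
  define k where "k = - \<lfloor>(x - c + L / 2) / L\<rfloor>"
  define d where "d = x + of_int k * L - c"
  have d: "\<bar>d\<bar> \<le> L / 2"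
    using floor_divide_lower[OF L, of "x - c + L / 2"] floor_divide_upper[OF L, of "x - c + L / 2"]
    unfolding d_def k_def abs_le_iff by (simp add: algebra_simps)
  have "bump (2 * pi / L) (cos (2 * pi / L * r)) c (x + of_int k * L) \<noteq> 0"
    using nz periodic_shift_of_int[of "bump (2 * pi / L) (cos (2 * pi / L * r)) c" L,
        OF bump_periodic[OF L]] by simp
  then have "cos (2 * pi / L * r) < cos (2 * pi / L * d)"
    by (auto simp: bump_def max_def d_def split: if_splits)
  then have "\<bar>d\<bar> < r" using cos_le_cos_periodic[OF L r(1), of d] d r by fastforce
  then show ?thesis using that[of k] by (simp add: d_def)
qed

text \<open>Let \<open>w = u + \<epsilon> * \<phi>\<close> with bumps of alternating sign at the
  zeros \<open>c i\<close>, so that the signed values of \<open>w\<close> there are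
  \<open>\<epsilon> * A\<close> at time \<open>\<tau>\<close>. Up to an error of at most
  \<open>\<epsilon> * \<eta>\<close> the function \<open>w\<close> satisfies the equation of
  \<open>u\<close>, so \<open>config_backward\<close> applies with a level that falls linearly in
  backward time at rate \<open>\<epsilon> * A * M\<close>. During \<open>T0 = 1 / (2 * M)\<close> it
  loses half its height, whatever \<epsilon> is. At time \<open>t\<close> the function
  \<open>u\<close> is nonzero on the supports, so for small \<epsilon> the configuration found for
  \<open>w\<close> has the signs of \<open>u\<close>. \<open>T0\<close> is fixed before the time and
  the centres, since the time, and in one application also the centres, will depend on it.\<close>

lemma (in parabolic) bump_alternation:
  assumes \<tau>: "\<tau> > 0" and r: "0 < r" "r < L / 2" and m: "even m"
  obtains T0 where "T0 > 0" "\<And>t c. \<tau> - T0 \<le> t \<Longrightarrow> 0 \<le> t \<Longrightarrow> t \<le> \<tau> \<Longrightarrow>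
    (\<And>i. i < m \<Longrightarrow> c i + 2 * r < c (Suc i)) \<Longrightarrow> c m = c 0 + L \<Longrightarrow>
    (\<And>i. i < m \<Longrightarrow> u \<tau> (c i) = 0) \<Longrightarrow>
    (\<And>i x. i < m \<Longrightarrow> \<bar>x - c i\<bar> \<le> r \<Longrightarrow> u t x \<noteq> 0) \<Longrightarrow> \<exists>y. alternates L (u t) m y"
proof -
  obtain C where "C > 0" and C: "\<And>t x. 0 < t \<Longrightarrow> t \<le> \<tau> \<Longrightarrow>
    \<exists>a b c. 1 / C \<le> a \<and> a \<le> C \<and> \<bar>b\<bar> \<le> C \<and> \<bar>c\<bar> \<le> C \<and>
      ((\<lambda>\<tau>. u \<tau> x) has_real_derivative a * uxx t x + b * ux t x + c * u t x) (at t)"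
    using pde[of \<tau>] by blast
  define q where "q = 2 * pi / L"
  define k where "k = cos (q * r)"
  \<comment> \<open>\<open>A\<close> is the height of a bump at its centre, \<open>\<eta>\<close>
    bounds \<open>a * \<phi>2 + b * \<phi>1 + e * \<phi>\<close> for a signed sum
    \<open>\<phi>\<close> of \<open>m\<close> bumps, and \<open>M\<close> is such that \<open>C *
    (\<epsilon> * A) + \<epsilon> * \<eta> < \<epsilon> * A * M\<close>.\<close>
  define A where "A = (1 - k) ^ 3"
  define \<eta> where "\<eta> = of_nat m * (C * (36 * q\<^sup>2) + C * (12 * q) + C * 8)"
  define M where "M = C + \<eta> / A + 1"
  define T0 where "T0 = 1 / (2 * M)"
  have q: "q > 0" using L by (simp add: q_def)
  have "q * r < q * (L / 2)" using q r by (intro mult_strict_left_mono) auto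
  then have "k < cos 0" unfolding k_def using q r L by (intro cos_monotone_0_pi) (auto simp: q_def)
  then have k: "k < 1" "- 1 \<le> k" by (auto simp: k_def)
  have A: "A > 0" using k by (simp add: A_def)
  have \<eta>: "\<eta> \<ge> 0" using q \<open>C > 0\<close> by (auto simp: \<eta>_def)
  have M: "M > 0" using \<eta> A \<open>C > 0\<close> by (auto simp: M_def intro!: add_nonneg_pos add_pos_nonneg)
  have T0: "T0 > 0" using M by (simp add: T0_def)
  show ?thesis
  proof (rule that[OF T0])
    fix t1 c
    assume t1: "\<tau> - T0 \<le> t1" "0 \<le> t1" "t1 \<le> \<tau>"
      and sep: "\<And>i. i < m \<Longrightarrow> c i + 2 * r < c (Suc i)" and cm: "c m = c 0 + L"
      and zero: "\<And>i. i < m \<Longrightarrow> u \<tau> (c i) = 0"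
      and nz: "\<And>i x. i < m \<Longrightarrow> \<bar>x - c i\<bar> \<le> r \<Longrightarrow> u t1 x \<noteq> 0"
    have m0: "m > 0" using cm L by (intro gr0I) auto
    define s where "s = (\<lambda>i. (- 1) ^ i :: real)"
    have s: "s i \<in> {1, -1}" "s (Suc i) = - s i" "s m = s 0" for i
      using m by (cases "even i"; simp add: s_def)+
    have s2: "s i * s i = 1" for i using s(1)[of i] by auto
    define \<phi> where "\<phi> = (\<lambda>x. \<Sum>i<m. s i * bump q k (c i) x)"
    define \<phi>1 where "\<phi>1 = (\<lambda>x. \<Sum>i<m. s i * bump1 q k (c i) x)"
    define \<phi>2 where "\<phi>2 = (\<lambda>x. \<Sum>i<m. s i * bump2 q k (c i) x)"
    have \<phi>1: "(\<phi> has_real_derivative \<phi>1 x) (at x)" for x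
      unfolding \<phi>_def \<phi>1_def by (intro DERIV_sum DERIV_cmult DERIV_bump)
    have \<phi>2: "(\<phi>1 has_real_derivative \<phi>2 x) (at x)" for x
      unfolding \<phi>1_def \<phi>2_def by (intro DERIV_sum DERIV_cmult DERIV_bump1)
    have bnd: "\<bar>\<Sum>i<m. s i * f i\<bar> \<le> of_nat m * b" if "\<And>i. \<bar>f i\<bar> \<le> b" for f b
    proof -
      have "\<bar>\<Sum>i<m. s i * f i\<bar> \<le> (\<Sum>i<m. \<bar>s i * f i\<bar>)" by (rule sum_abs)
      also have "\<dots> \<le> (\<Sum>i<m. b)"
        using that by (intro sum_mono) (auto simp: s_def abs_mult power_abs)
      finally show ?thesis by simp
    qed
    have \<phi>_bnd: "\<bar>\<phi> x\<bar> \<le> of_nat m * 8" "\<bar>\<phi>1 x\<bar> \<le> of_nat m * (12 * q)"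
      "\<bar>\<phi>2 x\<bar> \<le> of_nat m * (36 * q\<^sup>2)" for x
      unfolding \<phi>_def \<phi>1_def \<phi>2_def using bump_bounds[OF less_imp_le[OF q] k(2)]
      by (intro bnd; simp)+
    have \<phi>_per: "\<phi> (x + L) = \<phi> x" for x
      unfolding \<phi>_def q_def using bump_periodic[OF L] by simp
    have mono: "c i + 2 * r \<le> c j" if "i < j" "j \<le> m" for i j
      using that
    proof (induction j)
      case (Suc j)
      then show ?case using sep[of j] r by (cases "i = j") auto
    qed simp
    have \<phi>_c: "\<phi> (c i) = s i * A" if i: "i < m" for i
    proof -
      have "bump q k (c j) (c i) = 0" if j: "j < m" "j \<noteq> i" for j
      proof -
        have "r \<le> \<bar>c i - c j\<bar>"
          using mono[of i j] mono[of j i] i j r by (cases "i < j") auto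
        moreover have "\<bar>c i - c j\<bar> \<le> L - r"
          using mono[of i m] mono[of j m] mono[of 0 i] mono[of 0 j] i j r cm
          by (cases "i = 0"; cases "j = 0") auto
        ultimately have "cos (q * (c i - c j)) \<le> k"
          unfolding q_def k_def by (rule cos_le_cos_periodic[OF L r(1)])
        then show ?thesis by (simp add: bump_def)
      qed
      then have "\<phi> (c i) = (\<Sum>j<m. if j = i then s i * A else 0)"
        unfolding \<phi>_def using k by (intro sum.cong) (auto simp: bump_def A_def)
      then show ?thesis using i by simp
    qed
    \<comment> \<open>Compactness of the union of the closed \<open>r\<close>-neighbourhoods bounds
      \<open>\<bar>u t1\<bar>\<close> from below on them; periodicity carries the bound to the whole
      support of \<open>\<phi>\<close>.\<close>
    obtain c0 where c0: "c0 > 0" "\<And>x. \<phi> x \<noteq> 0 \<Longrightarrow> c0 \<le> \<bar>u t1 x\<bar>"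
    proof -
      define S where "S = (\<Union>i<m. {c i - r..c i + r})"
      have "compact S" unfolding S_def by (intro compact_UN) auto
      moreover have "S \<noteq> {}" using m0 r by (auto simp: S_def)
      moreover have "continuous_on S (\<lambda>x. \<bar>u t1 x\<bar>)"
        using t1 by (intro continuous_intros cont_slice)
      ultimately obtain x0 where x0: "x0 \<in> S" "\<And>x. x \<in> S \<Longrightarrow> \<bar>u t1 x0\<bar> \<le> \<bar>u t1 x\<bar>"
        using continuous_attains_inf[of S "\<lambda>x. \<bar>u t1 x\<bar>"] by blast
      show ?thesis
      proof (rule that[of "\<bar>u t1 x0\<bar>"])
        show "0 < \<bar>u t1 x0\<bar>"
          using x0(1) nz by (auto simp: S_def abs_le_iff)
        fix x assume "\<phi> x \<noteq> 0"
        then obtain i where i: "i < m" "bump q k (c i) x \<noteq> 0"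
          unfolding \<phi>_def by (metis (no_types, lifting) lessThan_iff mult_zero_right sum.neutral)
        then obtain n :: int where n: "\<bar>x + of_int n * L - c i\<bar> \<le> r"
          using bump_support[OF L r(1), of "c i" x] r(2) by (auto simp: q_def k_def)
        have "x + of_int n * L \<in> S"
          unfolding S_def using i n by (intro UN_I[of i]) (auto simp: abs_le_iff)
        from x0(2)[OF this] show "\<bar>u t1 x0\<bar> \<le> \<bar>u t1 x\<bar>"
          using periodic_shift_of_int[of "u t1" L, OF per[OF t1(2)]] by simp
      qed
    qed
    define \<epsilon> where "\<epsilon> = c0 / (of_nat m * 8 + 1)"
    have \<epsilon>: "\<epsilon> > 0" using c0 by (simp add: \<epsilon>_def add_nonneg_pos)
    have \<epsilon>\<phi>: "\<bar>\<epsilon> * \<phi> x\<bar> < c0" for x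
    proof -
      have "\<bar>\<epsilon> * \<phi> x\<bar> \<le> \<epsilon> * (of_nat m * 8)"
        using \<epsilon> \<phi>_bnd(1)[of x] by (simp add: abs_mult)
      also have "\<dots> < \<epsilon> * (of_nat m * 8 + 1)" using \<epsilon> by simp
      also have "\<dots> = c0" by (simp add: \<epsilon>_def)
      finally show ?thesis .
    qed
    define w where "w = (\<lambda>t x. u t x + \<epsilon> * \<phi> x)"
    define l where "l = (\<lambda>t. \<epsilon> * A * (1 - (\<tau> - t) * M))"
    have lpos: "0 < l t" "l t \<le> \<epsilon> * A" if "t \<in> {t1..\<tau>}" for t
    proof -
      have "(\<tau> - t) * M \<le> T0 * M" using that t1 M by (intro mult_right_mono) auto
      also have "T0 * M = 1 / 2" using M by (simp add: T0_def)
      finally show "0 < l t" using \<epsilon> A by (simp add: l_def)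
      have "0 \<le> (\<tau> - t) * M" using that M by simp
      then show "l t \<le> \<epsilon> * A" using \<epsilon> A by (simp add: l_def mult_left_le)
    qed
    have "l \<tau> \<le> s i * w \<tau> (c i)" if im: "i \<le> m" for i
    proof -
      have eq: "l \<tau> = s i * w \<tau> (c i)" if "i < m" for i
        using zero[OF that] \<phi>_c[OF that] s2[of i] by (simp add: l_def w_def)
      have "w \<tau> (c m) = w \<tau> (c 0)"
        using cm per[of \<tau> "c 0"] \<phi>_per[of "c 0"] \<tau> by (simp add: w_def)
      then show ?thesis using eq[of i] eq[of 0] im m0 s(3) by (cases "i = m") auto
    qed
    then have Q: "config L m s (w \<tau>) (l \<tau>) c"
      using sep cm r by (force simp: config_def)
    obtain z where z: "config L m s (w t1) (l t1) z"
    proof (rule config_backward[where w = w and l = l and ?t1.0 = t1 and ?t2.0 = \<tau>,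
          OF L t1(3) _ _ _ _ _ s(1,2,3) Q])
      have cont\<phi>: "continuous_on S \<phi>" for S
        using \<phi>1 by (meson DERIV_isCont continuous_at_imp_continuous_on)
      have "continuous_on ({t1..\<tau>} \<times> UNIV) (\<lambda>z. w (fst z) (snd z))"
        unfolding w_def
        by (intro continuous_intros cont_compose continuous_on_compose2[OF cont\<phi>[of UNIV]])
          (use t1 in auto)
      then show "continuous_on ({t1..\<tau>} \<times> UNIV) (\<lambda>(t, x). w t x)"
        by (simp add: case_prod_unfold)
      show "continuous_on {t1..\<tau>} l" unfolding l_def by (intro continuous_intros)
      fix t x \<sigma> d :: real assume *: "t1 < t" "t \<le> \<tau>" "\<sigma> \<in> {1, - 1}" "0 < d"
        "\<And>y. \<bar>y - x\<bar> < d \<Longrightarrow> \<sigma> * w t y \<le> \<sigma> * w t x" "\<sigma> * w t x = l t"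
      have t0: "0 < t" using t1 * by simp
      obtain a b e where abc: "1 / C \<le> a" "a \<le> C" "\<bar>b\<bar> \<le> C" "\<bar>e\<bar> \<le> C"
        "((\<lambda>\<tau>. u \<tau> x) has_real_derivative a * uxx t x + b * ux t x + e * u t x) (at t)"
        using C[OF t0 *(2)] by blast
      have w1: "(w t has_real_derivative ux t x + \<epsilon> * \<phi>1 x) (at x)" for x
        unfolding w_def by (intro DERIV_add DERIV_cmult ux t0 \<phi>1)
      have w2: "((\<lambda>x. ux t x + \<epsilon> * \<phi>1 x) has_real_derivative uxx t x + \<epsilon> * \<phi>2 x) (at x)"
        by (intro DERIV_add DERIV_cmult uxx t0 \<phi>2)
      note ext = local_max_second_derivative[OF DERIV_cmult[OF w1] DERIV_cmult[OF w2] *(4,5)]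
      have a0: "0 < a" using abc(1) \<open>C > 0\<close> by (meson less_le_trans zero_less_divide_1_iff)
      have lt: "0 < l t" "l t \<le> \<epsilon> * A" using lpos * by auto
      have 1: "a * (\<sigma> * (uxx t x + \<epsilon> * \<phi>2 x)) \<le> 0"
        using ext(2) a0 by (simp add: mult_le_0_iff)
      have 2: "b * (\<sigma> * (ux t x + \<epsilon> * \<phi>1 x)) = 0" using ext(1) by simp
      have 3: "e * l t \<le> C * (\<epsilon> * A)"
        using abc(4) lt by (intro mult_mono) auto
      have "\<bar>a * \<phi>2 x + b * \<phi>1 x + e * \<phi> x\<bar> \<le> \<bar>a * \<phi>2 x\<bar> + \<bar>b * \<phi>1 x\<bar> + \<bar>e * \<phi> x\<bar>" by linarith
      also have "\<dots> \<le> C * (of_nat m * (36 * q\<^sup>2)) + C * (of_nat m * (12 * q)) + C * (of_nat m * 8)"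
        unfolding abs_mult using abc a0 \<phi>_bnd \<open>C > 0\<close> by (intro add_mono mult_mono) auto
      also have "\<dots> = \<eta>" by (simp add: \<eta>_def algebra_simps)
      finally have "\<bar>\<sigma> * (a * \<phi>2 x + b * \<phi>1 x + e * \<phi> x)\<bar> \<le> \<eta>" using *(3) by auto
      then have "\<epsilon> * - (\<sigma> * (a * \<phi>2 x + b * \<phi>1 x + e * \<phi> x)) \<le> \<epsilon> * \<eta>"
        using \<epsilon> by (intro mult_left_mono) linarith+
      then have 4: "- (\<epsilon> * (\<sigma> * (a * \<phi>2 x + b * \<phi>1 x + e * \<phi> x))) \<le> \<epsilon> * \<eta>" by simp
      \<comment> \<open>Completing the derivatives of \<open>u\<close> to those of \<open>w\<close>
        gives terms that vanish or have a sign at the spatial maximum of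
        \<open>\<sigma> * w\<close>; the compensating terms are the error bounded by
        \<open>\<epsilon> * \<eta>\<close>.\<close>
      have "\<sigma> * (a * uxx t x + b * ux t x + e * u t x) =
          a * (\<sigma> * (uxx t x + \<epsilon> * \<phi>2 x)) + b * (\<sigma> * (ux t x + \<epsilon> * \<phi>1 x)) + e * (\<sigma> * w t x)
          - \<epsilon> * (\<sigma> * (a * \<phi>2 x + b * \<phi>1 x + e * \<phi> x))"
        by (simp add: w_def algebra_simps)
      also have "\<dots> \<le> C * (\<epsilon> * A) + \<epsilon> * \<eta>" unfolding *(6) using 1 2 3 4 by linarith
      also have "\<dots> < \<epsilon> * A * M" using \<epsilon> A by (simp add: M_def field_simps)
      finally have "\<sigma> * (a * uxx t x + b * ux t x + e * u t x) < \<epsilon> * A * M" .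
      moreover have "(l has_real_derivative \<epsilon> * A * M) (at t)"
        unfolding l_def by (auto intro!: derivative_eq_intros)
      moreover have "((\<lambda>\<tau>. w \<tau> x) has_real_derivative a * uxx t x + b * ux t x + e * u t x) (at t)"
        unfolding w_def using DERIV_add[OF abc(5) DERIV_const[of "\<epsilon> * \<phi> x"]] by simp
      ultimately show "\<exists>D D'. ((\<lambda>\<tau>. w \<tau> x) has_real_derivative D) (at t) \<and>
          (l has_real_derivative D') (at t) \<and> \<sigma> * D < D'"
        by blast
    next
      show "w t (x + L) = w t x" if "t \<in> {t1..\<tau>}" for t x
        using that t1 per[of t x] \<phi>_per[of x] by (simp add: w_def)
    qed (use lpos in auto)
    define l' where "l' = Min ((\<lambda>i. s i * u t1 (z i)) ` {..m})"
    \<comment> \<open>Where \<open>\<phi>\<close> vanishes, \<open>w\<close> and \<open>u\<close>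
      agree; elsewhere \<open>\<bar>\<epsilon> * \<phi>\<bar> < c0 \<le> \<bar>u t1\<bar>\<close>,
      so removing the bumps does not change the sign.\<close>
    have "0 < s i * u t1 (z i)" if "i \<le> m" for i
    proof -
      have *: "0 < s i * w t1 (z i)" using z that lpos[of t1] t1 by (force simp: config_def)
      show ?thesis
      proof (cases "\<phi> (z i) = 0")
        case True
        then show ?thesis using * by (simp add: w_def)
      next
        case False
        then have "c0 \<le> \<bar>u t1 (z i)\<bar>" by (rule c0(2))
        with \<epsilon>\<phi>[of "z i"] * s(1)[of i] show ?thesis by (auto simp: w_def)
      qed
    qed
    then have "l' > 0" unfolding l'_def by (subst Min_gr_iff) auto
    moreover have "config L m s (u t1) l' z"
      using z by (auto simp: config_def l'_def intro!: Min_le)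
    ultimately show "\<exists>y. alternates L (u t1) m y" using config_alternates s by blast
  qed
qed


subsection \<open>Counting zeros over one period\<close>

lemma periodic_rmod:
  assumes L: "L > 0" and per: "\<And>x. f (x + L) = f x"
  shows "f (x rmod L) = f x"
proof -
  have "x rmod L = x + of_int (- \<lfloor>x / L\<rfloor>) * L"
    using L by (simp add: rmod_conv_frac frac_def algebra_simps)
  then show ?thesis using periodic_shift_of_int[of f L, OF per] by metis
qed

lemma rmod_eq_imp_eq:
  assumes "x rmod L = y rmod L" "\<bar>x - y\<bar> < L"
  shows "x = y"
proof -
  have L: "L > 0" using assms(2) by linarith
  have "frac (x / L) = frac (y / L)" using assms(1) L by (simp add: rmod_conv_frac)
  then have "x / L - y / L = of_int (\<lfloor>x / L\<rfloor> - \<lfloor>y / L\<rfloor>)" by (simp add: frac_def)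
  then have eq: "x - y = of_int (\<lfloor>x / L\<rfloor> - \<lfloor>y / L\<rfloor>) * L" using L by (simp add: field_simps)
  then have "\<bar>of_int (\<lfloor>x / L\<rfloor> - \<lfloor>y / L\<rfloor>) :: real\<bar> * L < 1 * L" using assms(2) L by (simp add: abs_mult)
  then have "\<bar>of_int (\<lfloor>x / L\<rfloor> - \<lfloor>y / L\<rfloor>) :: real\<bar> < 1" using L by (simp only: mult_less_cancel_right_pos)
  then have "\<lfloor>x / L\<rfloor> - \<lfloor>y / L\<rfloor> = 0" by linarith
  then show ?thesis using eq by simp
qed

lemma increasing_le:
  fixes x :: "nat \<Rightarrow> real"
  assumes "\<And>i. i < k \<Longrightarrow> x i < x (Suc i)" "i \<le> j" "j \<le> k"
  shows "x i \<le> x j"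
  using assms(2,3)
proof (induction j rule: dec_induct)
  case (step n)
  then show ?case using assms(1)[of n] by simp
qed simp

text \<open>The chosen zeros lie in disjoint gaps of a single period, so they are less than
  \<open>L\<close> apart and stay distinct modulo \<open>L\<close>.\<close>

lemma card_cyclic_zeros_ge:
  fixes f :: "real \<Rightarrow> real" and x :: "nat \<Rightarrow> real"
  assumes L: "L > 0" and per: "\<And>x. f (x + L) = f x"
    and x: "\<And>i. i < k \<Longrightarrow> x i < x (Suc i)" "x k = x 0 + L"
    and zero: "\<And>i. i < k \<Longrightarrow> \<exists>z. x i < z \<and> z < x (Suc i) \<and> f z = 0"
    and fin: "finite {z \<in> {0..<L}. f z = 0}"
  shows "k \<le> card {z \<in> {0..<L}. f z = 0}"
proof -
  obtain \<zeta> where \<zeta>: "\<And>i. i < k \<Longrightarrow> x i < \<zeta> i \<and> \<zeta> i < x (Suc i) \<and> f (\<zeta> i) = 0"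
    using zero by metis
  have lt: "\<zeta> i < \<zeta> j" "\<zeta> j - \<zeta> i < L" if "i < j" "j < k" for i j
  proof -
    have "x (Suc i) \<le> x j" "x (Suc j) \<le> x k" "x 0 \<le> x i"
      using that by (intro increasing_le[of k x, OF x(1)]; simp)+
    then show "\<zeta> i < \<zeta> j" "\<zeta> j - \<zeta> i < L" using \<zeta>[of i] \<zeta>[of j] that x(2) by auto
  qed
  have "inj_on (\<lambda>i. \<zeta> i rmod L) {..<k}"
  proof (rule linorder_inj_onI)
    fix i j assume "i < j" "i \<in> {..<k}" "j \<in> {..<k}"
    then show "\<zeta> i rmod L \<noteq> \<zeta> j rmod L"
      using rmod_eq_imp_eq[of "\<zeta> i" L "\<zeta> j"] lt[of i j] by auto
  qed auto
  moreover have "(\<lambda>i. \<zeta> i rmod L) ` {..<k} \<subseteq> {z \<in> {0..<L}. f z = 0}"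
    using \<zeta> L periodic_rmod[of L f, OF L per] by (auto simp: rmod_less rmod_nonneg)
  ultimately show ?thesis using card_inj_on_le[OF _ _ fin] by fastforce
qed

lemma find_gap:
  fixes q :: "nat \<Rightarrow> real"
  assumes "q 0 \<le> p" "p < q k"
  obtains i where "i < k" "q i \<le> p" "p < q (Suc i)"
  using assms
proof (induction k arbitrary: thesis)
  case (Suc k)
  show ?case
  proof (cases "p < q k")
    case True
    then show ?thesis using Suc.IH Suc.prems by (metis less_Suc_eq)
  next
    case False
    then show ?thesis using Suc.prems(3) by (intro Suc.prems(1)[of k]) auto
  qed
qed simp

text \<open>Every zero has a translate in the period starting at \<open>q 0\<close>, and the index
  of the gap containing it determines it, since the left end points are not zeros.\<close>

lemma card_gap_zeros_le:
  fixes f :: "real \<Rightarrow> real" and q :: "nat \<Rightarrow> real"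
  assumes L: "L > 0" and per: "\<And>x. f (x + L) = f x"
    and q: "q k = q 0 + L" and nz: "\<And>i. i < k \<Longrightarrow> f (q i) \<noteq> 0"
    and uniq: "\<And>i y z. i < k \<Longrightarrow> q i < y \<Longrightarrow> y < z \<Longrightarrow> z < q (Suc i) \<Longrightarrow> f y = 0 \<Longrightarrow> f z = 0 \<Longrightarrow> False"
  shows "finite {z \<in> {0..<L}. f z = 0} \<and> card {z \<in> {0..<L}. f z = 0} \<le> k"
proof -
  define Z where "Z = {z \<in> {0..<L}. f z = 0}"
  define p where "p = (\<lambda>z. q 0 + (z - q 0) rmod L)"
  have rmod: "y rmod L = y + of_int (- \<lfloor>y / L\<rfloor>) * L" for y
    using L by (simp add: rmod_conv_frac frac_def algebra_simps)
  have "p z = z + of_int (- \<lfloor>(z - q 0) / L\<rfloor>) * L" for z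
    unfolding p_def using rmod[of "z - q 0"] by linarith
  then have fp: "f (p z) = f z" for z
    using periodic_shift_of_int[of f L, OF per] by metis
  have p: "q 0 \<le> p z" "p z < q k" for z
    using L q by (auto simp: p_def rmod_less rmod_nonneg)
  have "\<exists>i<k. q i \<le> p z \<and> p z < q (Suc i)" for z
    using find_gap[OF p(1) p(2)] by blast
  then obtain g where g: "\<And>z. g z < k" "\<And>z. q (g z) \<le> p z" "\<And>z. p z < q (Suc (g z))" by metis
  have "inj_on g Z"
  proof (rule inj_onI)
    fix y z assume yz: "y \<in> Z" "z \<in> Z" "g y = g z"
    have f0: "f (p y) = 0" "f (p z) = 0" using yz fp by (auto simp: Z_def)
    have "q (g y) \<noteq> p y" "q (g z) \<noteq> p z" using f0 nz[OF g(1)[of y]] nz[OF g(1)[of z]] by auto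
    then have "q (g y) < p y" "q (g z) < p z" using g(2)[of y] g(2)[of z] by auto
    then have "p y = p z"
      using uniq[OF g(1)[of y], of "p y" "p z"] uniq[OF g(1)[of z], of "p z" "p y"] f0 g(3)[of y] g(3)[of z] yz(3)
      by (metis linorder_neqE_linordered_idom)
    then have "(y - q 0) rmod L = (z - q 0) rmod L" by (simp add: p_def)
    moreover have "\<bar>(y - q 0) - (z - q 0)\<bar> < L" using yz by (auto simp: Z_def)
    ultimately have "y - q 0 = z - q 0" by (rule rmod_eq_imp_eq)
    then show "y = z" by simp
  qed
  moreover have "g ` Z \<subseteq> {..<k}" using g(1) by auto
  ultimately have "finite Z" "card Z \<le> card {..<k}"
    using finite_lessThan[of k] by (metis inj_on_finite, metis card_inj_on_le)
  then show ?thesis by (simp add: Z_def)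
qed

lemma IVT_sign:
  fixes f :: "real \<Rightarrow> real"
  assumes "continuous_on {a..b} f" "a < b" "f a * f b < 0"
  obtains z where "a < z" "z < b" "f z = 0"
proof -
  have "\<exists>z. a \<le> z \<and> z \<le> b \<and> f z = 0"
  proof (cases "f a < 0")
    case True
    then have "f b > 0" using assms(3) by (simp add: mult_less_0_iff)
    then show ?thesis using IVT'[of f a 0 b] True assms by auto
  next
    case False
    then have "f a > 0" "f b < 0" using assms(3) by (auto simp: mult_less_0_iff)
    then show ?thesis using IVT2'[of f b 0 a] assms by auto
  qed
  then obtain z where "a \<le> z" "z \<le> b" "f z = 0" by blast
  moreover from this have "z \<noteq> a" "z \<noteq> b" using assms(3) by auto
  ultimately show ?thesis using that[of z] by auto
qed

lemma alternates_le_card: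
  assumes alt: "alternates L f m x" and L: "L > 0" and per: "\<And>x. f (x + L) = f x"
    and cont: "continuous_on UNIV f" and fin: "finite {z \<in> {0..<L}. f z = 0}"
  shows "m \<le> card {z \<in> {0..<L}. f z = 0}"
proof (rule card_cyclic_zeros_ge[where x = x, OF L _ _ _ _ fin])
  show "f (x + L) = f x" for x by (rule per)
  show "x i < x (Suc i)" if "i < m" for i using alt that by (simp add: alternates_def)
  show "x m = x 0 + L" using alt by (simp add: alternates_def)
  show "\<exists>z. x i < z \<and> z < x (Suc i) \<and> f z = 0" if "i < m" for i
    using IVT_sign[OF continuous_on_subset[OF cont], of "x i" "x (Suc i)"] alt that
    by (auto simp: alternates_def)
qed

text \<open>The value at \<open>y\<close> has the sign of that at \<open>q j\<close>, the value at
  \<open>x\<close> the opposite one, so the gap gains two sign changes. This is the means of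
  contradicting the maximality of a number of sign changes.\<close>

lemma alternates_insert:
  assumes alt: "alternates L f n q" and j: "j < n"
    and xy: "q j < x" "x < y" "y < q (Suc j)" "f (q j) * f x < 0" "f x * f y < 0"
  shows "\<exists>z. alternates L f (n + 2) z"
proof -
  define z where "z = (\<lambda>i. if i \<le> j then q i else if i = Suc j then x else if i = Suc (Suc j) then y
    else q (i - 2))"
  have last: "f y * f (q (Suc j)) < 0"
  proof -
    have "f (q j) * f (q (Suc j)) < 0" using alt j by (simp add: alternates_def)
    then show ?thesis using xy(4,5) by (auto simp: mult_less_0_iff)
  qed
  have "z i < z (Suc i) \<and> f (z i) * f (z (Suc i)) < 0" if "i < n + 2" for i
  proof -
    consider "i < j" | "i = j" | "i = Suc j" | "i = Suc (Suc j)" | "i > Suc (Suc j)" by linarith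
    then show ?thesis
    proof cases
      case 1
      then show ?thesis using alt j by (simp add: z_def alternates_def)
    next
      case 4
      then show ?thesis using xy last by (simp add: z_def)
    next
      case 5
      then have "Suc i - 2 = Suc (i - 2)" by simp
      then show ?thesis using 5 alt that by (simp add: z_def alternates_def)
    qed (use xy in \<open>simp_all add: z_def\<close>)
  qed
  moreover have "z (n + 2) = z 0 + L" using alt j by (simp add: z_def alternates_def)
  ultimately show ?thesis by (auto simp: alternates_def)
qed

section \<open>Signs at finitely many points over short times\<close>

context parabolic
begin

lemma nonneg_in_box_sign:
  assumes \<sigma>: "\<sigma> \<in> {1, - 1}" and t0: "0 \<le> t0"
    and "\<And>x. p \<le> x \<Longrightarrow> x \<le> q \<Longrightarrow> 0 \<le> \<sigma> * u t0 x"
    and "\<And>t. t0 \<le> t \<Longrightarrow> t \<le> t1 \<Longrightarrow> 0 \<le> \<sigma> * u t p"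
    and "\<And>t. t0 \<le> t \<Longrightarrow> t \<le> t1 \<Longrightarrow> 0 \<le> \<sigma> * u t q"
    and "t0 \<le> t" "t \<le> t1" "p \<le> x" "x \<le> q"
  shows "0 \<le> \<sigma> * u t x"
proof (cases "\<sigma> = 1")
  case True
  then show ?thesis using nonneg_in_box[of t0 p q t1 t x] assms by auto
next
  case False
  then show ?thesis
    using parabolic.nonneg_in_box[OF parabolic_uminus, of t0 p q t1 t x] assms by auto
qed

lemma persistent_signs:
  assumes fin: "finite I" and t: "0 \<le> t'" "t' < \<tau>" and nz: "\<And>x. x \<in> I \<Longrightarrow> u \<tau> x \<noteq> 0"
  shows "\<exists>s. t' \<le> s \<and> s < \<tau> \<and> (\<forall>t x. s \<le> t \<longrightarrow> t \<le> \<tau> \<longrightarrow> x \<in> I \<longrightarrow> 0 < u \<tau> x * u t x)"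
  using fin nz
proof (induction I rule: finite_induct)
  case empty
  then show ?case using t by auto
next
  case (insert x I)
  obtain s where s: "t' \<le> s" "s < \<tau>" "\<And>t x. s \<le> t \<Longrightarrow> t \<le> \<tau> \<Longrightarrow> x \<in> I \<Longrightarrow> 0 < u \<tau> x * u t x"
    using insert by blast
  have "0 < u \<tau> x * u \<tau> x" using insert.prems[of x] by (auto simp: zero_less_mult_iff)
  then obtain s' where "0 \<le> s'" "s' < \<tau>" "\<And>t. s' \<le> t \<Longrightarrow> t \<le> \<tau> \<Longrightarrow> 0 < u \<tau> x * u t x"
    using persistent_sign[of \<tau> "u \<tau> x" x] t by auto
  with s show ?case by (intro exI[of _ "max s s'"]) auto
qed

lemma alternates_persist:
  assumes "alternates L (u \<tau>) n q" "\<And>i. i \<le> n \<Longrightarrow> 0 < u \<tau> (q i) * u t (q i)"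
  shows "alternates L (u t) n q"
  unfolding alternates_def
proof (intro conjI allI impI)
  fix i assume i: "i < n"
  show "q i < q (Suc i)" using assms i by (simp add: alternates_def)
  have "u \<tau> (q i) * u \<tau> (q (Suc i)) < 0" using assms i by (simp add: alternates_def)
  then show "u t (q i) * u t (q (Suc i)) < 0"
    using assms(2)[of i] assms(2)[of "Suc i"] i by (auto simp: zero_less_mult_iff mult_less_0_iff)
qed (use assms in \<open>simp add: alternates_def\<close>)

lemma alternates_nonzero:
  assumes "alternates L (u t) n q" "i \<le> n" "0 \<le> t"
  shows "u t (q i) \<noteq> 0"
proof -
  obtain s l where "0 < s * u t (q i)"
    using alternates_config[OF assms(1) L per[OF assms(3)]] assms(2) by metis
  then show ?thesis by auto
qed

end

text \<open>Once finite, the number of sign changes is a nonincreasing integer, hence constant from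
  some time \<open>t'\<close> on before \<open>t2\<close>; the time \<open>t2\<close> is excluded
  since the number may drop there. The case \<open>n = 0\<close> stands apart because
  \<open>alternates\<close> with \<open>m = 0\<close> would give
  \<open>x 0 = x 0 + L\<close>.\<close>

locale constant_alternation = parabolic +
  fixes n :: nat and t' t2 :: real
  assumes nontrivial: "0 < t \<Longrightarrow> \<exists>x. u t x \<noteq> 0"
    and t': "0 \<le> t'" "t' < t2" and n: "even n"
    and attained: "t' \<le> t \<Longrightarrow> t < t2 \<Longrightarrow> n = 0 \<or> (\<exists>x. alternates L (u t) n x)"
    and maximal: "t' \<le> t \<Longrightarrow> t < t2 \<Longrightarrow> n < m \<Longrightarrow> \<not> alternates L (u t) m x"
begin

text \<open>A nonzero value at \<open>r\<close> has the sign of one end of the gap, and these signs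
  persist for a while before \<open>\<tau>\<close>. During that time a value of the other sign
  between \<open>r\<close> and this end would add two sign changes, so \<open>\<sigma> * u\<close>
  is nonnegative there. The strong maximum principle then makes it positive at the zero in between,
  which is \<open>y\<close> or \<open>z\<close> depending on the end.\<close>

lemma gap_zeros_convex:
  assumes \<tau>: "t' < \<tau>" "\<tau> < t2" and q: "alternates L (u \<tau>) n q" and j: "j < n"
    and z: "q j < y" "y < r" "r < z" "z < q (Suc j)" "u \<tau> y = 0" "u \<tau> z = 0"
  shows "u \<tau> r = 0"
proof (rule ccontr)
  assume r: "u \<tau> r \<noteq> 0"
  have \<tau>0: "0 \<le> \<tau>" using \<tau> t' by simp
  have "finite (insert r (q ` {..n}))" by simp
  from persistent_signs[OF this t'(1) \<tau>(1)] obtain s where s: "t' \<le> s" "s < \<tau>"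
    "\<And>t x. s \<le> t \<Longrightarrow> t \<le> \<tau> \<Longrightarrow> x \<in> insert r (q ` {..n}) \<Longrightarrow> 0 < u \<tau> x * u t x"
    using r alternates_nonzero[OF q _ \<tau>0] by blast
  have alt: "alternates L (u t) n q" if "s \<le> t" "t \<le> \<tau>" for t
    by (rule alternates_persist[OF q]) (use s(3)[OF that] in auto)
  have no: False if t: "s \<le> t" "t \<le> \<tau>" and "q j < a" "a < b" "b < q (Suc j)"
    "u t (q j) * u t a < 0" "u t a * u t b < 0" for t a b
    using alternates_insert[OF alt[OF t] j that(3-7)] maximal[of t "n + 2"] t s \<tau> by auto
  define \<sigma> where "\<sigma> = sgn (u \<tau> r)"
  have \<sigma>: "\<sigma> \<in> {1, - 1}" using r by (auto simp: \<sigma>_def sgn_if)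
  have rpos: "0 < \<sigma> * u t r" if "s \<le> t" "t \<le> \<tau>" for t
    using s(3)[OF that, of r] by (auto simp: \<sigma>_def sgn_if zero_less_mult_iff)
  have ends: "u \<tau> (q j) * u \<tau> (q (Suc j)) < 0" using q j by (simp add: alternates_def)
  show False
  proof (cases "0 < \<sigma> * u \<tau> (q j)")
    case True
    have left: "0 < \<sigma> * u t (q j)" if "s \<le> t" "t \<le> \<tau>" for t
      using s(3)[OF that, of "q j"] True j by (auto simp: zero_less_mult_iff)
    have "0 < \<sigma> * u \<tau> y"
    proof (rule positive_from_left[OF _ s(2) z(1,2) \<sigma>])
      fix t x assume t: "s \<le> t" "t \<le> \<tau>" and x: "q j \<le> x" "x \<le> r"
      show "0 \<le> \<sigma> * u t x"
      proof (rule ccontr)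
        assume neg: "\<not> ?thesis"
        then have "x \<noteq> q j" "x \<noteq> r" using left[OF t] rpos[OF t] by auto
        then show False using no[OF t, of x r] x z neg left[OF t] rpos[OF t] \<sigma>
          by (auto simp: mult_less_0_iff)
      qed
    qed (use s t' left in auto)
    then show False using z by simp
  next
    case False
    then have "0 < \<sigma> * u \<tau> (q (Suc j))"
      using ends \<sigma> by (auto simp: mult_less_0_iff)
    then have right: "0 < \<sigma> * u t (q (Suc j))" if "s \<le> t" "t \<le> \<tau>" for t
      using s(3)[OF that, of "q (Suc j)"] j by (auto simp: zero_less_mult_iff)
    have left: "\<sigma> * u t (q j) < 0" if "s \<le> t" "t \<le> \<tau>" for t
      using alt[OF that] right[OF that] j \<sigma>
      by (auto simp: zero_less_mult_iff mult_less_0_iff alternates_def)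
    have "0 < \<sigma> * u \<tau> z"
    proof (rule positive_from_right[OF _ s(2) z(3,4) \<sigma>])
      fix t x assume t: "s \<le> t" "t \<le> \<tau>" and x: "r \<le> x" "x \<le> q (Suc j)"
      show "0 \<le> \<sigma> * u t x"
      proof (rule ccontr)
        assume neg: "\<not> ?thesis"
        then have "x \<noteq> q (Suc j)" "x \<noteq> r" using right[OF t] rpos[OF t] by auto
        then show False using no[OF t, of r x] x z neg left[OF t] rpos[OF t] \<sigma>
          by (auto simp: mult_less_0_iff)
      qed
    qed (use s t' right in auto)
    then show False using z by simp
  qed
qed

text \<open>Two zeros in a gap bound an interval of zeros. Bumps on its left and on its right half show
  that its midpoint was a zero already shortly before, so \<open>u\<close> has one sign between the end of the
  gap and this midpoint, and the strong maximum principle applies.\<close>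

lemma gap_zero_unique:
  assumes \<tau>: "t' < \<tau>" "\<tau> < t2" and q: "alternates L (u \<tau>) n q" and j: "j < n"
    and z: "q j < y" "y < z" "z < q (Suc j)" "u \<tau> y = 0" "u \<tau> z = 0"
  shows False
proof -
  have \<tau>0: "0 < \<tau>" using \<tau> t' by simp
  have flat: "u \<tau> x = 0" if "y \<le> x" "x \<le> z" for x
    using gap_zeros_convex[OF \<tau> q j z(1) _ _ z(3) z(4,5), of x] that z by (cases "x = y \<or> x = z") auto
  have "q (Suc j) - q j \<le> L"
  proof -
    have "q 0 \<le> q j" "q (Suc j) \<le> q n"
      using q j by (intro increasing_le[of n q]; simp add: alternates_def)+
    then show ?thesis using q by (simp add: alternates_def)
  qed
  then have yzL: "z - y < L" using z by linarith
  define \<mu> where "\<mu> = (y + z) / 2"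
  \<comment> \<open>\<open>n + 2\<close> centres with spacing \<open>h\<close> fit into half of the
    interval with a margin \<open>h\<close> at both ends, as \<open>(n + 3) * h\<close> is its
    half-length; the radius \<open>h / 4\<close> keeps the bumps disjoint.\<close>
  define h where "h = (z - y) / (2 * (of_nat n + 3))"
  define r where "r = h / 4"
  have h: "h > 0" using z by (simp add: h_def)
  have hn: "(of_nat n + 3) * h = (z - y) / 2"
    unfolding h_def by (simp add: divide_simps)
  have r: "0 < r" "r < L / 2"
  proof -
    show "0 < r" using h by (simp add: r_def)
    have "h \<le> (of_nat n + 3) * h" using h by simp
    then have "h \<le> (z - y) / 2" by (simp only: hn)
    then show "r < L / 2" using yzL h by (simp add: r_def)
  qed
  have "even (n + 2)" using n by simp
  from bump_alternation[OF \<tau>0 r this] obtain T0 where "T0 > 0" and T0: "\<And>t c. \<tau> - T0 \<le> t \<Longrightarrow> 0 \<le> t \<Longrightarrow> t \<le> \<tau> \<Longrightarrow>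
    (\<And>i. i < n + 2 \<Longrightarrow> c i + 2 * r < c (Suc i)) \<Longrightarrow> c (n + 2) = c 0 + L \<Longrightarrow>
    (\<And>i. i < n + 2 \<Longrightarrow> u \<tau> (c i) = 0) \<Longrightarrow>
    (\<And>i x. i < n + 2 \<Longrightarrow> \<bar>x - c i\<bar> \<le> r \<Longrightarrow> u t x \<noteq> 0) \<Longrightarrow> \<exists>y. alternates L (u t) (n + 2) y"
    by metis
  have "finite (q ` {..n})" by simp
  from persistent_signs[OF this t'(1) \<tau>(1)] obtain s where s: "t' \<le> s" "s < \<tau>"
    "\<And>t x. s \<le> t \<Longrightarrow> t \<le> \<tau> \<Longrightarrow> x \<in> q ` {..n} \<Longrightarrow> 0 < u \<tau> x * u t x"
    using alternates_nonzero[OF q _ less_imp_le[OF \<tau>0]] by blast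
  define s' where "s' = max ((s + \<tau>) / 2) (\<tau> - T0)"
  have s': "s < s'" "s' < \<tau>" "\<tau> - T0 \<le> s'" using s(2) \<open>T0 > 0\<close> by (auto simp: s'_def less_max_iff_disj)
  have alt: "alternates L (u t) n q" if "s' \<le> t" "t \<le> \<tau>" for t
    by (rule alternates_persist[OF q]) (use s(3)[of t] s' that in auto)
  have convex: "u t x = 0" if "s' \<le> t" "t \<le> \<tau>" "q j < a" "a < x" "x < b" "b < q (Suc j)"
    "u t a = 0" "u t b = 0" for t a x b
    by (rule gap_zeros_convex[OF _ _ alt j that(3-8)]) (use that s s' \<tau> in auto)
  \<comment> \<open>Otherwise bumps at \<open>n + 2\<close> centres in this half, all of them zeros
    at time \<open>\<tau>\<close>, would reveal \<open>n + 2\<close> sign changes at time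
    \<open>t\<close>.\<close>
  have half: "\<exists>x. a < x \<and> x < a + (z - y) / 2 \<and> u t x = 0"
    if t: "s' \<le> t" "t \<le> \<tau>" and a: "y \<le> a" "a + (z - y) / 2 \<le> z" for t a
  proof (rule ccontr)
    assume no: "\<not> ?thesis"
    define c where "c = (\<lambda>i. if i < n + 2 then a + (of_nat i + 1) * h else a + h + L)"
    have ih: "(of_nat i + 2) * h \<le> (z - y) / 2" if "i < n + 2" for i
    proof -
      have "(of_nat i + 2 :: real) \<le> of_nat n + 3" using that by simp
      then have "(of_nat i + 2) * h \<le> (of_nat n + 3) * h" using h by (intro mult_right_mono) auto
      then show ?thesis using hn by simp
    qed
    have inside: "a < x \<and> x < a + (z - y) / 2" if "i < n + 2" "\<bar>x - c i\<bar> \<le> r" for i x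
    proof -
      have ci: "c i = a + (of_nat i + 2) * h - h" using that by (simp add: c_def algebra_simps)
      have "0 \<le> of_nat i * h" using h by simp
      then have "a + h \<le> c i" by (simp add: ci algebra_simps)
      moreover have "c i \<le> a + (z - y) / 2 - h" using ih[OF that(1)] ci by linarith
      ultimately show ?thesis using that(2) h unfolding r_def abs_le_iff by linarith
    qed
    have "\<exists>y. alternates L (u t) (n + 2) y"
    proof (rule T0[of t c])
      show "c i + 2 * r < c (Suc i)" if "i < n + 2" for i
      proof (cases "Suc i < n + 2")
        case True
        then show ?thesis using h by (simp add: c_def r_def algebra_simps)
      next
        case False
        have "c i < a + (z - y) / 2" using inside[OF that, of "c i"] r by simp
        moreover have "2 * r < h" using h by (simp add: r_def)
        moreover have "c (Suc i) = a + h + L" using False by (simp add: c_def)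
        moreover have "(z - y) / 2 < L" using yzL z(2) by argo
        ultimately show ?thesis by linarith
      qed
      show "u \<tau> (c i) = 0" if "i < n + 2" for i
        using inside[OF that, of "c i"] r a by (intro flat) auto
      show "u t x \<noteq> 0" if "i < n + 2" "\<bar>x - c i\<bar> \<le> r" for i x
        using inside[OF that] no by blast
    qed (use t s' s t' in \<open>auto simp: c_def\<close>)
    then show False using maximal[of t "n + 2"] t s s' \<tau> by auto
  qed
  \<comment> \<open>A zero in each half encloses the midpoint, and the zeros in the gap are convex
    at time \<open>t\<close> too.\<close>
  have mid: "u t \<mu> = 0" if t: "s' \<le> t" "t \<le> \<tau>" for t
  proof -
    obtain a where a: "y < a" "a < \<mu>" "u t a = 0"
      using half[OF t, of y] z by (auto simp: \<mu>_def field_simps)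
    obtain b where b: "\<mu> < b" "b < z" "u t b = 0"
      using half[OF t, of \<mu>] z by (auto simp: \<mu>_def field_simps)
    show ?thesis using convex[OF t, of a \<mu> b] a b z by auto
  qed
  define \<sigma> where "\<sigma> = sgn (u \<tau> (q j))"
  have "u \<tau> (q j) \<noteq> 0" using alternates_nonzero[OF q] j \<tau>0 by simp
  then have \<sigma>: "\<sigma> \<in> {1, - 1}" by (auto simp: \<sigma>_def sgn_if)
  have left: "0 < \<sigma> * u t (q j)" if "s' \<le> t" "t \<le> \<tau>" for t
    using s(3)[of t "q j"] that s' j by (auto simp: \<sigma>_def sgn_if zero_less_mult_iff)
  have \<mu>: "y < \<mu>" "\<mu> < z" using z by (auto simp: \<mu>_def)
  have "0 < \<sigma> * u \<tau> y"
  proof (rule positive_from_left[OF _ s'(2) z(1) \<mu>(1) \<sigma>])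
    fix t x assume t: "s' \<le> t" "t \<le> \<tau>" and x: "q j \<le> x" "x \<le> \<mu>"
    show "0 \<le> \<sigma> * u t x"
    proof (rule ccontr)
      assume neg: "\<not> ?thesis"
      then have x': "q j < x" "x < \<mu>" using left[OF t] mid[OF t] x by (auto simp: order.order_iff_strict)
      \<comment> \<open>A value of the wrong sign at \<open>x\<close> forces a zero between
        \<open>q j\<close> and \<open>x\<close>; then \<open>x\<close> lies between that zero and
        \<open>\<mu>\<close> and is itself a zero.\<close>
      have "u t (q j) * u t x < 0" using neg left[OF t] \<sigma> by (auto simp: mult_less_0_iff)
      moreover have "continuous_on {q j..x} (u t)" using t s s' t' by (intro cont_slice) auto
      ultimately obtain a where "q j < a" "a < x" "u t a = 0" using IVT_sign x'(1) by blast
      then have "u t x = 0" using convex[OF t, of a x \<mu>] x' \<mu> z mid[OF t] by auto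
      then show False using neg by simp
    qed
  qed (use s s' t' left in auto)
  then show False using z by simp
qed

text \<open>Without alternations \<open>u\<close> has a single sign at each time, namely that at a
  point \<open>q\<close> where it is nonzero; this sign is the same shortly before
  \<open>\<tau>\<close>. The strong maximum principle on the period starting at \<open>q\<close>
  excludes zeros.\<close>

lemma no_zeros_if_no_alternation:
  assumes n0: "n = 0" and \<tau>: "t' < \<tau>" "\<tau> < t2"
  shows "u \<tau> z \<noteq> 0"
proof
  assume z: "u \<tau> z = 0"
  have \<tau>0: "0 < \<tau>" using \<tau> t' by simp
  obtain q where q: "u \<tau> q \<noteq> 0" using nontrivial[OF \<tau>0] by blast
  have "finite {q}" by simp
  from persistent_signs[OF this t'(1) \<tau>(1)] obtain s where s: "t' \<le> s" "s < \<tau>"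
    "\<And>t. s \<le> t \<Longrightarrow> t \<le> \<tau> \<Longrightarrow> 0 < u \<tau> q * u t q"
    using q by blast
  define \<sigma> where "\<sigma> = sgn (u \<tau> q)"
  have \<sigma>: "\<sigma> \<in> {1, - 1}" using q by (auto simp: \<sigma>_def sgn_if)
  have qpos: "0 < \<sigma> * u t q" if "s \<le> t" "t \<le> \<tau>" for t
    using s(3)[OF that] by (auto simp: \<sigma>_def sgn_if zero_less_mult_iff)
  define shift where "shift = (\<lambda>x. q + (x - q) rmod L)"
  have shift: "u t (shift x) = u t x" if "0 \<le> t" for t x
  proof -
    have "u t (q + (x - q) rmod L) = u t (q + (x - q))"
      by (rule periodic_rmod[of L "\<lambda>x. u t (q + x)"]) (use L per[OF that] in \<open>auto simp flip: add.assoc\<close>)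
    then show ?thesis by (simp add: shift_def)
  qed
  have shift_bounds: "q \<le> shift x" "shift x < q + L" for x
    using L by (auto simp: shift_def rmod_less rmod_nonneg)
  have nonneg: "0 \<le> \<sigma> * u t x" if t: "s \<le> t" "t \<le> \<tau>" for t x
  proof (rule ccontr)
    assume neg: "\<not> ?thesis"
    have t0: "0 \<le> t" using t s t' by simp
    \<comment> \<open>A value of the other sign would give the alternation \<open>q\<close>,
      \<open>shift x\<close>, \<open>q + L\<close>.\<close>
    define c where "c = (\<lambda>i :: nat. if i = 0 then q else if i = 1 then shift x else q + L)"
    have "u t q * u t (shift x) < 0"
      using neg qpos[OF t] \<sigma> shift[OF t0, of x] by (auto simp: mult_less_0_iff)
    then have "q \<noteq> shift x" "u t (shift x) * u t (q + L) < 0"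
      using per[OF t0, of q] by (auto simp: mult_less_0_iff)
    then have "alternates L (u t) 2 c"
      using shift_bounds[of x] \<open>u t q * u t (shift x) < 0\<close>
      by (auto simp: alternates_def c_def less_2_cases_iff)
    then show False using maximal[of t 2] t s \<tau> n0 by auto
  qed
  have "shift z \<noteq> q" using shift[of \<tau> z] z q \<tau>0 by auto
  then have "0 < \<sigma> * u \<tau> (shift z)"
    by (intro positive_from_left[OF _ s(2), of q "shift z" "q + L" \<sigma>])
      (use s t' shift_bounds[of z] \<sigma> nonneg qpos in auto)
  then show False using z shift[of \<tau> z] \<tau>0 by simp
qed

lemma card_zeros_before:
  assumes \<tau>: "t' < \<tau>" "\<tau> < t2"
  shows "finite {z \<in> {0..<L}. u \<tau> z = 0} \<and> card {z \<in> {0..<L}. u \<tau> z = 0} \<le> n"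
proof (cases "n = 0")
  case True
  then show ?thesis using no_zeros_if_no_alternation[OF _ \<tau>] by simp
next
  case False
  have \<tau>0: "0 \<le> \<tau>" using \<tau> t' by simp
  obtain q where q: "alternates L (u \<tau>) n q" using attained[of \<tau>] False \<tau> by auto
  show ?thesis
  proof (rule card_gap_zeros_le[where f = "u \<tau>" and q = q, OF L])
    show "u \<tau> (x + L) = u \<tau> x" for x by (rule per[OF \<tau>0])
    show "q n = q 0 + L" using q by (simp add: alternates_def)
    show "u \<tau> (q i) \<noteq> 0" if "i < n" for i using alternates_nonzero[OF q _ \<tau>0] that by simp
  qed (rule gap_zero_unique[OF \<tau> q])
qed

text \<open>The interval is filled with \<open>K = 2 * n + 2\<close> disjoint candidate
  neighbourhoods. Shortly before \<open>t2\<close> there are at most \<open>n\<close> zeros per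
  period, so at least \<open>n + 2\<close> candidates avoid them, and bumps there yield
  \<open>n + 2\<close> sign changes. The centres depend on the time chosen, which is harmless
  because \<open>T0\<close> does not depend on the centres.\<close>

lemma no_interval_of_zeros:
  assumes "y < z" and zero: "\<And>x. y \<le> x \<Longrightarrow> x \<le> z \<Longrightarrow> u t2 x = 0"
  shows False
proof -
  \<comment> \<open>At most half a period is used, so that the candidates are distinct modulo
    \<open>L\<close>.\<close>
  define l where "l = min (z - y) (L / 2)"
  have l: "0 < l" "l < L" "y + l \<le> z" using assms(1) L by (auto simp: l_def)
  define K where "K = 2 * n + 2"
  define h where "h = l / (of_nat K + 1)"
  define r where "r = h / 4"
  define c where "c = (\<lambda>i. y + (of_nat i + 1) * h)"
  have h: "h > 0" using l by (simp add: h_def add_nonneg_pos)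
  have hK: "(of_nat K + 1) * h = l" by (simp add: h_def add_nonneg_pos)
  have r: "0 < r" "2 * r < h" using h by (auto simp: r_def)
  have inside: "y < x \<and> x < y + l" if "i < K" "\<bar>x - c i\<bar> \<le> r" for i x
  proof -
    have "(of_nat i + 2) * h \<le> (of_nat K + 1) * h" using that(1) h by (intro mult_right_mono) auto
    moreover have "c i = y + (of_nat i + 2) * h - h" by (simp add: c_def algebra_simps)
    moreover have "0 \<le> of_nat i * h" using h by simp
    then have "y + h \<le> c i" by (simp add: c_def algebra_simps)
    ultimately show ?thesis using that(2) r h hK unfolding abs_le_iff by linarith
  qed
  have sep: "c i + h \<le> c j" if "i < j" for i j
  proof -
    have "(of_nat i + 2) * h \<le> (of_nat j + 1) * h" using that h by (intro mult_right_mono) auto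
    then show ?thesis by (simp add: c_def algebra_simps)
  qed
  have "even (n + 2)" using n by simp
  moreover have "r < L / 2"
  proof -
    have "h \<le> (of_nat K + 1) * h" using h by simp
    then show ?thesis using hK l h by (simp add: r_def)
  qed
  moreover have t2: "0 < t2" using t' by simp
  ultimately obtain T0 where "T0 > 0" and T0: "\<And>t c. t2 - T0 \<le> t \<Longrightarrow> 0 \<le> t \<Longrightarrow> t \<le> t2 \<Longrightarrow>
    (\<And>i. i < n + 2 \<Longrightarrow> c i + 2 * r < c (Suc i)) \<Longrightarrow> c (n + 2) = c 0 + L \<Longrightarrow>
    (\<And>i. i < n + 2 \<Longrightarrow> u t2 (c i) = 0) \<Longrightarrow>
    (\<And>i x. i < n + 2 \<Longrightarrow> \<bar>x - c i\<bar> \<le> r \<Longrightarrow> u t x \<noteq> 0) \<Longrightarrow> \<exists>y. alternates L (u t) (n + 2) y"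
    using bump_alternation[of t2 r "n + 2"] r(1) by metis
  define t where "t = max ((t' + t2) / 2) (t2 - T0)"
  have t: "t' < t" "t < t2" "t2 - T0 \<le> t" using t' \<open>T0 > 0\<close> by (auto simp: t_def less_max_iff_disj)
  have t0: "0 \<le> t" using t t' by simp
  define Z where "Z = {z \<in> {0..<L}. u t z = 0}"
  have Z: "finite Z" "card Z \<le> n" using card_zeros_before[OF t(1,2)] by (auto simp: Z_def)
  define bad where "bad = {i. i < K \<and> (\<exists>x. \<bar>x - c i\<bar> \<le> r \<and> u t x = 0)}"
  define good where "good = {..<K} - bad"
  have "\<forall>i\<in>bad. \<exists>x. \<bar>x - c i\<bar> \<le> r \<and> u t x = 0" by (auto simp: bad_def)
  then obtain \<zeta> where \<zeta>: "\<And>i. i \<in> bad \<Longrightarrow> \<bar>\<zeta> i - c i\<bar> \<le> r \<and> u t (\<zeta> i) = 0" by metis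
  have "inj_on (\<lambda>i. \<zeta> i rmod L) bad"
  proof (rule linorder_inj_onI)
    fix i j assume ij: "i < j" "i \<in> bad" "j \<in> bad"
    have "\<zeta> i < \<zeta> j" using sep[OF ij(1)] \<zeta>[OF ij(2)] \<zeta>[OF ij(3)] r unfolding abs_le_iff by linarith
    moreover have "\<bar>\<zeta> i - \<zeta> j\<bar> < L"
      using inside[of i "\<zeta> i"] inside[of j "\<zeta> j"] ij \<zeta>[OF ij(2)] \<zeta>[OF ij(3)] l by (auto simp: bad_def)
    ultimately show "\<zeta> i rmod L \<noteq> \<zeta> j rmod L" using rmod_eq_imp_eq[of "\<zeta> i" L "\<zeta> j"] by auto
  qed auto
  moreover have "(\<lambda>i. \<zeta> i rmod L) ` bad \<subseteq> Z"
    using \<zeta> L periodic_rmod[of L "u t", OF L per[OF t0]] by (auto simp: Z_def rmod_less rmod_nonneg)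
  ultimately have "card bad \<le> card Z" using card_inj_on_le Z(1) by blast
  moreover have "card good = K - card bad"
    unfolding good_def by (subst card_Diff_subset) (auto simp: bad_def)
  ultimately have card_good: "n + 2 \<le> card good" using Z(2) by (simp add: K_def)
  obtain e where e: "bij_betw e {..<card good} good" "strict_mono_on {..<card good} e"
    using ex_bij_betw_strict_mono_card[of good] by (auto simp: good_def)
  have e_good: "e i \<in> good" if "i < n + 2" for i
    using e(1) that card_good by (auto simp: bij_betw_def)
  have e_K: "e i < K" if "i < n + 2" for i using e_good[OF that] by (simp add: good_def)
  define d where "d = (\<lambda>i. if i < n + 2 then c (e i) else c (e 0) + L)"
  have "\<exists>y. alternates L (u t) (n + 2) y"
  proof (rule T0[of t d])
    show "d i + 2 * r < d (Suc i)" if "i < n + 2" for i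
    proof (cases "Suc i < n + 2")
      case True
      then have "e i < e (Suc i)" using e(2) card_good by (auto simp: strict_mono_on_def)
      then show ?thesis using sep[of "e i" "e (Suc i)"] True r by (simp add: d_def)
    next
      case False
      have "c (e i) < y + l" using inside[OF e_K[OF that], of "c (e i)"] r by simp
      moreover have "y + h \<le> c (e 0)" using h by (simp add: c_def algebra_simps)
      moreover have "d (Suc i) = c (e 0) + L" "d i = c (e i)" using False that by (auto simp: d_def)
      ultimately show ?thesis using r l by linarith
    qed
    show "d (n + 2) = d 0 + L" by (simp add: d_def)
    show "u t2 (d i) = 0" if "i < n + 2" for i
      using inside[OF e_K[OF that], of "d i"] that r l zero[of "d i"] by (auto simp: d_def)
    show "u t x \<noteq> 0" if "i < n + 2" "\<bar>x - d i\<bar> \<le> r" for i x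
      using e_good[OF that(1)] that by (auto simp: good_def bad_def d_def)
  qed (use t t0 in auto)
  then show False using maximal[of t "n + 2"] t by auto
qed

text \<open>The nonzero points chosen between the zeros are the lateral sides of boxes over
  \<open>{\<tau>..t2}\<close>, short enough in time for the signs on the sides to persist. A box
  without a zero at its bottom has one sign on the bottom and the sides, hence inside, and the
  strong maximum principle removes the zero at its top.\<close>

lemma card_zeros_at_end: "finite {z \<in> {0..<L}. u t2 z = 0} \<and> card {z \<in> {0..<L}. u t2 z = 0} \<le> n"
proof (rule ccontr)
  define Z where "Z = {z \<in> {0..<L}. u t2 z = 0}"
  assume "\<not> ?thesis"
  then have "\<exists>P\<subseteq>Z. finite P \<and> card P = n + 1"
    unfolding Z_def[symmetric]
    by (metis infinite_arbitrarily_large not_less_eq_eq obtain_subset_with_card_n Suc_eq_plus1)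
  then obtain P where P: "P \<subseteq> Z" "finite P" "card P = n + 1" by blast
  obtain e where e: "bij_betw e {..<n + 1} P" "strict_mono_on {..<n + 1} e"
  proof -
    have "sorted_wrt (<) (sorted_list_of_set P)" by simp
    then have "strict_mono_on {..<n + 1} (\<lambda>i. sorted_list_of_set P ! i)"
      using P by (auto simp: strict_mono_on_def sorted_wrt_iff_nth_less)
    moreover have "bij_betw (\<lambda>i. sorted_list_of_set P ! i) {..<n + 1} P"
      using P bij_betw_nth[of "sorted_list_of_set P" "{..<n + 1}" P] by simp
    ultimately show ?thesis using that by blast
  qed
  define p where "p = (\<lambda>i. if i \<le> n then e i else e 0 + L)"
  have t2: "0 \<le> t2" using t' by simp
  have eZ: "e i \<in> Z" if "i \<le> n" for i
  proof -
    have "e i \<in> P" using e(1) that by (auto simp: bij_betw_def)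
    then show ?thesis using P by auto
  qed
  have p_less: "p i < p (Suc i)" if "i \<le> n" for i
  proof (cases "i = n")
    case True
    then show ?thesis using eZ[of n] eZ[of 0] by (auto simp: p_def Z_def)
  next
    case False
    then have "e i < e (Suc i)" using e(2) that by (auto simp: strict_mono_on_def)
    then show ?thesis using False that by (simp add: p_def)
  qed
  have p_zero: "u t2 (p i) = 0" for i
    using eZ[of i] eZ[of 0] per[OF t2, of "e 0"] by (auto simp: p_def Z_def)
  have "\<exists>x. p i < x \<and> x < p (Suc i) \<and> u t2 x \<noteq> 0" if "i \<le> n" for i
    using no_interval_of_zeros[OF p_less[OF that]] p_zero
    by (metis order.order_iff_strict)
  then obtain \<rho> where \<rho>: "\<And>i. i \<le> n \<Longrightarrow> p i < \<rho> i \<and> \<rho> i < p (Suc i) \<and> u t2 (\<rho> i) \<noteq> 0" by metis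
  \<comment> \<open>The gap from \<open>x i\<close> to \<open>x (Suc i)\<close> contains the zero
    \<open>p (Suc i)\<close>; the last gap wraps around the period.\<close>
  define x where "x = (\<lambda>i. if i \<le> n then \<rho> i else \<rho> 0 + L)"
  have p0: "p (Suc n) = p 0 + L" by (simp add: p_def)
  have px: "x i < p (Suc i)" "p (Suc i) < x (Suc i)" if "i \<le> n" for i
    using \<rho>[OF that] \<rho>[of "Suc i"] \<rho>[of 0] that p0 by (cases "i = n"; simp add: x_def)+
  have x_nz: "u t2 (x i) \<noteq> 0" for i using \<rho>[of i] \<rho>[of 0] per[OF t2, of "\<rho> 0"] by (auto simp: x_def)
  have "finite (x ` {..Suc n})" by simp
  from persistent_signs[OF this t'] obtain s where s: "t' \<le> s" "s < t2"
    "\<And>t y. s \<le> t \<Longrightarrow> t \<le> t2 \<Longrightarrow> y \<in> x ` {..Suc n} \<Longrightarrow> 0 < u t2 y * u t y"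
    using x_nz by blast
  define \<tau> where "\<tau> = (s + t2) / 2"
  have \<tau>: "s < \<tau>" "\<tau> < t2" "t' < \<tau>" "0 \<le> \<tau>" using s t' by (auto simp: \<tau>_def)
  have "n + 1 \<le> card {z \<in> {0..<L}. u \<tau> z = 0}"
  proof (rule card_cyclic_zeros_ge[where f = "u \<tau>" and x = x, OF L])
    show "u \<tau> (x + L) = u \<tau> x" for x by (rule per[OF \<tau>(4)])
    show "x i < x (Suc i)" if "i < n + 1" for i using px[of i] that by simp
    show "x (n + 1) = x 0 + L" by (simp add: x_def)
    show "\<exists>z. x i < z \<and> z < x (Suc i) \<and> u \<tau> z = 0" if i: "i < n + 1" for i
    proof (rule ccontr)
      assume no: "\<not> ?thesis"
      define \<sigma> where "\<sigma> = sgn (u t2 (x i))"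
      have \<sigma>: "\<sigma> \<in> {1, - 1}" using x_nz[of i] by (auto simp: \<sigma>_def sgn_if)
      have cont: "continuous_on {a..b} (u \<tau>)" for a b using \<tau> by (intro cont_slice)
      have left: "0 < \<sigma> * u t (x i)" if "\<tau> \<le> t" "t \<le> t2" for t
        using s(3)[of t "x i"] that \<tau> i by (auto simp: \<sigma>_def sgn_if zero_less_mult_iff)
      have pos: "0 < \<sigma> * u \<tau> z" if z: "x i \<le> z" "z < x (Suc i)" for z
      proof (rule ccontr)
        assume neg: "\<not> ?thesis"
        then have "x i \<noteq> z" using left[of \<tau>] \<tau> by auto
        then have "x i < z" using z by simp
        moreover have "u \<tau> z \<noteq> 0" using no \<open>x i < z\<close> z by blast
        then have "u \<tau> (x i) * u \<tau> z < 0"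
          using neg left[of \<tau>] \<tau> \<sigma> by (auto simp: mult_less_0_iff)
        ultimately obtain w where "x i < w" "w < z" "u \<tau> w = 0" using IVT_sign[OF cont] by blast
        then show False using no z by auto
      qed
      have right\<tau>: "0 < \<sigma> * u \<tau> (x (Suc i))"
      proof (rule ccontr)
        assume neg: "\<not> ?thesis"
        have "u \<tau> (x (Suc i)) \<noteq> 0" using s(3)[of \<tau> "x (Suc i)"] \<tau> i by auto
        then have "u \<tau> (x i) * u \<tau> (x (Suc i)) < 0"
          using neg left[of \<tau>] \<tau> \<sigma> by (auto simp: mult_less_0_iff)
        moreover have "x i < x (Suc i)" using px[of i] i by simp
        ultimately obtain w where "x i < w" "w < x (Suc i)" "u \<tau> w = 0" using IVT_sign[OF cont] by blast
        then show False using no by auto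
      qed
      have right: "0 < \<sigma> * u t (x (Suc i))" if "\<tau> \<le> t" "t \<le> t2" for t
        using s(3)[of t "x (Suc i)"] s(3)[of \<tau> "x (Suc i)"] right\<tau> that \<tau> i
        by (auto simp: zero_less_mult_iff)
      have nonneg: "0 \<le> \<sigma> * u t y" if "\<tau> \<le> t" "t \<le> t2" "x i \<le> y" "y \<le> x (Suc i)" for t y
      proof (rule nonneg_in_box_sign[OF \<sigma> \<tau>(4) _ _ _ that])
        show "0 \<le> \<sigma> * u \<tau> y" if "x i \<le> y" "y \<le> x (Suc i)" for y
          using pos[OF that(1)] right\<tau> that(2) by (cases "y = x (Suc i)") auto
      qed (use left right in \<open>auto intro: less_imp_le\<close>)
      have "0 < \<sigma> * u t2 (p (Suc i))"
        by (rule positive_from_left[OF \<tau>(4,2) _ _ \<sigma>, of "x i" _ "x (Suc i)"])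
          (use px[of i] i nonneg left in auto)
      then show False using p_zero by simp
    qed
    show "finite {z \<in> {0..<L}. u \<tau> z = 0}" using card_zeros_before[OF \<tau>(3,2)] by blast
  qed
  then show False using card_zeros_before[OF \<tau>(3,2)] by simp
qed

end

section \<open>Monotonicity of the number of zeros of a periodic solution\<close>

context parabolic
begin

text \<open>By the intermediate value theorem the finite number of zeros at \<open>t1\<close> bounds
  the number of sign changes there. The least bound \<open>n\<close> valid at some time before
  \<open>t2\<close> is valid from then on by backward persistence, and minimality makes it attained
  at all times before \<open>t2\<close>; this is the situation of
  \<open>constant_alternation\<close>.\<close>

theorem card_zeros_nonincreasing:
  assumes nontrivial: "\<And>t. 0 < t \<Longrightarrow> \<exists>x. u t x \<noteq> 0" and t: "0 \<le> t1" "t1 < t2"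
    and fin: "finite {z \<in> {0..<L}. u t1 z = 0}"
  shows "finite {z \<in> {0..<L}. u t2 z = 0} \<and>
    card {z \<in> {0..<L}. u t2 z = 0} \<le> card {z \<in> {0..<L}. u t1 z = 0}"
proof -
  define P where "P = (\<lambda>n. \<exists>t. t1 \<le> t \<and> t < t2 \<and> (\<forall>m x. n < m \<longrightarrow> \<not> alternates L (u t) m x))"
  define N where "N = card {z \<in> {0..<L}. u t1 z = 0}"
  have "P N"
    unfolding P_def N_def
    using alternates_le_card[OF _ L per[OF t(1)] cont_slice[OF t(1)] fin] t by fastforce
  define n where "n = (LEAST n. P n)"
  have "P n" unfolding n_def by (rule LeastI[of P N, OF \<open>P N\<close>])
  then obtain t' where t': "t1 \<le> t'" "t' < t2" "\<And>m x. n < m \<Longrightarrow> \<not> alternates L (u t') m x"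
    by (auto simp: P_def)
  have max: "\<not> alternates L (u \<tau>) m x" if "t' \<le> \<tau>" "n < m" for \<tau> m x
    using alternates_backward[of t' \<tau> m x] t' t that by (metis order_trans)
  have att: "n = 0 \<or> (\<exists>x. alternates L (u \<tau>) n x)" if \<tau>: "t' \<le> \<tau>" "\<tau> < t2" for \<tau>
  proof (rule ccontr)
    assume no: "\<not> ?thesis"
    have "\<not> alternates L (u \<tau>) m x" if "n - 1 < m" for m x
      using no max[OF \<tau>(1), of m x] that by (cases "m = n") auto
    then have "P (n - 1)" unfolding P_def using \<tau> t'(1) by (intro exI[of _ \<tau>]) auto
    then have "n \<le> n - 1" unfolding n_def by (rule Least_le[of P])
    then show False using no by auto
  qed
  have even: "even n"
    using att[of t'] t' t alternates_even[of L "u t'" n, OF _ L per] by auto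
  interpret constant_alternation L u ux uxx n t' t2
    by unfold_locales (use nontrivial t t' max att even in auto)
  have "n \<le> N" unfolding n_def by (rule Least_le[of P N, OF \<open>P N\<close>])
  then show ?thesis using card_zeros_at_end by (simp add: N_def)
qed

end


subsection \<open>One-sided derivatives and periodic extensions\<close>

lemma deriv_within_eqI:
  assumes L: "L > 0" and s: "s \<in> {0..L}" and g: "(g has_real_derivative D) (at s within {0..L})"
    and eq: "\<And>r. r \<in> {0..L} \<Longrightarrow> f r = g r"
  shows "deriv_within {0..L} f s = D"
proof -
  have "(f has_real_derivative D) (at s within {0..L})"
    by (rule has_field_derivative_transform_within[OF g zero_less_one s]) (simp add: eq)
  then show ?thesis
    unfolding deriv_within_def
    by (intro vector_derivative_within_closed_interval L s)
      (simp add: has_real_derivative_iff_has_vector_derivative)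
qed

lemma deriv_within_works:
  assumes "f differentiable_on S" "s \<in> S"
  shows "(f has_real_derivative deriv_within S f s) (at s within S)"
  using assms vector_derivative_works[of f "at s within S"]
  by (simp add: differentiable_on_def deriv_within_def has_real_derivative_iff_has_vector_derivative)

lemma deriv_within_cong:
  assumes "L > 0" "s \<in> {0..L}" "g differentiable_on {0..L}" "\<And>r. r \<in> {0..L} \<Longrightarrow> f r = g r"
  shows "deriv_within {0..L} f s = deriv_within {0..L} g s"
  using assms by (intro deriv_within_eqI[OF _ _ deriv_within_works]) auto

lemma Ck_on_diff_on: "Ck_on k S f \<Longrightarrow> j < k \<Longrightarrow> (deriv_within S ^^ j) f differentiable_on S"
  by (simp add: Ck_on_def)

lemma Ck_on_continuous: "Ck_on k S f \<Longrightarrow> j \<le> k \<Longrightarrow> continuous_on S ((deriv_within S ^^ j) f)"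
  by (cases "j = k") (auto simp: Ck_on_def intro: differentiable_imp_continuous_on)

lemma deriv_within_funpow_diff:
  assumes L: "L > 0" and f: "Ck_on k {0..L} f" and g: "Ck_on k {0..L} g"
    and j: "j \<le> k" and s: "s \<in> {0..L}"
  shows "(deriv_within {0..L} ^^ j) (\<lambda>r. f r - g r) s =
    (deriv_within {0..L} ^^ j) f s - (deriv_within {0..L} ^^ j) g s"
  using j s
proof (induction j arbitrary: s)
  case (Suc j)
  have "deriv_within {0..L} ((deriv_within {0..L} ^^ j) (\<lambda>r. f r - g r)) s =
     deriv_within {0..L} ((deriv_within {0..L} ^^ j) f) s - deriv_within {0..L} ((deriv_within {0..L} ^^ j) g) s"
  proof (rule deriv_within_eqI[OF L Suc.prems(2)])
    show "((\<lambda>r. (deriv_within {0..L} ^^ j) f r - (deriv_within {0..L} ^^ j) g r) has_real_derivative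
      deriv_within {0..L} ((deriv_within {0..L} ^^ j) f) s - deriv_within {0..L} ((deriv_within {0..L} ^^ j) g) s)
      (at s within {0..L})"
      using Suc.prems by (intro DERIV_diff deriv_within_works Ck_on_diff_on[OF f] Ck_on_diff_on[OF g]) auto
    show "(deriv_within {0..L} ^^ j) (\<lambda>r. f r - g r) r =
      (deriv_within {0..L} ^^ j) f r - (deriv_within {0..L} ^^ j) g r" if "r \<in> {0..L}" for r
      using Suc.IH[OF _ that] Suc.prems by simp
  qed
  then show ?case by simp
qed simp

text \<open>Continuity of the derivatives bounds the set under each \<open>SUP\<close>, without
  which the supremum would carry no information; one summand is at most the norm because all are
  nonnegative.\<close>

lemma deriv_within_le_C2_norm:
  assumes L: "L > 0" and f: "Ck_on 2 {0..L} f" and g: "Ck_on 2 {0..L} g"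
    and j: "j \<le> 2" and s: "s \<in> {0..L}"
  shows "\<bar>(deriv_within {0..L} ^^ j) f s - (deriv_within {0..L} ^^ j) g s\<bar> \<le> C2_norm L (\<lambda>r. f r - g r)"
proof -
  define h where "h = (\<lambda>j s. (deriv_within {0..L} ^^ j) (\<lambda>r. f r - g r) s)"
  have h: "h j s = (deriv_within {0..L} ^^ j) f s - (deriv_within {0..L} ^^ j) g s"
    if "j \<le> 2" "s \<in> {0..L}" for j s
    unfolding h_def by (rule deriv_within_funpow_diff[OF L f g that])
  have bdd: "bdd_above ((\<lambda>s. \<bar>h j s\<bar>) ` {0..L})" if "j \<le> 2" for j
  proof -
    have "continuous_on {0..L} (\<lambda>s. \<bar>(deriv_within {0..L} ^^ j) f s - (deriv_within {0..L} ^^ j) g s\<bar>)"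
      by (intro continuous_intros Ck_on_continuous[OF f that] Ck_on_continuous[OF g that])
    then have "continuous_on {0..L} (\<lambda>s. \<bar>h j s\<bar>)"
      by (rule continuous_on_eq) (simp add: h[OF that])
    then show ?thesis
      by (intro bounded_imp_bdd_above compact_imp_bounded compact_continuous_image) auto
  qed
  have le: "\<bar>h j s\<bar> \<le> (SUP s\<in>{0..L}. \<bar>h j s\<bar>)" if "j \<le> 2" "s \<in> {0..L}" for j s
    by (rule cSUP_upper[OF that(2) bdd[OF that(1)]])
  have nonneg: "0 \<le> (SUP s\<in>{0..L}. \<bar>h j s\<bar>)" if "j \<le> 2" for j
    using le[OF that s] abs_ge_zero[of "h j s"] by linarith
  have "\<bar>h j s\<bar> \<le> (SUP s\<in>{0..L}. \<bar>h j s\<bar>)" by (rule le[OF j s])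
  also have "\<dots> \<le> (\<Sum>j\<le>2. SUP s\<in>{0..L}. \<bar>h j s\<bar>)"
    by (rule member_le_sum) (use j nonneg in auto)
  finally show ?thesis using h[OF j s] by (simp add: C2_norm_def h_def)
qed

text \<open>Continuity into \<open>C\<^sup>2\<close> controls the change in time uniformly in space:
  the increment from \<open>(t, s)\<close> to \<open>(\<tau>, r)\<close> is at most the
  \<open>C2_norm\<close> of \<open>u \<tau> - u t\<close> plus the spatial increment of the fixed
  function at time \<open>t\<close>.\<close>

lemma C0_C2_continuous:
  assumes L: "L > 0" and u: "C0_C2 L u" and j: "j \<le> 2"
  shows "continuous_on ({0..} \<times> {0..L}) (\<lambda>(t, s). (deriv_within {0..L} ^^ j) (u t) s)"
proof -
  define f where "f = (\<lambda>t s. (deriv_within {0..L} ^^ j) (u t) s)"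
  have Ck: "Ck_on 2 {0..L} (u t)" if "0 \<le> t" for t using u that by (simp add: C0_C2_def)
  have "((\<lambda>z. f (fst z) (snd z)) \<longlongrightarrow> f t s) (at (t, s) within {0..} \<times> {0..L})"
    if ts: "0 \<le> t" "s \<in> {0..L}" for t s
  proof -
    let ?F = "at (t, s) within {0..} \<times> {0..L}"
    let ?N = "\<lambda>\<tau>. C2_norm L (\<lambda>r. u \<tau> r - u t r)"
    have inS: "\<forall>\<^sub>F z in ?F. z \<in> {0..} \<times> {0..L}"
      by (simp only: eventually_at_filter) (rule always_eventually, blast)
    have N: "(?N \<longlongrightarrow> 0) (at t within {0..})" using u ts by (simp add: C0_C2_def)
    \<comment> \<open>The limit in \<open>C0_C2\<close> ignores the time \<open>t\<close> itself,
      while points approaching \<open>(t, s)\<close> may have first coordinate \<open>t\<close>; so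
      the norm of the zero function is needed as well.\<close>
    have "(SUP x\<in>{0..L}. \<bar>(deriv_within {0..L} ^^ j) (\<lambda>r. u t r - u t r) x\<bar>) = 0" if "j \<le> 2" for j
    proof -
      have "(SUP x\<in>{0..L}. \<bar>(deriv_within {0..L} ^^ j) (\<lambda>r. u t r - u t r) x\<bar>) = (SUP x\<in>{0..L}. 0)"
      proof (intro SUP_cong refl)
        show "\<bar>(deriv_within {0..L} ^^ j) (\<lambda>r. u t r - u t r) x\<bar> = 0" if "x \<in> {0..L}" for x
          using deriv_within_funpow_diff[OF L Ck[OF ts(1)] Ck[OF ts(1)] \<open>j \<le> 2\<close> that] by simp
      qed
      then show ?thesis using L by simp
    qed
    then have "?N t = 0" unfolding C2_norm_def by (intro sum.neutral) auto
    then have "continuous (at t within {0..}) ?N" using N by (simp add: continuous_within)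
    then have "((\<lambda>z. ?N (fst z)) \<longlongrightarrow> ?N t) ?F"
    proof (rule continuous_within_tendsto_compose)
      show "\<forall>\<^sub>F z in ?F. fst z \<in> {0..}" using inS by (rule eventually_mono) auto
      show "(fst \<longlongrightarrow> t) ?F" by (auto intro!: tendsto_eq_intros)
    qed
    then have 1: "((\<lambda>z. ?N (fst z)) \<longlongrightarrow> 0) ?F" using \<open>?N t = 0\<close> by simp
    have "continuous (at s within {0..L}) (f t)"
      using Ck_on_continuous[OF Ck j] ts by (simp add: f_def continuous_on_eq_continuous_within)
    then have "((\<lambda>z. f t (snd z)) \<longlongrightarrow> f t s) ?F"
    proof (rule continuous_within_tendsto_compose)
      show "\<forall>\<^sub>F z in ?F. snd z \<in> {0..L}" using inS by (rule eventually_mono) auto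
      show "(snd \<longlongrightarrow> s) ?F" by (auto intro!: tendsto_eq_intros)
    qed
    then have 2: "((\<lambda>z. \<bar>f t (snd z) - f t s\<bar>) \<longlongrightarrow> 0) ?F"
      by (simp add: tendsto_rabs_zero_iff LIM_zero_iff)
    have "\<forall>\<^sub>F z in ?F. norm (f (fst z) (snd z) - f t s) \<le> ?N (fst z) + \<bar>f t (snd z) - f t s\<bar>"
    proof -
      have "norm (f (fst z) (snd z) - f t s) \<le> ?N (fst z) + \<bar>f t (snd z) - f t s\<bar>"
        if "z \<in> {0..} \<times> {0..L}" for z
      proof -
        have "\<bar>f (fst z) (snd z) - f t (snd z)\<bar> \<le> ?N (fst z)"
          unfolding f_def using that ts by (intro deriv_within_le_C2_norm[OF L _ _ j] Ck) auto
        then show ?thesis by simp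
      qed
      then show ?thesis by (rule eventually_mono[OF inS])
    qed
    then have "((\<lambda>z. f (fst z) (snd z) - f t s) \<longlongrightarrow> 0) ?F"
      by (rule Lim_null_comparison) (intro tendsto_add_zero 1 2)
    then show ?thesis by (simp add: LIM_zero_iff)
  qed
  then show ?thesis
    by (auto simp: continuous_on_def f_def case_prod_unfold)
qed

section \<open>Periodic extension from one period\<close>

lemma rmod_add_self: "L > 0 \<Longrightarrow> (x + L) rmod L = x rmod (L :: real)"
proof -
  assume "L > 0"
  moreover from this have "(x + L) / L = x / L + 1" by (simp add: field_simps)
  ultimately show ?thesis by (simp add: rmod_conv_frac frac_1_eq)
qed

lemma rmod_in: "L > 0 \<Longrightarrow> x rmod (L :: real) \<in> {0..L}"
  using rmod_less[of L x] rmod_nonneg[of L x] by auto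

lemma rmod_eq_in_period:
  assumes "L > 0" "of_int k * L \<le> x" "x < of_int k * L + L"
  shows "x rmod L = x - of_int k * (L :: real)"
proof -
  have "\<lfloor>x / L\<rfloor> = k" using assms by (intro floor_unique) (auto simp: field_simps)
  then show ?thesis using assms(1) by (simp add: rmod_conv_frac frac_def algebra_simps)
qed

lemma periodic_extension_in_period:
  fixes f :: "real \<Rightarrow> 'a"
  assumes "L > 0" "f L = f 0" "of_int k * L \<le> x" "x \<le> of_int k * L + L"
  shows "f (x rmod L) = f (x - of_int k * L)"
proof (cases "x = of_int k * L + L")
  case True
  then have "x rmod L = x - of_int (k + 1) * L"
    using assms(1) by (intro rmod_eq_in_period) (auto simp: algebra_simps)
  then show ?thesis using True assms(2) by (simp add: algebra_simps)
next
  case False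
  then show ?thesis using rmod_eq_in_period[OF assms(1,3)] assms(4) by simp
qed

text \<open>On each closed period the extension is a translate of \<open>f\<close>. At multiples of
  \<open>L\<close> the two one-sided derivatives come from neighbouring periods and agree by
  \<open>g L = g 0\<close>.\<close>

lemma DERIV_periodic_extension:
  assumes L: "L > 0" and f: "\<And>s. s \<in> {0..L} \<Longrightarrow> (f has_real_derivative g s) (at s within {0..L})"
    and per: "f L = f 0" "g L = g 0"
  shows "((\<lambda>x. f (x rmod L)) has_real_derivative g (x rmod L)) (at x)"
proof -
  have piece: "((\<lambda>x. f (x rmod L)) has_real_derivative g (x rmod L))
      (at x within {of_int k * L..of_int k * L + L})"
    if x: "of_int k * L \<le> x" "x \<le> of_int k * L + L" for k
  proof -
    have "((\<lambda>x. f (x - of_int k * L)) has_real_derivative g (x - of_int k * L) * 1)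
      (at x within {of_int k * L..of_int k * L + L})"
    proof (rule DERIV_image_chain[unfolded o_def, where f = f and g = "\<lambda>x. x - of_int k * L"])
      show "((\<lambda>x. x - of_int k * L) has_real_derivative 1)
          (at x within {of_int k * L..of_int k * L + L})"
        by (auto intro!: derivative_eq_intros)
      have "(\<lambda>x. x - of_int k * L) ` {of_int k * L..of_int k * L + L} \<subseteq> {0..L}" by auto
      then show "(f has_real_derivative g (x - of_int k * L)) (at (x - of_int k * L) within
          (\<lambda>x. x - of_int k * L) ` {of_int k * L..of_int k * L + L})"
        by (rule DERIV_subset[OF f, rotated]) (use x in auto)
    qed
    then have "((\<lambda>x. f (x - of_int k * L)) has_real_derivative g (x - of_int k * L))
      (at x within {of_int k * L..of_int k * L + L})" by simp
    then have "((\<lambda>x. f (x rmod L)) has_real_derivative g (x - of_int k * L))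
      (at x within {of_int k * L..of_int k * L + L})"
    proof (rule has_field_derivative_transform_within[OF _ zero_less_one])
      show "f (y - of_int k * L) = f (y rmod L)" if "y \<in> {of_int k * L..of_int k * L + L}" for y
        using periodic_extension_in_period[of L f k y, OF L per(1)] that by simp
    qed (use x in simp)
    then show ?thesis using periodic_extension_in_period[of L g k x, OF L per(2) x] by simp
  qed
  define k where "k = \<lfloor>x / L\<rfloor>"
  have k: "of_int k * L \<le> x" "x < of_int k * L + L"
    using floor_divide_lower[OF L, of x] floor_divide_upper[OF L, of x]
    by (auto simp: k_def algebra_simps)
  define D where "D = (\<lambda>y. (f (y rmod L) - f (x rmod L)) / (y - x))"
  have right: "(D \<longlongrightarrow> g (x rmod L)) (at_right x)"
  proof -
    have "(D \<longlongrightarrow> g (x rmod L)) (at x within {of_int k * L..of_int k * L + L})"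
      unfolding D_def using piece[of k] k by (simp add: has_field_derivative_iff)
    then have "(D \<longlongrightarrow> g (x rmod L)) (at x within {x..of_int k * L + L})"
      by (rule tendsto_within_subset) (use k in auto)
    then show ?thesis using at_within_Icc_at_right[OF k(2)] by simp
  qed
  moreover have "(D \<longlongrightarrow> g (x rmod L)) (at_left x)"
  proof -
    obtain k' where k': "of_int k' * L < x" "x \<le> of_int k' * L + L"
    proof (cases "of_int k * L = x")
      case True
      then show ?thesis using that[of "k - 1"] L by (simp add: algebra_simps)
    next
      case False
      then show ?thesis using that[of k] k by simp
    qed
    have "(D \<longlongrightarrow> g (x rmod L)) (at x within {of_int k' * L..of_int k' * L + L})"
      unfolding D_def using piece[of k'] k' by (simp add: has_field_derivative_iff)
    then have "(D \<longlongrightarrow> g (x rmod L)) (at x within {of_int k' * L..x})"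
      by (rule tendsto_within_subset) (use k' in auto)
    then show ?thesis using at_within_Icc_at_left[OF k'(1)] by simp
  qed
  ultimately have "(D \<longlongrightarrow> g (x rmod L)) (at x)" by (intro filterlim_split_at)
  then show ?thesis by (simp add: has_field_derivative_iff D_def)
qed

text \<open>Two adjacent closed periods cover a neighbourhood in space of any point, and on their
  union continuity follows by gluing the two translates.\<close>

lemma continuous_on_periodic_extension:
  fixes g :: "real \<Rightarrow> real \<Rightarrow> real"
  assumes L: "L > 0" and cont: "continuous_on ({0..} \<times> {0..L}) (\<lambda>(t, s). g t s)"
    and per: "\<And>t. 0 \<le> t \<Longrightarrow> g t L = g t 0"
  shows "continuous_on ({0..} \<times> UNIV) (\<lambda>(t, x). g t (x rmod L))"
proof -
  define h where "h = (\<lambda>z. g (fst z) (snd z rmod L))"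
  have piece: "continuous_on ({0..} \<times> {of_int k * L..of_int k * L + L}) h" for k
  proof -
    have "continuous_on ({0..} \<times> {of_int k * L..of_int k * L + L})
        (\<lambda>z. case (fst z, snd z - of_int k * L) of (t, s) \<Rightarrow> g t s)"
      by (rule continuous_on_compose2[OF cont]) (auto intro!: continuous_intros)
    then show ?thesis
    proof (rule continuous_on_eq)
      fix z :: "real \<times> real" assume "z \<in> {0..} \<times> {of_int k * L..of_int k * L + L}"
      then show "(case (fst z, snd z - of_int k * L) of (t, s) \<Rightarrow> g t s) = h z"
        using periodic_extension_in_period[of L "g (fst z)" k "snd z", OF L per] by (auto simp: h_def)
    qed
  qed
  have "continuous (at (t, x) within {0..} \<times> UNIV) h" if t: "0 \<le> t" for t x
  proof -
    define k where "k = \<lfloor>x / L\<rfloor>"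
    have k: "of_int k * L \<le> x" "x < of_int k * L + L"
      using floor_divide_lower[OF L, of x] floor_divide_upper[OF L, of x]
      by (auto simp: k_def algebra_simps)
    let ?S = "{0..} \<times> {of_int (k - 1) * L..of_int (k - 1) * L + L} \<union>
      {0..} \<times> {of_int k * L..of_int k * L + L}"
    let ?U = "UNIV \<times> {of_int k * L - L<..<of_int k * L + L}"
    have "continuous_on ?S h"
      by (intro continuous_on_closed_Un piece closed_Times) auto
    moreover have "(t, x) \<in> ?S" using t k by auto
    ultimately have "continuous (at (t, x) within ?S) h"
      by (simp only: continuous_on_eq_continuous_within)
    moreover have "at (t, x) within ?S = at (t, x) within {0..} \<times> UNIV"
      by (rule at_within_nhd[where S = ?U]) (use k L in \<open>auto simp: open_Times algebra_simps\<close>)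
    ultimately show ?thesis by simp
  qed
  then show ?thesis
    by (auto simp: continuous_on_eq_continuous_within h_def case_prod_unfold)
qed


subsection \<open>The matrix of the nonlocal multipliers\<close>

lemma det_Pi_matrix:
  "det (Pi_matrix L f) = integral {0..L} (\<lambda>s. (sin (f s))\<^sup>2) * integral {0..L} (\<lambda>s. (cos (f s))\<^sup>2)
     - (integral {0..L} (\<lambda>s. cos (f s) * sin (f s)))\<^sup>2"
  by (simp add: Pi_matrix_def det_2 power2_eq_square)

lemma continuous_nonneg_integral_zero:
  fixes f :: "real \<Rightarrow> real"
  assumes "a < b" "continuous_on {a..b} f" "\<And>x. x \<in> {a..b} \<Longrightarrow> 0 \<le> f x" "integral {a..b} f = 0"
    and "x \<in> {a..b}"
  shows "f x = 0"
proof -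
  have "(f has_integral 0) (cbox a b)"
    using integrable_integral[OF integrable_continuous_real[OF assms(2)]] assms(4) by simp
  then show ?thesis
    using has_integral_0_cbox_imp_0[of a b f x] assms by auto
qed

text \<open>Up to the sign of the off-diagonal entries this is the Gram matrix of
  \<open>sin f\<close> and \<open>cos f\<close>, so a vanishing determinant is the equality case of
  the Cauchy-Schwarz inequality. The quadratic form is the integral of
  \<open>(p * sin f + q * cos f)\<^sup>2\<close>.\<close>

lemma det_Pi_matrix_eq_0:
  assumes L: "L > 0" and f: "continuous_on {0..L} f" and det: "det (Pi_matrix L f) = 0"
  obtains p q where "p \<noteq> 0 \<or> q \<noteq> 0" "\<And>s. s \<in> {0..L} \<Longrightarrow> p * sin (f s) + q * cos (f s) = 0"
proof -
  define S where "S = integral {0..L} (\<lambda>s. (sin (f s))\<^sup>2)"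
  define C where "C = integral {0..L} (\<lambda>s. (cos (f s))\<^sup>2)"
  define X where "X = integral {0..L} (\<lambda>s. cos (f s) * sin (f s))"
  have int: "g integrable_on {0..L}" if "continuous_on {0..L} g" for g :: "real \<Rightarrow> real"
    using that by (rule integrable_continuous_real)
  have quad: "p * sin (f s) + q * cos (f s) = 0"
    if "p\<^sup>2 * S + 2 * p * q * X + q\<^sup>2 * C = 0" "s \<in> {0..L}" for p q s
  proof -
    have "((\<lambda>s. p\<^sup>2 * (sin (f s))\<^sup>2 + 2 * p * q * (cos (f s) * sin (f s)) + q\<^sup>2 * (cos (f s))\<^sup>2)
        has_integral (p\<^sup>2 * S + 2 * p * q * X + q\<^sup>2 * C)) {0..L}"
      unfolding S_def X_def C_def
      by (intro has_integral_add has_integral_mult_right integrable_integral int continuous_intros f)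
    moreover have "(\<lambda>s. p\<^sup>2 * (sin (f s))\<^sup>2 + 2 * p * q * (cos (f s) * sin (f s)) + q\<^sup>2 * (cos (f s))\<^sup>2) =
        (\<lambda>s. (p * sin (f s) + q * cos (f s))\<^sup>2)"
      by (simp add: fun_eq_iff power2_eq_square algebra_simps)
    ultimately have "integral {0..L} (\<lambda>s. (p * sin (f s) + q * cos (f s))\<^sup>2) = 0"
      using that(1) by (simp add: integral_unique)
    moreover have "continuous_on {0..L} (\<lambda>s. (p * sin (f s) + q * cos (f s))\<^sup>2)"
      by (intro continuous_intros f)
    ultimately have "(p * sin (f s) + q * cos (f s))\<^sup>2 = 0"
      using continuous_nonneg_integral_zero[of 0 L "\<lambda>s. (p * sin (f s) + q * cos (f s))\<^sup>2" s] L that(2)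
      by simp
    then show ?thesis by simp
  qed
  have SC: "S * C = X\<^sup>2" using det by (simp add: det_Pi_matrix S_def C_def X_def)
  show ?thesis
  proof (cases "C = 0 \<and> X = 0")
    case True
    then show ?thesis using quad[of 0 1] that[of 0 1] by simp
  next
    case False
    \<comment> \<open>The form vanishes at \<open>(C, - X)\<close> when
      \<open>S * C = X\<^sup>2\<close>; this vector is zero only in the case treated before.\<close>
    have "C\<^sup>2 * S + 2 * C * (- X) * X + (- X)\<^sup>2 * C = C * (S * C - X\<^sup>2)"
      by (simp add: power2_eq_square algebra_simps)
    then show ?thesis using quad[of C "- X"] that[of C "- X"] False SC by simp
  qed
qed

text \<open>Cramer's rule. \<open>matrix_inv\<close> is opaque, whereas this quotient shows
  continuity in time wherever the determinant is nonzero.\<close>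

lemma lambda_theta_eq:
  fixes L c \<beta> \<theta> \<rho>
  assumes inv: "invertible (Pi_matrix L \<theta>)"
  defines "S \<equiv> integral {0..L} (\<lambda>s. (sin (\<theta> s))\<^sup>2)"
    and "C \<equiv> integral {0..L} (\<lambda>s. (cos (\<theta> s))\<^sup>2)"
    and "X \<equiv> integral {0..L} (\<lambda>s. cos (\<theta> s) * sin (\<theta> s))"
    and "V1 \<equiv> integral {0..L} (\<lambda>s. cos (\<theta> s) * curvature L \<theta> s * \<beta> (\<rho> s) * (curvature L \<theta> s - c))"
    and "V2 \<equiv> integral {0..L} (\<lambda>s. sin (\<theta> s) * curvature L \<theta> s * \<beta> (\<rho> s) * (curvature L \<theta> s - c))"
  shows "lambda_theta L c \<beta> \<theta> \<rho> $ 1 = (C * V1 + X * V2) / (S * C - X\<^sup>2)"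
    and "lambda_theta L c \<beta> \<theta> \<rho> $ 2 = (X * V1 + S * V2) / (S * C - X\<^sup>2)"
proof -
  define l where "l = lambda_theta L c \<beta> \<theta> \<rho>"
  have det: "S * C - X\<^sup>2 \<noteq> 0"
    using inv by (simp add: invertible_det_nz det_Pi_matrix S_def C_def X_def)
  have "Pi_matrix L \<theta> ** matrix_inv (Pi_matrix L \<theta>) = mat 1"
    using inv unfolding invertible_def matrix_inv_def by (metis (mono_tags, lifting) someI_ex)
  then have "Pi_matrix L \<theta> *v l = vector [V1, V2]"
    by (simp add: l_def lambda_theta_def matrix_vector_mul_assoc V1_def V2_def)
  then have "(Pi_matrix L \<theta> *v l) $ 1 = V1" "(Pi_matrix L \<theta> *v l) $ 2 = V2" by simp_all
  then have V: "V1 = S * l $ 1 - X * l $ 2" "V2 = - X * l $ 1 + C * l $ 2"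
    by (simp_all add: matrix_vector_mult_def sum_2 Pi_matrix_def S_def C_def X_def)
  have "C * V1 + X * V2 = l $ 1 * (S * C - X\<^sup>2)" "X * V1 + S * V2 = l $ 2 * (S * C - X\<^sup>2)"
    unfolding V by (simp_all add: algebra_simps power2_eq_square)
  then show "lambda_theta L c \<beta> \<theta> \<rho> $ 1 = (C * V1 + X * V2) / (S * C - X\<^sup>2)"
    "lambda_theta L c \<beta> \<theta> \<rho> $ 2 = (X * V1 + S * V2) / (S * C - X\<^sup>2)"
    using det by (auto simp: l_def)
qed

subsection \<open>The curvature solves a linear parabolic equation\<close>

locale zero_spontaneous_curvature_flow =
  fixes L \<nu> \<mu> :: real and \<omega> :: int and \<beta> \<theta>0 \<rho>0 :: "real \<Rightarrow> real" and \<theta> \<rho> :: "real \<Rightarrow> real \<Rightarrow> real"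
  assumes L: "L > 0" and \<mu>: "\<mu> > 0" and \<beta>: "Cinf_on UNIV \<beta>" and \<beta>_pos: "\<beta> x > 0"
    and datum: "admissible_datum L \<nu> \<omega> \<theta>0 \<rho>0"
    and solution: "global_solution L \<mu> \<omega> 0 \<beta> \<theta>0 \<rho>0 \<theta> \<rho>"
begin

definition "\<kappa> t = curvature L (\<theta> t)"
definition "\<beta>1 = deriv_within UNIV \<beta>"
definition "\<beta>2 = deriv_within UNIV \<beta>1"
definition "l1 t = lambda_theta L 0 \<beta> (\<theta> t) (\<rho> t) $ 1"
definition "l2 t = lambda_theta L 0 \<beta> (\<theta> t) (\<rho> t) $ 2"
text \<open>One family of partial derivatives is fixed. In it \<open>D\<theta> 1 1\<close> is both
  the space derivative of \<open>D\<theta> 1 0\<close> and the time derivative of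
  \<open>D\<theta> 0 1\<close>, so the equation can be differentiated in space without a separate
  argument on exchanging derivatives.\<close>

definition "D\<theta> = (SOME D. (\<forall>t>0. \<forall>s\<in>{0..L}. D 0 0 t s = \<theta> t s) \<and>
  (\<forall>i j. continuous_on ({0<..} \<times> {0..L}) (\<lambda>(t, s). D i j t s) \<and>
    (\<forall>t>0. \<forall>s\<in>{0..L}. ((\<lambda>\<tau>. D i j \<tau> s) has_real_derivative D (Suc i) j t s) (at t) \<and>
      (D i j t has_real_derivative D i (Suc j) t s) (at s within {0..L}))))"
definition "D\<rho> = (SOME D. (\<forall>t>0. \<forall>s\<in>{0..L}. D 0 0 t s = \<rho> t s) \<and>
  (\<forall>i j. continuous_on ({0<..} \<times> {0..L}) (\<lambda>(t, s). D i j t s) \<and>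
    (\<forall>t>0. \<forall>s\<in>{0..L}. ((\<lambda>\<tau>. D i j \<tau> s) has_real_derivative D (Suc i) j t s) (at t) \<and>
      (D i j t has_real_derivative D i (Suc j) t s) (at s within {0..L}))))"

section \<open>The equations in terms of the chosen partial derivatives\<close>

lemma D\<theta>:
  assumes "0 < t" "s \<in> {0..L}"
  shows D\<theta>_00: "D\<theta> 0 0 t s = \<theta> t s"
    and D\<theta>_time: "((\<lambda>\<tau>. D\<theta> i j \<tau> s) has_real_derivative D\<theta> (Suc i) j t s) (at t)"
    and D\<theta>_space: "(D\<theta> i j t has_real_derivative D\<theta> i (Suc j) t s) (at s within {0..L})"
proof -
  have "Cinf_strip L \<theta>" using solution by (simp add: global_solution_def)
  from someI_ex[OF this[unfolded Cinf_strip_def]] assms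
  show "D\<theta> 0 0 t s = \<theta> t s" "((\<lambda>\<tau>. D\<theta> i j \<tau> s) has_real_derivative D\<theta> (Suc i) j t s) (at t)"
    "(D\<theta> i j t has_real_derivative D\<theta> i (Suc j) t s) (at s within {0..L})"
    unfolding D\<theta>_def[symmetric] by blast+
qed

lemma D\<rho>:
  assumes "0 < t" "s \<in> {0..L}"
  shows D\<rho>_00: "D\<rho> 0 0 t s = \<rho> t s"
    and D\<rho>_time: "((\<lambda>\<tau>. D\<rho> i j \<tau> s) has_real_derivative D\<rho> (Suc i) j t s) (at t)"
    and D\<rho>_space: "(D\<rho> i j t has_real_derivative D\<rho> i (Suc j) t s) (at s within {0..L})"
proof -
  have "Cinf_strip L \<rho>" using solution by (simp add: global_solution_def)
  from someI_ex[OF this[unfolded Cinf_strip_def]] assms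
  show "D\<rho> 0 0 t s = \<rho> t s" "((\<lambda>\<tau>. D\<rho> i j \<tau> s) has_real_derivative D\<rho> (Suc i) j t s) (at t)"
    "(D\<rho> i j t has_real_derivative D\<rho> i (Suc j) t s) (at s within {0..L})"
    unfolding D\<rho>_def[symmetric] by blast+
qed

lemma ends: "0 \<in> {0..L}" "L \<in> {0..L}" using L by auto

lemma \<theta>_space: "0 < t \<Longrightarrow> s \<in> {0..L} \<Longrightarrow> (\<theta> t has_real_derivative D\<theta> 0 1 t s) (at s within {0..L})"
  by (rule has_field_derivative_transform_within[OF D\<theta>_space[of t s 0 0, folded One_nat_def] zero_less_one])
    (simp_all add: D\<theta>_00)

lemma \<rho>_space: "0 < t \<Longrightarrow> s \<in> {0..L} \<Longrightarrow> (\<rho> t has_real_derivative D\<rho> 0 1 t s) (at s within {0..L})"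
  by (rule has_field_derivative_transform_within[OF D\<rho>_space[of t s 0 0, folded One_nat_def] zero_less_one])
    (simp_all add: D\<rho>_00)

lemma \<theta>_time: "0 < t \<Longrightarrow> s \<in> {0..L} \<Longrightarrow> ((\<lambda>\<tau>. \<theta> \<tau> s) has_real_derivative D\<theta> 1 0 t s) (at t)"
  by (rule has_field_derivative_transform_within_open[OF D\<theta>_time[of t s 0 0, folded One_nat_def]
        open_greaterThan[of 0]]) (simp_all add: D\<theta>_00)

lemma \<rho>_time: "0 < t \<Longrightarrow> s \<in> {0..L} \<Longrightarrow> ((\<lambda>\<tau>. \<rho> \<tau> s) has_real_derivative D\<rho> 1 0 t s) (at t)"
  by (rule has_field_derivative_transform_within_open[OF D\<rho>_time[of t s 0 0, folded One_nat_def]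
        open_greaterThan[of 0]]) (simp_all add: D\<rho>_00)

lemma dw_\<theta>: "0 < t \<Longrightarrow> s \<in> {0..L} \<Longrightarrow> deriv_within {0..L} (\<theta> t) s = D\<theta> 0 1 t s"
  using \<theta>_space by (intro deriv_within_eqI[OF L]) auto

lemma dw_\<rho>: "0 < t \<Longrightarrow> s \<in> {0..L} \<Longrightarrow> deriv_within {0..L} (\<rho> t) s = D\<rho> 0 1 t s"
  using \<rho>_space by (intro deriv_within_eqI[OF L]) auto

lemma dw_dw_\<rho>:
  assumes "0 < t" "s \<in> {0..L}"
  shows "deriv_within {0..L} (deriv_within {0..L} (\<rho> t)) s = D\<rho> 0 2 t s"
  using D\<rho>_space[OF assms, of 0 1] dw_\<rho>[OF assms(1)]
  by (intro deriv_within_eqI[OF L assms(2)]) (auto simp: numeral_2_eq_2)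

lemma \<kappa>_eq: "0 < t \<Longrightarrow> s \<in> {0..L} \<Longrightarrow> \<kappa> t s = D\<theta> 0 1 t s"
  by (simp add: \<kappa>_def curvature_def dw_\<theta>)

lemma DERIV_\<beta>: "(\<beta> has_real_derivative \<beta>1 x) (at x)"
proof -
  have "(deriv_within UNIV ^^ 0) \<beta> differentiable_on UNIV"
    using \<beta> Ck_on_diff_on[of 1 UNIV \<beta> 0] by (simp add: Cinf_on_def)
  then show ?thesis using deriv_within_works[of \<beta> UNIV x] by (simp add: \<beta>1_def)
qed

lemma DERIV_\<beta>1: "(\<beta>1 has_real_derivative \<beta>2 x) (at x)"
proof -
  have "(deriv_within UNIV ^^ 1) \<beta> differentiable_on UNIV"
    using \<beta> Ck_on_diff_on[of 2 UNIV \<beta> 1] by (simp add: Cinf_on_def)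
  then show ?thesis using deriv_within_works[of \<beta>1 UNIV x] by (simp add: \<beta>1_def \<beta>2_def)
qed

lemma cont_\<beta>: "continuous_on UNIV \<beta>" "continuous_on UNIV \<beta>1" "continuous_on UNIV \<beta>2"
proof -
  show "continuous_on UNIV \<beta>" "continuous_on UNIV \<beta>1"
    using DERIV_\<beta> DERIV_\<beta>1 by (meson DERIV_isCont continuous_at_imp_continuous_on)+
  have "continuous_on UNIV ((deriv_within UNIV ^^ 2) \<beta>)"
    using \<beta> by (simp add: Cinf_on_def Ck_on_def)
  then show "continuous_on UNIV \<beta>2" by (simp add: \<beta>1_def \<beta>2_def numeral_2_eq_2)
qed

lemma \<theta>_equation:
  assumes t: "0 < t" and s: "s \<in> {0..L}"
  shows "D\<theta> 1 0 t s = \<beta>1 (\<rho> t s) * D\<rho> 0 1 t s * D\<theta> 0 1 t s + \<beta> (\<rho> t s) * D\<theta> 0 2 t s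
    + l1 t * sin (\<theta> t s) - l2 t * cos (\<theta> t s)"
proof -
  have "((\<lambda>r. \<beta> (\<rho> t r) * D\<theta> 0 1 t r) has_real_derivative
      \<beta>1 (\<rho> t s) * D\<rho> 0 1 t s * D\<theta> 0 1 t s + D\<theta> 0 2 t s * \<beta> (\<rho> t s)) (at s within {0..L})"
    using DERIV_mult[OF DERIV_chain2[OF DERIV_\<beta> \<rho>_space[OF t s]] D\<theta>_space[OF t s, of 0 1]]
    by (simp add: numeral_2_eq_2)
  then have "deriv_within {0..L} (\<lambda>r. \<beta> (\<rho> t r) * (deriv_within {0..L} (\<theta> t) r - 0)) s =
      \<beta>1 (\<rho> t s) * D\<rho> 0 1 t s * D\<theta> 0 1 t s + D\<theta> 0 2 t s * \<beta> (\<rho> t s)"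
    by (rule deriv_within_eqI[OF L s]) (simp add: dw_\<theta>[OF t])
  moreover have "flow_equations L \<mu> 0 \<beta> \<theta> \<rho>" using solution by (simp add: global_solution_def)
  then have "deriv (\<lambda>\<tau>. \<theta> \<tau> s) t =
      deriv_within {0..L} (\<lambda>r. \<beta> (\<rho> t r) * (deriv_within {0..L} (\<theta> t) r - 0)) s
      + l1 t * sin (\<theta> t s) - l2 t * cos (\<theta> t s)"
    using t s unfolding flow_equations_def l1_def l2_def by blast
  ultimately show ?thesis using DERIV_imp_deriv[OF \<theta>_time[OF t s]] by simp
qed

lemma \<rho>_equation:
  assumes t: "0 < t" and s: "s \<in> {0..L}"
  shows "D\<rho> 1 0 t s = \<mu> * D\<rho> 0 2 t s - 1 / 2 * deriv \<beta> (\<rho> t s) * (D\<theta> 0 1 t s)\<^sup>2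
    - lambda_rho L 0 \<beta> (\<theta> t) (\<rho> t)"
proof -
  have "flow_equations L \<mu> 0 \<beta> \<theta> \<rho>" using solution by (simp add: global_solution_def)
  then have "deriv (\<lambda>\<tau>. \<rho> \<tau> s) t = \<mu> * (deriv_within {0..L} ^^ 2) (\<rho> t) s
      - 1 / 2 * deriv \<beta> (\<rho> t s) * (deriv_within {0..L} (\<theta> t) s - 0)\<^sup>2
      - lambda_rho L 0 \<beta> (\<theta> t) (\<rho> t)"
    using t s unfolding flow_equations_def by blast
  then show ?thesis
    using DERIV_imp_deriv[OF \<rho>_time[OF t s]] dw_dw_\<rho>[OF t s] dw_\<theta>[OF t s]
    by (simp add: numeral_2_eq_2)
qed

text \<open>This is the space derivative of \<open>\<theta>_equation\<close>. For
  \<open>c\<^sub>0 = 0\<close> the first part is a second derivative of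
  \<open>\<beta>(\<rho>) \<kappa>\<close>, and the multiplier terms acquire
  \<open>D\<theta> 0 1\<close> as a factor, so the result has no inhomogeneous term;
  \<open>\<rho>\<close> and the multipliers enter through the coefficients.\<close>

lemma curvature_equation:
  assumes t: "0 < t" and s: "s \<in> {0..L}"
  shows "D\<theta> 1 1 t s = \<beta> (\<rho> t s) * D\<theta> 0 3 t s + 2 * \<beta>1 (\<rho> t s) * D\<rho> 0 1 t s * D\<theta> 0 2 t s
    + (\<beta>2 (\<rho> t s) * (D\<rho> 0 1 t s)\<^sup>2 + \<beta>1 (\<rho> t s) * D\<rho> 0 2 t s
      + l1 t * cos (\<theta> t s) + l2 t * sin (\<theta> t s)) * D\<theta> 0 1 t s"
proof -
  note d = DERIV_chain2[OF DERIV_\<beta> \<rho>_space[OF t s]] DERIV_chain2[OF DERIV_\<beta>1 \<rho>_space[OF t s]]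
    \<theta>_space[OF t s] D\<theta>_space[OF t s, of 0 1] D\<theta>_space[OF t s, of 0 2] D\<rho>_space[OF t s, of 0 1]
  have "((\<lambda>s. \<beta>1 (\<rho> t s) * D\<rho> 0 1 t s * D\<theta> 0 1 t s + \<beta> (\<rho> t s) * D\<theta> 0 2 t s
      + l1 t * sin (\<theta> t s) - l2 t * cos (\<theta> t s)) has_real_derivative
      (\<beta>2 (\<rho> t s) * D\<rho> 0 1 t s * D\<rho> 0 1 t s + D\<rho> 0 (Suc 1) t s * \<beta>1 (\<rho> t s)) * D\<theta> 0 1 t s
        + D\<theta> 0 (Suc 1) t s * (\<beta>1 (\<rho> t s) * D\<rho> 0 1 t s)
      + (\<beta>1 (\<rho> t s) * D\<rho> 0 1 t s * D\<theta> 0 2 t s + D\<theta> 0 (Suc 2) t s * \<beta> (\<rho> t s))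
      + l1 t * (cos (\<theta> t s) * D\<theta> 0 1 t s) - l2 t * (- sin (\<theta> t s) * D\<theta> 0 1 t s))
      (at s within {0..L})"
    by (intro DERIV_diff DERIV_add DERIV_mult DERIV_cmult DERIV_chain2[OF DERIV_sin]
        DERIV_chain2[OF DERIV_cos] d)
  then have "deriv_within {0..L} (D\<theta> 1 0 t) s =
      (\<beta>2 (\<rho> t s) * D\<rho> 0 1 t s * D\<rho> 0 1 t s + D\<rho> 0 (Suc 1) t s * \<beta>1 (\<rho> t s)) * D\<theta> 0 1 t s
        + D\<theta> 0 (Suc 1) t s * (\<beta>1 (\<rho> t s) * D\<rho> 0 1 t s)
      + (\<beta>1 (\<rho> t s) * D\<rho> 0 1 t s * D\<theta> 0 2 t s + D\<theta> 0 (Suc 2) t s * \<beta> (\<rho> t s))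
      + l1 t * (cos (\<theta> t s) * D\<theta> 0 1 t s) - l2 t * (- sin (\<theta> t s) * D\<theta> 0 1 t s)"
    by (rule deriv_within_eqI[OF L s]) (rule \<theta>_equation[OF t])
  moreover have "deriv_within {0..L} (D\<theta> 1 0 t) s = D\<theta> 1 1 t s"
    using D\<theta>_space[OF t s, of 1 0] by (intro deriv_within_eqI[OF L s]) auto
  moreover have "Suc 1 = 2" "Suc 2 = 3" by simp_all
  ultimately show ?thesis by (simp only:) (simp add: algebra_simps power2_eq_square)
qed

lemma boundary:
  assumes t: "0 < t"
  shows "\<theta> t L = \<theta> t 0 + 2 * pi * of_int \<omega>" "\<rho> t L = \<rho> t 0"
    "D\<theta> 0 1 t L = D\<theta> 0 1 t 0" "D\<rho> 0 1 t L = D\<rho> 0 1 t 0"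
proof -
  have b: "boundary_conditions L \<omega> \<theta> \<rho>" using solution by (simp add: global_solution_def)
  show "\<theta> t L = \<theta> t 0 + 2 * pi * of_int \<omega>" "\<rho> t L = \<rho> t 0"
    using b t by (auto simp: boundary_conditions_def algebra_simps)
  show "D\<theta> 0 1 t L = D\<theta> 0 1 t 0" "D\<rho> 0 1 t L = D\<rho> 0 1 t 0"
    using b t dw_\<theta>[OF t] dw_\<rho>[OF t] ends by (auto simp: boundary_conditions_def)
qed

lemma boundary_trig:
  assumes t: "0 < t"
  shows "sin (\<theta> t L) = sin (\<theta> t 0)" "cos (\<theta> t L) = cos (\<theta> t 0)"
  by (simp_all add: boundary(1)[OF t] sin_add cos_add)

lemma time_derivative_periodic:
  assumes t: "0 < t" and f: "(f has_real_derivative a) (at t)" "(g has_real_derivative b) (at t)"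
    and eq: "\<And>\<tau>. 0 < \<tau> \<Longrightarrow> f \<tau> = g \<tau> + c"
  shows "a = b"
proof -
  have "((\<lambda>\<tau>. g \<tau> + c) has_real_derivative b) (at t)"
    using DERIV_add[OF f(2) DERIV_const[of c]] by simp
  then have "(f has_real_derivative b) (at t)"
    by (rule has_field_derivative_transform_within_open[of _ _ _ "{0<..}"]) (use t eq in auto)
  then show ?thesis using f(1) by (rule DERIV_unique[symmetric])
qed

text \<open>The boundary conditions give periodicity of the higher space derivatives through the equations,
  because the time derivatives are periodic.\<close>

lemma boundary_higher:
  assumes t: "0 < t"
  shows "D\<theta> 0 2 t L = D\<theta> 0 2 t 0" "D\<theta> 0 3 t L = D\<theta> 0 3 t 0"
proof -
  have "D\<theta> 1 0 t L = D\<theta> 1 0 t 0"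
    by (rule time_derivative_periodic[OF t \<theta>_time[OF t ends(2)] \<theta>_time[OF t ends(1)]])
      (rule boundary(1))
  then show 2: "D\<theta> 0 2 t L = D\<theta> 0 2 t 0"
    using \<theta>_equation[OF t ends(1)] \<theta>_equation[OF t ends(2)] boundary[OF t] boundary_trig[OF t]
      \<beta>_pos[of "\<rho> t 0"] by simp
  have "D\<rho> 1 0 t L = D\<rho> 1 0 t 0"
    by (rule time_derivative_periodic[OF t \<rho>_time[OF t ends(2)] \<rho>_time[OF t ends(1)], of 0])
      (simp add: boundary(2))
  then have \<rho>2: "D\<rho> 0 2 t L = D\<rho> 0 2 t 0"
    using \<rho>_equation[OF t ends(1)] \<rho>_equation[OF t ends(2)] boundary[OF t] \<mu> by simp
  have "D\<theta> 1 1 t L = D\<theta> 1 1 t 0"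
    by (rule time_derivative_periodic[OF t D\<theta>_time[OF t ends(2), of 0 1, folded One_nat_def]
          D\<theta>_time[OF t ends(1), of 0 1, folded One_nat_def], of 0])
      (simp add: boundary(3)[simplified])
  then show "D\<theta> 0 3 t L = D\<theta> 0 3 t 0"
    using curvature_equation[OF t ends(1)] curvature_equation[OF t ends(2)] boundary[OF t]
      boundary_trig[OF t] 2 \<rho>2 \<beta>_pos[of "\<rho> t 0"] by simp
qed

lemma initial: "s \<in> {0..L} \<Longrightarrow> \<theta> 0 s = \<theta>0 s"
  using solution by (simp add: global_solution_def)

text \<open>At time 0 this is a condition on the datum, as the boundary conditions concern
  \<open>t > 0\<close>.\<close>

lemma \<kappa>_periodic: "0 \<le> t \<Longrightarrow> \<kappa> t L = \<kappa> t 0"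
proof (cases "t = 0")
  case True
  have "Cinf_on {0..L} \<theta>0" using datum by (simp add: admissible_datum_def)
  then have "(deriv_within {0..L} ^^ 0) \<theta>0 differentiable_on {0..L}"
    using Ck_on_diff_on[of 1 "{0..L}" \<theta>0 0] by (simp add: Cinf_on_def)
  then have "\<kappa> 0 s = deriv_within {0..L} \<theta>0 s" if "s \<in> {0..L}" for s
    unfolding \<kappa>_def curvature_def using initial by (intro deriv_within_cong[OF L that]) auto
  moreover have "deriv_within {0..L} \<theta>0 L = deriv_within {0..L} \<theta>0 0"
    using datum by (simp add: admissible_datum_def)
  ultimately show ?thesis using True ends by simp
next
  case False
  assume "0 \<le> t"
  then show ?thesis using False \<kappa>_eq ends boundary(3)[of t] by simp
qed

section \<open>Continuity and nondegeneracy down to time zero\<close>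

abbreviation "strip \<equiv> {0..} \<times> {0..L}"

lemma cont_C2:
  shows cont_\<theta>: "continuous_on strip (\<lambda>z. \<theta> (fst z) (snd z))"
    and cont_\<kappa>: "continuous_on strip (\<lambda>z. \<kappa> (fst z) (snd z))"
    and cont_\<rho>: "continuous_on strip (\<lambda>z. \<rho> (fst z) (snd z))"
    and cont_\<rho>1: "continuous_on strip (\<lambda>z. deriv_within {0..L} (\<rho> (fst z)) (snd z))"
    and cont_\<rho>2: "continuous_on strip
      (\<lambda>z. deriv_within {0..L} (deriv_within {0..L} (\<rho> (fst z))) (snd z))"
proof -
  have "C0_C2 L \<theta>" "C0_C2 L \<rho>" using solution by (auto simp: global_solution_def)
  note * = C0_C2_continuous[OF L this(1)] C0_C2_continuous[OF L this(2)]
  show "continuous_on strip (\<lambda>z. \<theta> (fst z) (snd z))" using *(1)[of 0] by (simp add: case_prod_unfold)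
  show "continuous_on strip (\<lambda>z. \<kappa> (fst z) (snd z))"
    using *(1)[of 1] by (simp add: case_prod_unfold \<kappa>_def curvature_def)
  show "continuous_on strip (\<lambda>z. \<rho> (fst z) (snd z))" using *(2)[of 0] by (simp add: case_prod_unfold)
  show "continuous_on strip (\<lambda>z. deriv_within {0..L} (\<rho> (fst z)) (snd z))"
    using *(2)[of 1] by (simp add: case_prod_unfold)
  show "continuous_on strip (\<lambda>z. deriv_within {0..L} (deriv_within {0..L} (\<rho> (fst z))) (snd z))"
    using *(2)[of 2] by (simp add: case_prod_unfold numeral_2_eq_2)
qed

lemma cont_integral:
  fixes f :: "real \<Rightarrow> real \<Rightarrow> real"
  assumes "continuous_on strip (\<lambda>z. f (fst z) (snd z))"
  shows "continuous_on {0..} (\<lambda>t. integral {0..L} (f t))"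
  using integral_continuous_on_param[of "{0..}" 0 L f] assms by (simp add: case_prod_unfold)

lemma cont_slice_\<theta>:
  assumes "0 \<le> t"
  shows "continuous_on {0..L} (\<theta> t)"
proof -
  have "continuous_on {0..L} (\<lambda>s. (t, s))" by (intro continuous_intros)
  from continuous_on_compose2[OF cont_\<theta> this] show ?thesis using assms by fastforce
qed

text \<open>For \<open>t > 0\<close> this is part of the flow equations. At \<open>t = 0\<close> a
  degenerate matrix would keep the tangent \<open>(cos \<theta>, sin \<theta>)\<close> parallel to a
  fixed line; its component \<open>e\<close> along that line, up to a factor, never vanishes, yet
  integrates to zero as the curve is closed.\<close>

lemma det_nonzero: "0 \<le> t \<Longrightarrow> det (Pi_matrix L (\<theta> t)) \<noteq> 0"
proof (cases "t = 0")
  case False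
  assume "0 \<le> t"
  then have "invertible (Pi_matrix L (\<theta> t))"
    using False solution by (auto simp: global_solution_def flow_equations_def)
  then show ?thesis by (simp add: invertible_det_nz)
next
  case True
  show ?thesis
  proof
    assume "det (Pi_matrix L (\<theta> t)) = 0"
    then obtain p q where pq: "p \<noteq> 0 \<or> q \<noteq> 0"
      and zero: "\<And>s. s \<in> {0..L} \<Longrightarrow> p * sin (\<theta> t s) + q * cos (\<theta> t s) = 0"
      using det_Pi_matrix_eq_0[OF L cont_slice_\<theta>, of t] True by auto
    define e where "e = (\<lambda>s. q * sin (\<theta> t s) - p * cos (\<theta> t s))"
    have cont: "continuous_on {0..L} e"
      unfolding e_def using cont_slice_\<theta>[of t] True by (intro continuous_intros) auto
    have e_nz: "e s \<noteq> 0" if "s \<in> {0..L}" for s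
    proof
      assume "e s = 0"
      have "(p\<^sup>2 + q\<^sup>2) * ((sin (\<theta> t s))\<^sup>2 + (cos (\<theta> t s))\<^sup>2) =
          (p * sin (\<theta> t s) + q * cos (\<theta> t s))\<^sup>2 + (e s)\<^sup>2"
        unfolding e_def by algebra
      also have "\<dots> = 0" using zero[OF that] \<open>e s = 0\<close> by simp
      finally show False using pq by (simp add: sum_power2_eq_zero_iff)
    qed
    have "integral {0..L} (\<lambda>s. sin (\<theta>0 s)) = 0" "integral {0..L} (\<lambda>s. cos (\<theta>0 s)) = 0"
      using datum by (auto simp: admissible_datum_def)
    moreover have "integral {0..L} (\<lambda>s. g (\<theta> t s)) = integral {0..L} (\<lambda>s. g (\<theta>0 s))"
      for g :: "real \<Rightarrow> real"
      by (rule integral_cong) (simp add: True initial)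
    ultimately have int: "integral {0..L} (\<lambda>s. sin (\<theta> t s)) = 0" "integral {0..L} (\<lambda>s. cos (\<theta> t s)) = 0"
      by auto
    have "((\<lambda>s. q * sin (\<theta> t s) - p * cos (\<theta> t s)) has_integral
        q * integral {0..L} (\<lambda>s. sin (\<theta> t s)) - p * integral {0..L} (\<lambda>s. cos (\<theta> t s))) {0..L}"
      using cont_slice_\<theta>[of t] True
      by (intro has_integral_diff has_integral_mult_right integrable_integral
          integrable_continuous_real continuous_intros) auto
    then have int_e: "integral {0..L} e = 0" using int by (simp add: e_def integral_unique)
    define \<sigma> where "\<sigma> = sgn (e 0)"
    have "0 \<le> \<sigma> * e s" if s: "s \<in> {0..L}" for s
    proof (rule ccontr)
      assume neg: "\<not> ?thesis"
      then have "e 0 * e s < 0" using e_nz[OF ends(1)] by (auto simp: \<sigma>_def sgn_if mult_less_0_iff split: if_splits)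
      moreover from this have "s \<noteq> 0" by (auto simp: mult_less_0_iff)
      moreover have "continuous_on {0..s} e" using s by (intro continuous_on_subset[OF cont]) auto
      ultimately obtain r where "0 < r" "r < s" "e r = 0" using IVT_sign[of 0 s e] s by auto
      then show False using e_nz[of r] s by auto
    qed
    moreover have "continuous_on {0..L} (\<lambda>s. \<sigma> * e s)" by (intro continuous_intros cont)
    ultimately have "\<sigma> * e 0 = 0"
      using continuous_nonneg_integral_zero[OF L, of "\<lambda>s. \<sigma> * e s" 0] int_e ends by simp
    then show False using e_nz[OF ends(1)] by (simp add: \<sigma>_def sgn_if split: if_splits)
  qed
qed

text \<open>With vanishing curvature \<open>\<theta> t\<close> is constant, and then the determinant
  of \<open>Pi_matrix\<close> is zero.\<close>

lemma nontrivial: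
  assumes t: "0 < t"
  obtains s where "s \<in> {0..L}" "\<kappa> t s \<noteq> 0"
proof -
  have False if zero: "\<And>s. s \<in> {0..L} \<Longrightarrow> \<kappa> t s = 0"
  proof -
    have "(\<theta> t has_real_derivative 0) (at s within {0..L})" if "s \<in> {0..L}" for s
      using \<theta>_space[OF t that] zero[OF that] \<kappa>_eq[OF t that] by simp
    then obtain c where c: "\<And>s. s \<in> {0..L} \<Longrightarrow> \<theta> t s = c"
      using has_field_derivative_zero_constant[of "{0..L}" "\<theta> t"] by auto
    have "integral {0..L} (\<lambda>s. g (\<theta> t s)) = L * g c" for g :: "real \<Rightarrow> real"
    proof -
      have "integral {0..L} (\<lambda>s. g (\<theta> t s)) = integral {0..L} (\<lambda>s. g c)"
        by (rule integral_cong) (simp add: c)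
      then show ?thesis using L by simp
    qed
    note int = this[of "\<lambda>x. (sin x)\<^sup>2"] this[of "\<lambda>x. (cos x)\<^sup>2"] this[of "\<lambda>x. cos x * sin x"]
    have "det (Pi_matrix L (\<theta> t)) = 0"
      unfolding det_Pi_matrix int by (simp add: power2_eq_square)
    then show False using det_nonzero[of t] t by simp
  qed
  then show ?thesis using that by blast
qed

text \<open>Cramer's formula defines \<open>m1\<close> and \<open>m2\<close> on all of
  \<open>{0..}\<close>, where its denominator is nonzero by \<open>det_nonzero\<close>. This is what
  bounds the zeroth order coefficient near the initial time.\<close>

lemma multipliers_continuous:
  obtains m1 m2 where "continuous_on {0..} m1" "continuous_on {0..} m2"
    "\<And>t. 0 < t \<Longrightarrow> l1 t = m1 t" "\<And>t. 0 < t \<Longrightarrow> l2 t = m2 t"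
proof -
  define S where "S = (\<lambda>t. integral {0..L} (\<lambda>s. (sin (\<theta> t s))\<^sup>2))"
  define C where "C = (\<lambda>t. integral {0..L} (\<lambda>s. (cos (\<theta> t s))\<^sup>2))"
  define X where "X = (\<lambda>t. integral {0..L} (\<lambda>s. cos (\<theta> t s) * sin (\<theta> t s)))"
  define V1 where "V1 = (\<lambda>t. integral {0..L} (\<lambda>s. cos (\<theta> t s) * \<kappa> t s * \<beta> (\<rho> t s) * (\<kappa> t s - 0)))"
  define V2 where "V2 = (\<lambda>t. integral {0..L} (\<lambda>s. sin (\<theta> t s) * \<kappa> t s * \<beta> (\<rho> t s) * (\<kappa> t s - 0)))"
  have "continuous_on strip (\<lambda>z. \<beta> (\<rho> (fst z) (snd z)))"
    by (rule continuous_on_compose2[OF cont_\<beta>(1) cont_\<rho>]) auto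
  then have cont: "continuous_on {0..} S" "continuous_on {0..} C" "continuous_on {0..} X"
    "continuous_on {0..} V1" "continuous_on {0..} V2"
    unfolding S_def C_def X_def V1_def V2_def
    by (intro cont_integral continuous_intros cont_\<theta> cont_\<kappa>; assumption)+
  have det: "S t * C t - (X t)\<^sup>2 \<noteq> 0" if "0 \<le> t" for t
    using det_nonzero[OF that] by (simp add: det_Pi_matrix S_def C_def X_def)
  show ?thesis
  proof (rule that)
    show "continuous_on {0..} (\<lambda>t. (C t * V1 t + X t * V2 t) / (S t * C t - (X t)\<^sup>2))"
      "continuous_on {0..} (\<lambda>t. (X t * V1 t + S t * V2 t) / (S t * C t - (X t)\<^sup>2))"
      using det by (intro continuous_intros cont; simp)+
    fix t :: real assume "0 < t"
    then have "invertible (Pi_matrix L (\<theta> t))"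
      using solution by (auto simp: global_solution_def flow_equations_def)
    from lambda_theta_eq[OF this, of 0 \<beta> "\<rho> t"]
    show "l1 t = (C t * V1 t + X t * V2 t) / (S t * C t - (X t)\<^sup>2)"
      "l2 t = (X t * V1 t + S t * V2 t) / (S t * C t - (X t)\<^sup>2)"
      by (simp_all only: l1_def l2_def S_def C_def X_def V1_def V2_def \<kappa>_def)
  qed
qed

lemma parabolic_curvature:
  "parabolic L (\<lambda>t x. \<kappa> t (x rmod L)) (\<lambda>t x. D\<theta> 0 2 t (x rmod L)) (\<lambda>t x. D\<theta> 0 3 t (x rmod L))"
proof
  show "\<kappa> t ((x + L) rmod L) = \<kappa> t (x rmod L)" for t x
    by (simp add: rmod_add_self[OF L])
  show "continuous_on ({0..} \<times> UNIV) (\<lambda>(t, x). \<kappa> t (x rmod L))"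
    by (rule continuous_on_periodic_extension[OF L _ \<kappa>_periodic])
      (use cont_\<kappa> in \<open>simp_all add: case_prod_unfold\<close>)
  show "((\<lambda>x. \<kappa> t (x rmod L)) has_real_derivative D\<theta> 0 2 t (x rmod L)) (at x)" if t: "0 < t" for t x
  proof -
    have "((\<lambda>x. D\<theta> 0 1 t (x rmod L)) has_real_derivative D\<theta> 0 2 t (x rmod L)) (at x)"
      using D\<theta>_space[OF t, of _ 0 1] boundary(3)[OF t] boundary_higher(1)[OF t]
      by (intro DERIV_periodic_extension[OF L]) (auto simp: numeral_2_eq_2)
    moreover have "(\<lambda>x. \<kappa> t (x rmod L)) = (\<lambda>x. D\<theta> 0 1 t (x rmod L))"
      using \<kappa>_eq[OF t] rmod_in[OF L] by auto
    ultimately show ?thesis by simp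
  qed
  show "((\<lambda>x. D\<theta> 0 2 t (x rmod L)) has_real_derivative D\<theta> 0 3 t (x rmod L)) (at x)" if t: "0 < t" for t x
    using D\<theta>_space[OF t, of _ 0 2] boundary_higher[OF t]
    by (intro DERIV_periodic_extension[OF L]) (auto simp: numeral_3_eq_3 numeral_2_eq_2)
  fix T :: real
  obtain m1 m2 where m: "continuous_on {0..} m1" "continuous_on {0..} m2"
    "\<And>t. 0 < t \<Longrightarrow> l1 t = m1 t" "\<And>t. 0 < t \<Longrightarrow> l2 t = m2 t"
    by (rule multipliers_continuous) (rule that)
  define \<rho>1 where "\<rho>1 = (\<lambda>t. deriv_within {0..L} (\<rho> t))"
  define \<rho>2 where "\<rho>2 = (\<lambda>t. deriv_within {0..L} (\<rho>1 t))"
  define a where "a = (\<lambda>z. \<beta> (\<rho> (fst z) (snd z)))"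
  define b where "b = (\<lambda>z. 2 * \<beta>1 (\<rho> (fst z) (snd z)) * \<rho>1 (fst z) (snd z))"
  define c where "c = (\<lambda>z. \<beta>2 (\<rho> (fst z) (snd z)) * (\<rho>1 (fst z) (snd z))\<^sup>2
    + \<beta>1 (\<rho> (fst z) (snd z)) * \<rho>2 (fst z) (snd z)
    + m1 (fst z) * cos (\<theta> (fst z) (snd z)) + m2 (fst z) * sin (\<theta> (fst z) (snd z)))"
  \<comment> \<open>The maximum keeps the set nonempty when \<open>T\<close> is negative.\<close>
  define K where "K = {0..max T 0} \<times> {0..L}"
  have K: "compact K" "K \<noteq> {}" "K \<subseteq> strip" using L by (auto simp: K_def intro: compact_Times)
  have \<beta>\<rho>: "continuous_on strip (\<lambda>z. f (\<rho> (fst z) (snd z)))"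
    if "continuous_on UNIV f" for f :: "real \<Rightarrow> real"
    by (rule continuous_on_compose2[OF that cont_\<rho>]) auto
  have m': "continuous_on strip (\<lambda>z. f (fst z))" if "continuous_on {0..} f" for f :: "real \<Rightarrow> real"
    by (rule continuous_on_compose2[OF that]) (auto intro!: continuous_intros)
  have ca: "continuous_on K a" and cb: "continuous_on K b" and cc: "continuous_on K c"
    unfolding a_def b_def c_def \<rho>1_def \<rho>2_def
    by (rule continuous_on_subset[OF _ K(3)],
        intro continuous_intros \<beta>\<rho> m' cont_\<beta> cont_\<theta> cont_\<rho>1 cont_\<rho>2 m(1,2))+
  have bdd: "\<exists>B. \<forall>z\<in>K. \<bar>f z\<bar> \<le> B" if "continuous_on K f" for f :: "real \<times> real \<Rightarrow> real"
    using compact_imp_bounded[OF compact_continuous_image[OF that K(1)]]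
    by (auto simp: bounded_iff)
  obtain Ba Bb Bc where B: "\<And>z. z \<in> K \<Longrightarrow> \<bar>a z\<bar> \<le> Ba" "\<And>z. z \<in> K \<Longrightarrow> \<bar>b z\<bar> \<le> Bb"
    "\<And>z. z \<in> K \<Longrightarrow> \<bar>c z\<bar> \<le> Bc"
    using bdd[OF ca] bdd[OF cb] bdd[OF cc] by blast
  obtain z0 where z0: "z0 \<in> K" "\<And>z. z \<in> K \<Longrightarrow> a z0 \<le> a z"
    using continuous_attains_inf[OF K(1,2) ca] by blast
  have a0: "0 < a z0" using \<beta>_pos by (simp add: a_def)
  have B0: "0 \<le> Ba" "0 \<le> Bb" "0 \<le> Bc"
    using B[OF z0(1)] abs_ge_zero order_trans by blast+
  \<comment> \<open>The sum dominates each upper bound; its summand \<open>1 / a z0\<close> provides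
    the lower bound of the leading coefficient, whose positive minimum is
    \<open>a z0\<close>.\<close>
  define C where "C = 1 / a z0 + Ba + Bb + Bc"
  have C: "0 < C" "1 / a z0 \<le> C" using a0 B0 by (auto simp: C_def intro!: add_pos_nonneg)
  have "1 / C \<le> a z0" using C a0 by (simp add: field_simps)
  show "\<exists>C>0. \<forall>t x. 0 < t \<longrightarrow> t \<le> T \<longrightarrow> (\<exists>a b c. 1 / C \<le> a \<and> a \<le> C \<and> \<bar>b\<bar> \<le> C \<and> \<bar>c\<bar> \<le> C \<and>
      ((\<lambda>\<tau>. \<kappa> \<tau> (x rmod L)) has_real_derivative
        a * D\<theta> 0 3 t (x rmod L) + b * D\<theta> 0 2 t (x rmod L) + c * \<kappa> t (x rmod L)) (at t))"
  proof (rule exI[of _ C], intro conjI allI impI C(1))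
    fix t x :: real assume t: "0 < t" "t \<le> T"
    define s where "s = x rmod L"
    have s: "s \<in> {0..L}" unfolding s_def by (rule rmod_in[OF L])
    have z: "(t, s) \<in> K" using t s by (auto simp: K_def)
    have "((\<lambda>\<tau>. D\<theta> 0 1 \<tau> s) has_real_derivative D\<theta> 1 1 t s) (at t)"
      using D\<theta>_time[OF t(1) s, of 0 1] by simp
    then have "((\<lambda>\<tau>. \<kappa> \<tau> s) has_real_derivative D\<theta> 1 1 t s) (at t)"
      by (rule has_field_derivative_transform_within_open[of _ _ _ "{0<..}"])
        (use t \<kappa>_eq s in auto)
    moreover have "D\<theta> 1 1 t s = a (t, s) * D\<theta> 0 3 t s + b (t, s) * D\<theta> 0 2 t s + c (t, s) * \<kappa> t s"
      using curvature_equation[OF t(1) s] dw_\<rho>[OF t(1) s] dw_dw_\<rho>[OF t(1) s] m(3,4)[OF t(1)] \<kappa>_eq[OF t(1) s]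
      by (simp add: a_def b_def c_def \<rho>1_def \<rho>2_def)
    moreover have "1 / C \<le> a (t, s)" using \<open>1 / C \<le> a z0\<close> z0(2)[OF z] by simp
    moreover have "a (t, s) \<le> C" "\<bar>b (t, s)\<bar> \<le> C" "\<bar>c (t, s)\<bar> \<le> C"
      using B[OF z] B0 zero_less_divide_1_iff[of "a z0"] a0 unfolding C_def by linarith+
    ultimately show "\<exists>a b c. 1 / C \<le> a \<and> a \<le> C \<and> \<bar>b\<bar> \<le> C \<and> \<bar>c\<bar> \<le> C \<and>
      ((\<lambda>\<tau>. \<kappa> \<tau> (x rmod L)) has_real_derivative
        a * D\<theta> 0 3 t (x rmod L) + b * D\<theta> 0 2 t (x rmod L) + c * \<kappa> t (x rmod L)) (at t)"
      unfolding s_def[symmetric] by metis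
  qed
qed (fact L)

section \<open>Transfer to the counts of zeros and of inflection points\<close>

sublocale curvature: parabolic L "\<lambda>t x. \<kappa> t (x rmod L)" "\<lambda>t x. D\<theta> 0 2 t (x rmod L)"
  "\<lambda>t x. D\<theta> 0 3 t (x rmod L)"
  by (rule parabolic_curvature)

lemma num_zeros_antimono:
  assumes t: "0 \<le> t1" "t1 \<le> t2"
  shows "num_zeros L (\<kappa> t2) \<le> num_zeros L (\<kappa> t1)"
proof (cases "t1 = t2 \<or> infinite {s \<in> {0..<L}. \<kappa> t1 s = 0}")
  case True
  then show ?thesis by (auto simp: num_zeros_def ecard_def)
next
  case False
  have eq: "{z \<in> {0..<L}. \<kappa> t (z rmod L) = 0} = {s \<in> {0..<L}. \<kappa> t s = 0}" for t
    using L by (auto simp: rmod_idem)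
  have "\<exists>x. \<kappa> t (x rmod L) \<noteq> 0" if t0: "0 < t" for t
  proof -
    \<comment> \<open>The point may be \<open>L\<close>, which \<open>rmod\<close> sends to 0;
      periodicity of the curvature covers this case.\<close>
    obtain s where s: "s \<in> {0..L}" "\<kappa> t s \<noteq> 0" by (rule nontrivial[OF t0])
    then have "\<kappa> t (s rmod L) \<noteq> 0"
      using \<kappa>_periodic[of t] t0 L by (cases "s = L") (auto simp: rmod_idem)
    then show ?thesis by blast
  qed
  from curvature.card_zeros_nonincreasing[OF this t(1), of t2, unfolded eq] False t
  show ?thesis by (auto simp: num_zeros_def ecard_def)
qed

text \<open>Each alternation at \<open>t2\<close> yields one of the same length at
  \<open>t1\<close>, so the sets under the suprema are nested; this covers infinite counts as
  well.\<close>

lemma num_inflection_points_antimono: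
  assumes t: "0 \<le> t1" "t1 \<le> t2"
  shows "num_inflection_points L (\<theta> t2) \<le> num_inflection_points L (\<theta> t1)"
proof -
  \<comment> \<open>The definition of the count numbers the points from 1, \<open>alternates\<close>
    from 0.\<close>
  have alt: "(\<exists>x :: nat \<Rightarrow> real. strict_mono_on {1..m + 1} x \<and> x (m + 1) = x 1 + L \<and>
      (\<forall>i\<in>{1..m}. periodic_extension L f (x i) * periodic_extension L f (x (i + 1)) < 0)) \<longleftrightarrow>
      (\<exists>x. alternates L (\<lambda>x. f (x rmod L)) m x)" (is "?l \<longleftrightarrow> ?r") for f m
  proof
    assume ?l
    then obtain x :: "nat \<Rightarrow> real" where x: "strict_mono_on {1..m + 1} x" "x (m + 1) = x 1 + L"
      "\<And>i. i \<in> {1..m} \<Longrightarrow> periodic_extension L f (x i) * periodic_extension L f (x (i + 1)) < 0"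
      by blast
    have "x (Suc i) < x (Suc (Suc i)) \<and> f (x (Suc i) rmod L) * f (x (Suc (Suc i)) rmod L) < 0"
      if "i < m" for i
      using strict_mono_onD[OF x(1), of "Suc i" "Suc (Suc i)"] x(3)[of "Suc i"] that
      by (simp add: periodic_extension_def)
    then have "alternates L (\<lambda>x. f (x rmod L)) m (\<lambda>i. x (Suc i))"
      using x(2) by (simp add: alternates_def)
    then show ?r by blast
  next
    assume ?r
    then obtain x where x: "alternates L (\<lambda>x. f (x rmod L)) m x" by blast
    have "strict_mono_on {1..m + 1} (\<lambda>i. x (i - 1))"
    proof (rule strict_mono_onI)
      fix i j :: nat assume ij: "i \<in> {1..m + 1}" "j \<in> {1..m + 1}" "i < j"
      have "i - 1 < m" using ij by auto
      then have "x (i - 1) < x (Suc (i - 1))" using x unfolding alternates_def by blast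
      also have "\<dots> \<le> x (j - 1)"
        using ij x by (intro increasing_le[of m x]) (auto simp: alternates_def)
      finally show "x (i - 1) < x (j - 1)" .
    qed
    moreover have "periodic_extension L f (x (i - 1)) * periodic_extension L f (x (i + 1 - 1)) < 0"
      if i: "i \<in> {1..m}" for i
    proof -
      obtain j where "i = Suc j" using \<open>i \<in> {1..m}\<close> by (cases i) auto
      then show ?thesis using x i by (simp add: alternates_def periodic_extension_def)
    qed
    moreover have "x (m + 1 - 1) = x (1 - 1) + L" using x by (simp add: alternates_def)
    ultimately show ?l by (intro exI[of _ "\<lambda>i. x (i - 1)"]) blast
  qed
  have "{enat m | m. \<exists>x. alternates L (\<lambda>x. \<kappa> t2 (x rmod L)) m x} \<subseteq>
      {enat m | m. \<exists>x. alternates L (\<lambda>x. \<kappa> t1 (x rmod L)) m x}"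
    using curvature.alternates_backward[OF t] by blast
  then show ?thesis
    unfolding num_inflection_points_def num_sign_changes_def alt \<kappa>_def[symmetric]
    by (rule Sup_subset_mono)
qed

end

theorem theorem1p2:
  fixes L \<nu> \<mu> c\<^sub>0 :: real and \<omega> :: int
    and \<beta> \<theta>\<^sub>0 \<rho>\<^sub>0 :: "real \<Rightarrow> real" and \<theta> \<rho> :: "real \<Rightarrow> real \<Rightarrow> real"
  assumes "L > 0" and "\<mu> > 0"
    and "Cinf_on UNIV \<beta>" and "\<And>x. \<beta> x > 0"
    and "c\<^sub>0 = 0"
    and "admissible_datum L \<nu> \<omega> \<theta>\<^sub>0 \<rho>\<^sub>0"
    and "global_solution L \<mu> \<omega> c\<^sub>0 \<beta> \<theta>\<^sub>0 \<rho>\<^sub>0 \<theta> \<rho>"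
  shows "antimono_on {0..} (\<lambda>t. num_zeros L (curvature L (\<theta> t))) \<and>
         antimono_on {0..} (\<lambda>t. num_inflection_points L (\<theta> t))"
proof -
  interpret zero_spontaneous_curvature_flow L \<nu> \<mu> \<omega> \<beta> \<theta>\<^sub>0 \<rho>\<^sub>0 \<theta> \<rho>
    by unfold_locales (use assms in auto)
  show ?thesis
    using num_zeros_antimono num_inflection_points_antimono
    by (auto simp: monotone_on_def \<kappa>_def)
qed

end
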